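(* Switch Set Cover parameterized by the number of colors and the number of switches is polynomial-time polynomial-parameter many-one reducible to $2$-Dimensional Eulerian Extension parameterized by the number of extension arcs (the maximum number of arcs in a solution).
   Context: Let $C$ be a finite set of colors; a $C$-position is a multiset of elements of $C$ and a $C$-switch is a multiset of $C$-positions. Switch Set Cover: given a set $C$ of $c$ colors and $k$ $C$-switches, can one choose exactly one position in each switch so that every color of $C$ lies in some chosen position? $d$-Dimensional Eulerian Extension: given a directed graph $G=(V,A)$ with $V\subset\mathbb Q^d$, is there a multiset $E$ of arcs such that $(V,A\cup E)$ has a closed trail traversing every arc exactly once and every vertex at least once and every $(u,v)\in E$ satisfies $u\ge v$ componentwise? Its parameter is the maximum $|E|$ over all such solutions $E$. A polynomial-time polynomial-parameter many-one reduction maps instances in polynomial time, preserves yes/no answers, and bounds the new parameter by a polynomial in the old one. *)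

theory Defs
  imports
    Complex_Main
    "HOL-Library.Multiset"
    "HOL-Computational_Algebra.Polynomial"
    "Graph_Theory.Graph_Theory"
begin

section \<open>Polynomial time\<close>

text \<open>
  The machine model is the multi-stack machine, written as structured programs. A program uses
  finitely many registers; each register is a stack over a fixed four-letter alphabet. One time
  unit pays for pushing or popping one symbol or for one test of a top symbol, where the value
  \<^term>\<open>None\<close> of the test stands for the empty stack. Two stacks are a tape and
  conversely, so this is the multi-tape Turing machine up to a constant factor in the running time.
\<close>

datatype symbol = Bit bool | Open | Close

type_synonym word = "symbol list"

datatype program =
    Push nat symbol
  | Pop nat
  | Seq program program
  | Branch nat "symbol option set" program program
  | Loop nat "symbol option set" program

type_synonym store = "nat \<Rightarrow> word"

definition top_symbol :: "word \<Rightarrow> symbol option" where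
  "top_symbol w = (case w of [] \<Rightarrow> None | a # _ \<Rightarrow> Some a)"

text \<open>\<open>run c s t s'\<close>: started in store \<open>s\<close>, program \<open>c\<close> halts after \<open>t\<close> time units in store \<open>s'\<close>.\<close>

inductive run :: "program \<Rightarrow> store \<Rightarrow> nat \<Rightarrow> store \<Rightarrow> bool" where
  push: "run (Push r a) s 1 (s(r := a # s r))"
| pop: "run (Pop r) s 1 (s(r := tl (s r)))"
| seq: "run c1 s m s' \<Longrightarrow> run c2 s' n s'' \<Longrightarrow> run (Seq c1 c2) s (m + n) s''"
| branch_true: "top_symbol (s r) \<in> X \<Longrightarrow> run c1 s n s' \<Longrightarrow> run (Branch r X c1 c2) s (n + 1) s'"
| branch_false: "top_symbol (s r) \<notin> X \<Longrightarrow> run c2 s n s' \<Longrightarrow> run (Branch r X c1 c2) s (n + 1) s'"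
| loop_exit: "top_symbol (s r) \<notin> X \<Longrightarrow> run (Loop r X c) s 1 s"
| loop_step: "top_symbol (s r) \<in> X \<Longrightarrow> run c s m s' \<Longrightarrow> run (Loop r X c) s' n s'' \<Longrightarrow>
    run (Loop r X c) s (m + n + 1) s''"

definition initial_store :: "word \<Rightarrow> store" where
  "initial_store w = (\<lambda>r. if r = 0 then w else [])"

text \<open>Input and output are in register 0; only the words in \<open>W\<close> count as inputs.\<close>

definition polytime_on :: "word set \<Rightarrow> (word \<Rightarrow> word) \<Rightarrow> bool" where
  "polytime_on W f \<longleftrightarrow>
     (\<exists>(c :: program) (p :: nat poly). \<forall>w\<in>W. \<exists>t s.
        run c (initial_store w) t s \<and> s 0 = f w \<and> t \<le> poly p (length w))"

section \<open>Parameterized problems and reductions\<close>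

text \<open>
  \<open>encodes P x w\<close> says that the word \<open>w\<close> is an encoding of the instance \<open>x\<close>. An instance involving
  sets or multisets has one encoding for every order in which these can be listed.
\<close>

record 'i param_problem =
  instances :: "'i set"
  is_yes :: "'i \<Rightarrow> bool"
  parameter :: "'i \<Rightarrow> nat"
  encodes :: "'i \<Rightarrow> word \<Rightarrow> bool"

definition codes :: "'i param_problem \<Rightarrow> word set" where
  "codes P = {w. \<exists>x\<in>instances P. encodes P x w}"

definition poly_param_reducible :: "'i param_problem \<Rightarrow> 'j param_problem \<Rightarrow> bool" where
  "poly_param_reducible P Q \<longleftrightarrow>
     (\<exists>(f :: word \<Rightarrow> word) (p :: nat poly).
        polytime_on (codes P) f \<and>
        (\<forall>x\<in>instances P. \<forall>w. encodes P x w \<longrightarrow>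
           (\<exists>y\<in>instances Q. encodes Q y (f w) \<and>
              (is_yes P x \<longleftrightarrow> is_yes Q y) \<and>
              parameter Q y \<le> poly p (parameter P x))))"

section \<open>Encodings\<close>

text \<open>Numbers are written in binary, least significant bit first, without leading zeros.\<close>

fun nat_bits :: "nat \<Rightarrow> bool list" where
  "nat_bits n = (if n = 0 then [] else odd n # nat_bits (n div 2))"

declare nat_bits.simps [simp del]

definition enc_nat :: "nat \<Rightarrow> word" where
  "enc_nat n = Open # map Bit (nat_bits n) @ [Close]"

definition enc_int :: "int \<Rightarrow> word" where
  "enc_int z = Open # Bit (z < 0) # map Bit (nat_bits (nat \<bar>z\<bar>)) @ [Close]"

definition enc_rat :: "rat \<Rightarrow> word" where
  "enc_rat q = enc_int (fst (quotient_of q)) @ enc_nat (nat (snd (quotient_of q)))"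

definition enc_list :: "('a \<Rightarrow> word) \<Rightarrow> 'a list \<Rightarrow> word" where
  "enc_list enc xs = Open # concat (map enc xs) @ [Close]"

definition enc_pair :: "('a \<Rightarrow> word) \<Rightarrow> ('b \<Rightarrow> word) \<Rightarrow> 'a \<times> 'b \<Rightarrow> word" where
  "enc_pair enc_a enc_b x = Open # enc_a (fst x) @ enc_b (snd x) @ [Close]"

section \<open>Switch Set Cover\<close>

text \<open>Colors are named by natural numbers, so that instances can be written down as words.\<close>

type_synonym color = nat
type_synonym position = "color multiset"
type_synonym switch = "position multiset"

definition is_position :: "color set \<Rightarrow> position \<Rightarrow> bool" where
  "is_position C p \<longleftrightarrow> set_mset p \<subseteq> C"

definition is_switch :: "color set \<Rightarrow> switch \<Rightarrow> bool" where
  "is_switch C S \<longleftrightarrow> (\<forall>p\<in>#S. is_position C p)"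

text \<open>The \<open>i\<close>-th entry of \<open>ps\<close> is the position chosen in the \<open>i\<close>-th switch.\<close>

definition switch_coverable :: "color set \<Rightarrow> switch list \<Rightarrow> bool" where
  "switch_coverable C Ss \<longleftrightarrow>
     (\<exists>ps. list_all2 (\<lambda>p S. p \<in># S) ps Ss \<and> (\<forall>c\<in>C. \<exists>p\<in>set ps. c \<in># p))"

definition switch_set_cover :: "(color set \<times> switch list) param_problem" where
  "switch_set_cover = \<lparr>
     instances = {(C, Ss). finite C \<and> (\<forall>S\<in>set Ss. is_switch C S)},
     is_yes = (\<lambda>(C, Ss). switch_coverable C Ss),
     parameter = (\<lambda>(C, Ss). card C + length Ss),
     encodes = (\<lambda>(C, Ss) w. \<exists>cs xs. distinct cs \<and> set cs = C \<and>
       map (\<lambda>x. mset (map mset x)) xs = Ss \<and>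
       w = enc_pair (enc_list enc_nat) (enc_list (enc_list (enc_list enc_nat))) (cs, xs)) \<rparr>"

section \<open>Eulerian Extension\<close>

text \<open>Points of \<open>d\<close>-dimensional rational space are lists of length \<open>d\<close>.\<close>

type_synonym point = "rat list"

text \<open>
  The multigraph with the arcs of \<open>G\<close> together with those of \<open>E\<close>, where an arc occurring in both
  counts separately. The \<open>i\<close>-th copy of the arc \<open>a\<close> is \<open>(a, i)\<close>.
\<close>

definition add_arcs ::
  "'a pair_pre_digraph \<Rightarrow> ('a \<times> 'a) multiset \<Rightarrow> ('a, ('a \<times> 'a) \<times> nat) pre_digraph" where
  "add_arcs G E = \<lparr>
     verts = pverts G,
     arcs = {(a, i). i < count (mset_set (parcs G) + E) a},
     tail = (\<lambda>(a, i). fst a),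
     head = (\<lambda>(a, i). snd a) \<rparr>"

definition has_closed_euler_trail :: "('a, 'b) pre_digraph \<Rightarrow> bool" where
  "has_closed_euler_trail H \<longleftrightarrow> (\<exists>u p. pre_digraph.euler_trail H u p u)"

text \<open>
  As in \<^locale>\<open>pair_digraph\<close>, arcs are not loops. If \<open>E\<close> could contain loops, these could be
  added to a solution without end and no solution would have the maximum number of arcs.
\<close>

definition is_extension :: "point pair_pre_digraph \<Rightarrow> (point \<times> point) multiset \<Rightarrow> bool" where
  "is_extension G E \<longleftrightarrow>
     (\<forall>(u, v)\<in>#E. u \<in> pverts G \<and> v \<in> pverts G \<and> u \<noteq> v \<and> list_all2 (\<ge>) u v) \<and>
     has_closed_euler_trail (add_arcs G E)"

definition eulerian_extension :: "nat \<Rightarrow> point pair_pre_digraph param_problem" where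
  "eulerian_extension d = \<lparr>
     instances = {G. pair_digraph G \<and> (\<forall>v\<in>pverts G. length v = d)},
     is_yes = (\<lambda>G. \<exists>E. is_extension G E),
     parameter = (\<lambda>G. if \<exists>E. is_extension G E then Max (size ` {E. is_extension G E}) else 0),
     encodes = (\<lambda>G w. \<exists>vs as. distinct vs \<and> set vs = pverts G \<and> distinct as \<and> set as = parcs G \<and>
       w = enc_pair (enc_list (enc_list enc_rat))
             (enc_list (enc_pair (enc_list enc_rat) (enc_list enc_rat))) (vs, as)) \<rparr>"

text \<open>The maximum in \<^const>\<open>eulerian_extension\<close> is over a finite set, since the arcs of an
  extension strictly decrease the sum of the coordinates, while the sum of the changes along a
  closed trail is 0.\<close>

lemma cas_telescope:
  fixes \<phi> :: "'a \<Rightarrow> rat"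
  shows "pre_digraph.cas H u p v \<Longrightarrow> (\<Sum>e\<leftarrow>p. \<phi> (tail H e) - \<phi> (head H e)) = \<phi> u - \<phi> v"
  by (induction p arbitrary: u) (auto simp: pre_digraph.cas.simps)

lemma copies_of_arcs:
  fixes g :: "'a \<Rightarrow> rat"
  shows "finite {(a, i). i < count M a} \<and> (\<Sum>x\<in>{(a, i). i < count M a}. g (fst x)) = (\<Sum>a\<in>#M. g a)"
proof (induction M)
  case empty
  then show ?case by simp
next
  case (add b M)
  have "{(a, i). i < count (add_mset b M) a} = insert (b, count M b) {(a, i). i < count M a}"
    by (auto simp: less_Suc_eq split: if_splits)
  then show ?case using add by simp
qed

lemma list_sum_strict:
  fixes u v :: "rat list"
  assumes "list_all2 (\<ge>) u v"
  shows "sum_list v \<le> sum_list u \<and> (u \<noteq> v \<longrightarrow> sum_list v < sum_list u)"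
  using assms by (induction rule: list_all2_induct) auto

lemma finite_extension_sizes:
  assumes "pair_digraph G"
  shows "finite (size ` {E. is_extension G E})"
proof -
  interpret pair_digraph G by fact
  define h :: "point \<times> point \<Rightarrow> rat" where "h a = sum_list (fst a) - sum_list (snd a)" for a
  define D where "D = {x \<in> h ` (pverts G \<times> pverts G). x > 0}"
  define \<delta> where "\<delta> = Min (insert 1 D)"
  have fD: "finite D"
    unfolding D_def using pair_finite_verts by simp
  have \<delta>: "\<delta> > 0" "\<And>x. x \<in> D \<Longrightarrow> \<delta> \<le> x"
    using fD by (auto simp: \<delta>_def D_def)
  define K where "K = - (\<Sum>a\<in>#mset_set (parcs G). h a)"
  have bound: "size E \<le> nat \<lceil>K / \<delta>\<rceil>" if E: "is_extension G E" for E
  proof -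
    let ?M = "mset_set (parcs G) + E" and ?H = "add_arcs G E"
    obtain u p where p: "pre_digraph.euler_trail ?H u p u"
      using E by (auto simp: is_extension_def has_closed_euler_trail_def)
    then have cas: "pre_digraph.cas ?H u p u" and d: "distinct p" and sp: "set p = arcs ?H"
      by (auto simp: pre_digraph.euler_trail_def pre_digraph.trail_def pre_digraph.awalk_def)
    have "(\<Sum>e\<leftarrow>p. h (fst e)) = 0"
      using cas_telescope[OF cas, of sum_list] by (simp add: h_def add_arcs_def case_prod_unfold)
    then have "(\<Sum>e\<in>set p. h (fst e)) = 0"
      using d by (simp add: sum_list_distinct_conv_sum_set)
    then have "(\<Sum>a\<in>#?M. h a) = 0"
      unfolding sp using copies_of_arcs[of ?M h] by (simp add: add_arcs_def)
    then have K: "(\<Sum>a\<in>#E. h a) = K"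
      by (simp add: K_def)
    have "\<delta> \<le> h a" if "a \<in># E" for a
    proof (rule \<delta>(2))
      show "h a \<in> D"
      proof -
        obtain x y where a: "a = (x, y)" by (cases a)
        then have "x \<in> pverts G" "y \<in> pverts G" "x \<noteq> y" "list_all2 (\<ge>) x y"
          using E that unfolding is_extension_def by blast+
        then show ?thesis
          using list_sum_strict[of x y] a unfolding D_def
          by (auto simp: h_def intro!: image_eqI[where x = "(x, y)"])
      qed
    qed
    then have "(\<Sum>a\<in>#E. \<delta>) \<le> (\<Sum>a\<in>#E. h a)"
      by (intro sum_mset_mono)
    then have "of_nat (size E) * \<delta> \<le> K"
      by (simp add: K)
    then have "of_nat (size E) \<le> K / \<delta>"
      using \<delta>(1) by (simp add: pos_le_divide_eq)
    then show ?thesis by linarith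
  qed
  then show ?thesis
    by (intro finite_subset[OF _ finite_atMost[of "nat \<lceil>K / \<delta>\<rceil>"]]) auto
qed

end

(* Idea. The graph consists of balanced components: one star per color, whose leaves are its
   occurrences in positions; one additional star, the hub, with one leaf per position; and, for
   each switch, a single arc from a sink to a source. In the plane, the vertices of a switch lie
   below its source and above its sink, its positions form an antichain of boxes, and inside a box the
   occurrences descend with the color. Vertices of different switches are incomparable. The extension
   arcs have to lead from each source to its sink, so they form one descending path per switch. This
   path meets at most one box, and connectivity with the hub forces it to meet one; it can visit the
   colors of the chosen position, each at most once. All components are connected iff the chosen
   positions cover all colors. Instead of decomposing the extension into paths, the proofs use that
   for every potential on the vertices the total drop along the extension arcs equals the total
   drop between the sources and the sinks.

   Duplicates of a color inside a position are made incomparable, since otherwise the length of the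
   paths would not be bounded in terms of the parameter. *)

theory Submission
  imports Defs
begin

section \<open>Stack programs\<close>

text \<open>The running time refers to a concrete machine, so the reduction has to be an explicit
  program, and this shapes the coordinates. Each coordinate is, as a bit list, a concatenation of
  words that the machine already holds in registers; writing a vertex is copying, and no arithmetic
  is performed. Levels are written in unary: one more bit passes to the next level, and levels
  exceed the input length by at most one, so numbers stay polynomially long. Orders are reversed by
  complementing a padded code or by writing a minus sign. Codes avoid 0 and the levels of switches
  start at 1, since the encoding admits neither leading zeros nor a negative zero. The block width
  \<open>W\<close> is the length of the input, a bound on codes and indices that the machine can
  produce by a single pass.

  The parameter of the target problem is a maximum, so its bound has to hold for all extensions, not
  only for those built from covers.\<close>

inductive_cases run_PushE: "run (Push r a) s t s'"
inductive_cases run_PopE: "run (Pop r) s t s'"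
inductive_cases run_SeqE: "run (Seq c1 c2) s t s'"
inductive_cases run_BranchE: "run (Branch r X c1 c2) s t s'"
inductive_cases run_LoopE: "run (Loop r X c) s t s'"

text \<open>Makes a program a partial function on words; the reduction is defined as the function of
  its program.\<close>

lemma run_deterministic: "run c s t s' \<Longrightarrow> run c s u s'' \<Longrightarrow> t = u \<and> s' = s''"
proof (induction arbitrary: u s'' rule: run.induct)
  case (push r a s)
  from push.prems show ?case by (rule run_PushE) simp
next
  case (pop r s)
  from pop.prems show ?case by (rule run_PopE) simp
next
  case (seq c1 s m s' c2 n s2)
  from seq.prems obtain m' s1' n' where
    "u = m' + n'" "run c1 s m' s1'" "run c2 s1' n' s''" by (rule run_SeqE)
  with seq.IH(1)[of m' s1'] seq.IH(2)[of n' s''] show ?case by simp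
next
  case (branch_true s r X c1 n s' c2)
  from branch_true.prems obtain n' where "u = n' + 1" "run c1 s n' s''"
    by (rule run_BranchE) (use branch_true.hyps(1) in simp_all)
  with branch_true.IH[of n' s''] show ?case by simp
next
  case (branch_false s r X c2 n s' c1)
  from branch_false.prems obtain n' where "u = n' + 1" "run c2 s n' s''"
    by (rule run_BranchE) (use branch_false.hyps(1) in simp_all)
  with branch_false.IH[of n' s''] show ?case by simp
next
  case (loop_exit s r X c)
  from loop_exit.prems show ?case
    by (rule run_LoopE) (use loop_exit.hyps in simp_all)
next
  case (loop_step s r X c m s' n s2)
  from loop_step.prems obtain m' s1' n' where
    "u = m' + n' + 1" "run c s m' s1'" "run (Loop r X c) s1' n' s''"
    by (rule run_LoopE) (use loop_step.hyps(1) in simp_all)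
  with loop_step.IH(1)[of m' s1'] loop_step.IH(2)[of n' s''] show ?case by simp
qed

text \<open>One time unit adds at most one symbol. Lengths of output words are bounded in this way
  by the running time and never computed.\<close>

lemma run_length_le: "run c s t s' \<Longrightarrow> length (s' r) \<le> length (s r) + t"
  by (induction rule: run.induct) auto

text \<open>Upper bounds on the time compose more easily than the exact times of
  \<open>run\<close>.\<close>

definition exec :: "program \<Rightarrow> store \<Rightarrow> store \<Rightarrow> nat \<Rightarrow> bool" where
  "exec c s s' T \<longleftrightarrow> (\<exists>t\<le>T. run c s t s')"

lemma execI: "run c s t s' \<Longrightarrow> t \<le> T \<Longrightarrow> exec c s s' T"
  unfolding exec_def by blast

lemma exec_mono: "exec c s s' T \<Longrightarrow> T \<le> T' \<Longrightarrow> exec c s s' T'"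
  unfolding exec_def using le_trans by blast

lemma exec_push: "exec (Push r a) s (s(r := a # s r)) 1"
  by (rule execI[OF run.push]) simp

lemma exec_pop: "exec (Pop r) s (s(r := tl (s r))) 1"
  by (rule execI[OF run.pop]) simp

lemma exec_seq:
  assumes "exec c1 s s' T1" "exec c2 s' s'' T2"
  shows "exec (Seq c1 c2) s s'' (T1 + T2)"
proof -
  obtain t1 t2 where "t1 \<le> T1" "run c1 s t1 s'" "t2 \<le> T2" "run c2 s' t2 s''"
    using assms unfolding exec_def by blast
  then show ?thesis
    using run.seq by (intro execI[of _ _ "t1 + t2"]) auto
qed

lemma exec_branch_True:
  assumes "top_symbol (s r) \<in> X" "exec c1 s s' T"
  shows "exec (Branch r X c1 c2) s s' (T + 1)"
proof -
  obtain t where "t \<le> T" "run c1 s t s'"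
    using assms(2) unfolding exec_def by blast
  then show ?thesis
    using run.branch_true[of s r, OF assms(1)] by (intro execI[of _ _ "t + 1"]) auto
qed

lemma exec_branch_False:
  assumes "top_symbol (s r) \<notin> X" "exec c2 s s' T"
  shows "exec (Branch r X c1 c2) s s' (T + 1)"
proof -
  obtain t where "t \<le> T" "run c2 s t s'"
    using assms(2) unfolding exec_def by blast
  then show ?thesis
    using run.branch_false[of s r, OF assms(1)] by (intro execI[of _ _ "t + 1"]) auto
qed

lemma exec_loop_exit:
  assumes "top_symbol (s r) \<notin> X"
  shows "exec (Loop r X c) s s 1"
  by (rule execI[OF run.loop_exit[of s r, OF assms]]) simp

lemma exec_loop_step:
  assumes "top_symbol (s r) \<in> X" "exec c s s' T1" "exec (Loop r X c) s' s'' T2"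
  shows "exec (Loop r X c) s s'' (T1 + T2 + 1)"
proof -
  obtain t1 t2 where "t1 \<le> T1" "run c s t1 s'" "t2 \<le> T2" "run (Loop r X c) s' t2 s''"
    using assms unfolding exec_def by blast
  then show ?thesis
    using run.loop_step[of s r, OF assms(1)] by (intro execI[of _ _ "t1 + t2 + 1"]) auto
qed

lemma top_symbol_simps [simp]: "top_symbol [] = None" "top_symbol (a # w) = Some a"
  by (auto simp: top_symbol_def)

definition skip :: program where
  "skip = Loop 0 {} (Pop 0)"

lemma exec_skip: "exec skip s s 1"
  unfolding skip_def by (rule exec_loop_exit) simp

fun seqs :: "program list \<Rightarrow> program" where
  "seqs [] = skip"
| "seqs (c # cs) = Seq c (seqs cs)"

lemma exec_seqs_Cons: "exec c s s' T1 \<Longrightarrow> exec (seqs cs) s' s'' T2 \<Longrightarrow> exec (seqs (c # cs)) s s'' (T1 + T2)"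
  by (simp add: exec_seq)

subsection \<open>Pouring one register into others\<close>

text \<open>\<open>Push\<close> takes a fixed symbol, so moving an unknown one requires a copy of
  the body for each of the four letters.\<close>

definition case_top :: "nat \<Rightarrow> (symbol \<Rightarrow> program) \<Rightarrow> program" where
  "case_top r body =
     Branch r {Some Open} (body Open)
       (Branch r {Some Close} (body Close)
         (Branch r {Some (Bit True)} (body (Bit True)) (body (Bit False))))"

lemma exec_case_top:
  assumes "s r = a # w" "exec (body a) s s' T"
  shows "exec (case_top r body) s s' (T + 3)"
proof -
  consider "a = Open" | "a = Close" | "a = Bit True" | "a = Bit False"
    by (metis (full_types) symbol.exhaust)
  then show ?thesis
  proof cases
    case 1
    then have "exec (case_top r body) s s' (T + 1)"
      using assms unfolding case_top_def by (intro exec_branch_True) auto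
    then show ?thesis by (rule exec_mono) simp
  next
    case 2
    then have "exec (case_top r body) s s' (T + 1 + 1)"
      using assms unfolding case_top_def by (intro exec_branch_False exec_branch_True) auto
    then show ?thesis by (rule exec_mono) simp
  next
    case 3
    then have "exec (case_top r body) s s' (T + 1 + 1 + 1)"
      using assms unfolding case_top_def
      by (intro exec_branch_False[where X = "{Some Open}"] exec_branch_False[where X = "{Some Close}"]
          exec_branch_True) auto
    then show ?thesis by (rule exec_mono) simp
  next
    case 4
    then have "exec (case_top r body) s s' (T + 1 + 1 + 1)"
      using assms unfolding case_top_def by (intro exec_branch_False) auto
    then show ?thesis by (rule exec_mono) simp
  qed
qed

text \<open>\<open>pour r X ds ps\<close> empties register \<open>r\<close> as long as the top symbol lies in \<open>X\<close>. Each symbol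
  \<open>a\<close> is pushed as \<open>h a\<close> onto \<open>d\<close> for all \<open>(d, h)\<close> in \<open>ds\<close>, and costs a symbol of each register
  in \<open>ps\<close>.\<close>

definition pour :: "nat \<Rightarrow> symbol set \<Rightarrow> (nat \<times> (symbol \<Rightarrow> symbol)) list \<Rightarrow> nat list \<Rightarrow> program" where
  "pour r X ds ps = Loop r (Some ` X)
     (case_top r (\<lambda>a. Seq (Pop r) (seqs (map (\<lambda>(d, h). Push d (h a)) ds @ map Pop ps))))"

definition poured ::
    "nat \<Rightarrow> (nat \<times> (symbol \<Rightarrow> symbol)) list \<Rightarrow> nat list \<Rightarrow> word \<Rightarrow> word \<Rightarrow> store \<Rightarrow> store" where
  "poured r ds ps u v s = (\<lambda>q. if q = r then v
     else case map_of ds q of Some h \<Rightarrow> rev (map h u) @ s q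
     | None \<Rightarrow> if q \<in> set ps then drop (length u) (s q) else s q)"

lemma exec_pushes_pops:
  assumes "distinct (map fst ds @ ps)"
  shows "exec (seqs (map (\<lambda>(d, h). Push d (h a)) ds @ map Pop ps)) s
     (\<lambda>q. case map_of ds q of Some h \<Rightarrow> h a # s q | None \<Rightarrow> if q \<in> set ps then tl (s q) else s q)
     (length ds + length ps + 1)"
  using assms
proof (induction ds arbitrary: s)
  case Nil
  then show ?case
  proof (induction ps arbitrary: s)
    case Nil
    then show ?case using exec_skip by simp
  next
    case (Cons p ps)
    let ?s = "s(p := tl (s p))"
    have "exec (seqs (map Pop (p # ps))) s (\<lambda>q. if q \<in> set ps then tl (?s q) else ?s q)
        (1 + (length ps + 1))"
      unfolding list.map by (rule exec_seqs_Cons[OF exec_pop]) (use Cons in simp)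
    also have "(\<lambda>q. if q \<in> set ps then tl (?s q) else ?s q) = (\<lambda>q. if q \<in> set (p # ps) then tl (s q) else s q)"
      using Cons.prems by (intro ext) auto
    finally show ?case by simp
  qed
next
  case (Cons dh ds)
  obtain d h where dh: "dh = (d, h)" by (cases dh)
  let ?s = "s(d := h a # s d)"
  let ?f = "\<lambda>s ds q. case map_of ds q of Some h \<Rightarrow> h a # s q
    | None \<Rightarrow> if q \<in> set ps then tl (s q) else s q"
  have "exec (seqs (map (\<lambda>(d, h). Push d (h a)) (dh # ds) @ map Pop ps)) s (?f ?s ds)
      (1 + (length ds + length ps + 1))"
    unfolding dh list.map append_Cons prod.case
    by (rule exec_seqs_Cons[OF exec_push]) (use Cons dh in simp)
  also have "?f ?s ds = ?f s (dh # ds)"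
  proof
    fix q
    have "map_of ds d = None" "d \<notin> set ps"
      using Cons.prems dh by (auto simp: map_of_eq_None_iff)
    then show "?f ?s ds q = ?f s (dh # ds) q"
      by (auto simp: dh split: option.splits)
  qed
  finally show ?case by simp
qed

text \<open>The 6 per symbol covers the loop test, up to three tests in \<open>case_top\<close>, the
  pop of \<open>r\<close> and the final \<open>skip\<close>.\<close>

lemma exec_pour:
  assumes "distinct (r # map fst ds @ ps)" "s r = u @ v" "set u \<subseteq> X" "top_symbol v \<notin> Some ` X"
  shows "exec (pour r X ds ps) s (poured r ds ps u v s) ((length u + 1) * (length ds + length ps + 6))"
  using assms(2,3)
proof (induction u arbitrary: s)
  case Nil
  have "poured r ds ps [] v s = s"
    using Nil by (auto simp: poured_def fun_eq_iff split: option.splits)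
  moreover have "exec (pour r X ds ps) s s 1"
    unfolding pour_def by (rule exec_loop_exit) (use Nil assms(4) in simp)
  ultimately show ?case
    using exec_mono by simp
next
  case (Cons a u)
  let ?K = "length ds + length ps + 6"
  define s1 where "s1 = s(r := u @ v)"
  define s2 where "s2 = (\<lambda>q. case map_of ds q of Some h \<Rightarrow> h a # s1 q
    | None \<Rightarrow> if q \<in> set ps then tl (s1 q) else s1 q)"
  have r: "map_of ds r = None" "r \<notin> set ps"
    using assms(1) by (auto simp: map_of_eq_None_iff)
  have "exec (Pop r) s s1 1"
    using exec_pop[of r s] Cons.prems by (simp add: s1_def)
  from exec_seq[OF this exec_pushes_pops[of ds ps a s1]] assms(1)
  have "exec (case_top r (\<lambda>a. Seq (Pop r) (seqs (map (\<lambda>(d, h). Push d (h a)) ds @ map Pop ps)))) s s2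
      (1 + (length ds + length ps + 1) + 3)"
    unfolding s2_def by (intro exec_case_top) (use Cons.prems in auto)
  moreover have "exec (pour r X ds ps) s2 (poured r ds ps u v s2) ((length u + 1) * ?K)"
    using Cons.prems r by (intro Cons.IH) (auto simp: s2_def s1_def)
  ultimately have "exec (pour r X ds ps) s (poured r ds ps u v s2)
      (1 + (length ds + length ps + 1) + 3 + (length u + 1) * ?K + 1)"
    unfolding pour_def by (rule exec_loop_step[rotated]) (use Cons.prems in auto)
  moreover have "poured r ds ps u v s2 = poured r ds ps (a # u) v s"
    by (auto simp: poured_def s2_def s1_def fun_eq_iff drop_Suc tl_drop split: option.splits)
  ultimately show ?case
    by (simp add: algebra_simps)
qed

subsection \<open>Writing words that contain the contents of registers\<close>

text \<open>Pouring destroys the source and reverses the word. Register 1 receives a second copy,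
  from which \<open>r\<close> is restored in its original order. The target keeps the reversed word,
  which suits registers 13 and 14; the other targets receive constant words.\<close>

definition copy :: "nat \<Rightarrow> nat \<Rightarrow> program" where
  "copy r d = Seq (pour r UNIV [(d, id), (1, id)] []) (pour 1 UNIV [(r, id)] [])"

lemma exec_copy:
  assumes "distinct [r, d, 1]" "s 1 = []" "length (s r) \<le> n"
  shows "exec (copy r d) s (s(d := rev (s r) @ s d)) (20 * (n + 1))"
proof -
  let ?s = "poured r [(d, id), (1, id)] [] (s r) [] s"
  have "exec (pour r UNIV [(d, id), (1, id)] []) s ?s
      ((length (s r) + 1) * (length [(d, id), (1::nat, id::symbol\<Rightarrow>symbol)] + length ([]::nat list) + 6))"
    by (rule exec_pour) (use assms in auto)
  moreover have "exec (pour 1 UNIV [(r, id)] []) ?s (poured 1 [(r, id)] [] (rev (s r)) [] ?s)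
      ((length (rev (s r)) + 1) * (length [(r, id::symbol\<Rightarrow>symbol)] + length ([]::nat list) + 6))"
    by (rule exec_pour) (use assms in \<open>auto simp: poured_def\<close>)
  moreover have "poured 1 [(r, id)] [] (rev (s r)) [] ?s = s(d := rev (s r) @ s d)"
    using assms by (auto simp: poured_def fun_eq_iff)
  ultimately have "exec (copy r d) s (s(d := rev (s r) @ s d)) ((length (s r) + 1) * 8 + (length (s r) + 1) * 7)"
    unfolding copy_def using exec_seq by fastforce
  then show ?thesis
    by (rule exec_mono) (use assms(3) in auto)
qed

datatype item = Sym symbol | Reg nat

fun item_word :: "store \<Rightarrow> item \<Rightarrow> word" where
  "item_word s (Sym a) = [a]"
| "item_word s (Reg r) = s r"

fun emit_item :: "nat \<Rightarrow> item \<Rightarrow> program" where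
  "emit_item d (Sym a) = Push d a"
| "emit_item d (Reg r) = copy r d"

definition emit :: "nat \<Rightarrow> item list \<Rightarrow> program" where
  "emit d its = seqs (map (emit_item d) its)"

lemma exec_emit:
  assumes "d \<noteq> 1" "s 1 = []" "\<forall>r. Reg r \<in> set its \<longrightarrow> r \<noteq> d \<and> r \<noteq> 1 \<and> length (s r) \<le> n"
  shows "exec (emit d its) s (s(d := rev (concat (map (item_word s) its)) @ s d))
    (length its * (20 * (n + 1)) + 1)"
  using assms
proof (induction its arbitrary: s)
  case Nil
  then show ?case using exec_skip by (simp add: emit_def)
next
  case (Cons i its)
  let ?s = "s(d := rev (item_word s i) @ s d)"
  have 1: "exec (emit_item d i) s ?s (20 * (n + 1))"
  proof (cases i)
    case (Sym a)
    then show ?thesis using exec_mono[OF exec_push[of d a s]] by simp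
  next
    case (Reg r)
    then show ?thesis using exec_copy[of r d s n] Cons.prems by simp
  qed
  have eq: "item_word ?s j = item_word s j" if "j \<in> set its" for j
  proof (cases j)
    case (Reg r)
    then have "r \<noteq> d" using that Cons.prems(3) by auto
    then show ?thesis using Reg by simp
  qed simp
  have "exec (emit d its) ?s (?s(d := rev (concat (map (item_word ?s) its)) @ ?s d))
      (length its * (20 * (n + 1)) + 1)"
    using Cons.prems by (intro Cons.IH) auto
  moreover have "map (item_word ?s) its = map (item_word s) its"
    using eq by auto
  moreover have "?s(d := rev w @ ?s d) = s(d := rev (item_word s i @ w) @ s d)" for w
    by auto
  ultimately have "exec (emit d its) ?s (s(d := rev (concat (map (item_word s) (i # its))) @ s d))
      (length its * (20 * (n + 1)) + 1)"
    by (metis concat.simps(2) list.map(2))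
  then have "exec (emit d (i # its)) s (s(d := rev (concat (map (item_word s) (i # its))) @ s d))
      (20 * (n + 1) + (length its * (20 * (n + 1)) + 1))"
    unfolding emit_def list.map(2)[of "emit_item d"] by (rule exec_seqs_Cons[OF 1])
  then show ?case
    by (rule exec_mono) simp
qed

section \<open>Binary numbers\<close>

fun bits_val :: "bool list \<Rightarrow> nat" where
  "bits_val [] = 0"
| "bits_val (b # bs) = of_bool b + 2 * bits_val bs"

lemma bits_val_nat_bits [simp]: "bits_val (nat_bits n) = n"
  by (induction n rule: nat_bits.induct) (subst nat_bits.simps, auto simp: of_bool_def)

lemma bits_val_pos: "bs \<noteq> [] \<Longrightarrow> last bs \<Longrightarrow> bits_val bs > 0"
  by (induction bs) (auto split: if_splits)

text \<open>Lets coordinates be assembled as bit lists: the encoding demands the representation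
  without leading zeros, and for a nonempty list this is a condition on the last bit alone.\<close>

lemma nat_bits_bits_val: "bs = [] \<or> last bs \<Longrightarrow> nat_bits (bits_val bs) = bs"
proof (induction bs)
  case Nil
  then show ?case by (simp add: nat_bits.simps)
next
  case (Cons b bs)
  then have "bits_val (b # bs) > 0"
    by (intro bits_val_pos) auto
  then have "nat_bits (bits_val (b # bs)) = b # nat_bits (bits_val bs)"
    by (subst nat_bits.simps) (auto simp: of_bool_def)
  then show ?case using Cons by (cases "bs = []") (auto simp: nat_bits.simps)
qed

lemma last_nat_bits: "n > 0 \<Longrightarrow> nat_bits n \<noteq> [] \<and> last (nat_bits n)"
proof (induction n rule: nat_bits.induct)
  case (1 n)
  have "nat_bits n = odd n # nat_bits (n div 2)"
    using 1 by (subst nat_bits.simps) simp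
  moreover have "nat_bits 0 = []"
    by (simp add: nat_bits.simps)
  moreover have "odd n" if "n div 2 = 0"
    using 1 that by (cases "n = 1") auto
  ultimately show ?case
    using 1 by (cases "n div 2 = 0") auto
qed

text \<open>The program obtains the code of a color by putting a set bit in front of its
  bits.\<close>

lemma nat_bits_double: "nat_bits (2 * n + 1) = True # nat_bits n"
  by (subst nat_bits.simps) simp

lemma nat_bits_2: "nat_bits 2 = [False, True]"
proof -
  have "[False, True] = nat_bits (bits_val [False, True])"
    by (rule nat_bits_bits_val[symmetric]) simp
  then show ?thesis by (simp add: numeral_2_eq_2)
qed

lemma bits_val_append: "bits_val (xs @ ys) = bits_val xs + 2 ^ length xs * bits_val ys"
  by (induction xs) (auto simp: algebra_simps)

lemma bits_val_less: "bits_val bs < 2 ^ length bs"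
  by (induction bs) (auto simp: of_bool_def)

lemma double_pred: "1 \<le> n \<Longrightarrow> 1 + 2 * (n - 1) = 2 * n - (1::nat)"
  by arith

lemma bits_val_ones: "bits_val (replicate n True) = 2 ^ n - 1"
proof (induction n)
  case (Suc n)
  have "(1::nat) \<le> 2 ^ n" by simp
  moreover have "bits_val (replicate (Suc n) True) = 1 + 2 * (2 ^ n - 1)"
    using Suc by simp
  ultimately show ?case by (simp only: power_Suc double_pred)
qed simp

lemma bits_val_zeros [simp]: "bits_val (replicate n False) = 0"
  by (induction n) auto

text \<open>Complementing reverses the order of numbers of a fixed length and replaces a subtraction
  by the machine.\<close>

lemma bits_val_flip: "bits_val (map Not bs) + bits_val bs = 2 ^ length bs - 1"
proof (induction bs)
  case (Cons b bs)
  have "(1::nat) \<le> 2 ^ length bs" by simp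
  moreover have "bits_val (map Not (b # bs)) + bits_val (b # bs) =
      1 + 2 * (bits_val (map Not bs) + bits_val bs)"
    by (cases b) auto
  ultimately show ?case by (simp only: Cons length_Cons power_Suc double_pred)
qed simp

lemma less_length_nat_bits: "n < 2 ^ length (nat_bits n)"
  using bits_val_less[of "nat_bits n"] by simp

lemma length_nat_bits_le: "n < 2 ^ k \<Longrightarrow> length (nat_bits n) \<le> k"
proof (induction k arbitrary: n)
  case (Suc k)
  then have "length (nat_bits (n div 2)) \<le> k" by auto
  then show ?case by (subst nat_bits.simps) auto
qed (simp add: nat_bits.simps)

text \<open>The zeros are appended at the end because the least significant bit comes first.\<close>

definition pad :: "nat \<Rightarrow> bool list \<Rightarrow> bool list" where
  "pad W bs = bs @ replicate (W - length bs) False"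

lemma length_pad: "length bs \<le> W \<Longrightarrow> length (pad W bs) = W"
  by (simp add: pad_def)

lemma bits_val_pad [simp]: "bits_val (pad W bs) = bits_val bs"
  by (simp add: pad_def bits_val_append)

lemma bits_val_flip_pad:
  "n < 2 ^ W \<Longrightarrow> bits_val (map Not (pad W (nat_bits n))) = 2 ^ W - 1 - n"
  using bits_val_flip[of "pad W (nat_bits n)"] length_pad[OF length_nat_bits_le[of n W]] by simp

section \<open>The vertices and their coordinates\<close>

text \<open>\<open>Anchor a\<close> stands for the color with code \<open>a\<close>; \<open>Occ m l a\<close> is the \<open>l\<close>-th vertex of the box
  with number \<open>m\<close> and belongs to the color with code \<open>a\<close>; a switch whose boxes have the numbers
  strictly between \<open>\<alpha>\<close> and \<open>\<beta>\<close> has the vertices \<open>Src \<alpha> \<beta>\<close> and \<open>Snk \<alpha> \<beta>\<close>.\<close>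

datatype key = Anchor nat | Occ nat nat nat | Src nat nat | Snk nat nat

text \<open>An occurrence has three blocks, from least to most significant: \<open>W\<close> bits
  for the index, \<open>W\<close> bits for the code, and the unary level. So the level decides
  first, then the code, and the index matters only between equal codes. Anchors become the points
  \<open>(a, -a)\<close> of an antidiagonal, no two of which are comparable.\<close>

fun xbits :: "nat \<Rightarrow> key \<Rightarrow> bool list" where
  "xbits W (Anchor a) = nat_bits a"
| "xbits W (Occ m l a) = replicate l True @ replicate (W - l) False @ pad W (nat_bits a) @ replicate m True"
| "xbits W (Src \<alpha> \<beta>) = replicate W True @ replicate W True @ replicate \<beta> True"
| "xbits W (Snk \<alpha> \<beta>) = replicate W True @ replicate W True @ replicate \<alpha> True"

text \<open>These magnitudes are negated by \<open>place\<close>. Level and index enter both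
  coordinates alike, so a difference in the level, or in the index at equal level and code, makes
  two occurrences incomparable. The code is complemented, so within a box a larger code raises both
  coordinates. Sources and sinks exchange \<open>\<alpha>\<close> and
  \<open>\<beta>\<close>.\<close>

fun ybits :: "nat \<Rightarrow> key \<Rightarrow> bool list" where
  "ybits W (Anchor a) = nat_bits a"
| "ybits W (Occ m l a) =
     replicate l True @ replicate (W - l) False @ map Not (pad W (nat_bits a)) @ replicate m True"
| "ybits W (Src \<alpha> \<beta>) = replicate W True @ replicate W True @ replicate \<alpha> True"
| "ybits W (Snk \<alpha> \<beta>) = replicate W True @ replicate W True @ replicate \<beta> True"

fun xlevel :: "key \<Rightarrow> nat" where
  "xlevel (Anchor a) = 0"
| "xlevel (Occ m l a) = m"
| "xlevel (Src \<alpha> \<beta>) = \<beta>"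
| "xlevel (Snk \<alpha> \<beta>) = \<alpha>"

fun ylevel :: "key \<Rightarrow> nat" where
  "ylevel (Anchor a) = 0"
| "ylevel (Occ m l a) = m"
| "ylevel (Src \<alpha> \<beta>) = \<alpha>"
| "ylevel (Snk \<alpha> \<beta>) = \<beta>"

text \<open>The bounds keep the blocks within their widths; positivity makes the most significant
  bit of each coordinate set and leaves level 0 to the anchors.\<close>

fun valid :: "nat \<Rightarrow> key \<Rightarrow> bool" where
  "valid W (Anchor a) \<longleftrightarrow> 0 < a \<and> a < 2 ^ W"
| "valid W (Occ m l a) \<longleftrightarrow> 0 < m \<and> l \<le> W \<and> a < 2 ^ W"
| "valid W (Src \<alpha> \<beta>) \<longleftrightarrow> 0 < \<alpha> \<and> \<alpha> < \<beta>"
| "valid W (Snk \<alpha> \<beta>) \<longleftrightarrow> 0 < \<alpha> \<and> \<alpha> < \<beta>"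

abbreviation xmag :: "nat \<Rightarrow> key \<Rightarrow> nat" where "xmag W k \<equiv> bits_val (xbits W k)"
abbreviation ymag :: "nat \<Rightarrow> key \<Rightarrow> nat" where "ymag W k \<equiv> bits_val (ybits W k)"

definition place :: "nat \<Rightarrow> key \<Rightarrow> point" where
  "place W k = [of_nat (xmag W k), - of_nat (ymag W k)]"

definition above :: "nat \<Rightarrow> key \<Rightarrow> key \<Rightarrow> bool" where
  "above W u v \<longleftrightarrow> xmag W v \<le> xmag W u \<and> ymag W u \<le> ymag W v"

section \<open>The order on the vertices in terms of levels, codes and indices\<close>

lemma ge_place_iff: "list_all2 (\<ge>) (place W u) (place W v) \<longleftrightarrow> above W u v"
  by (simp add: place_def above_def)

text \<open>As \<open>2 ^ L \<le> 2 ^ L' - 1\<close> for \<open>L < L'\<close>, these intervals are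
  disjoint for different levels, so levels decide comparisons before all lower bits.\<close>

lemma level_interval:
  assumes "length lo = W + W"
  shows "2 ^ (W + W) * (2 ^ L - 1) \<le> bits_val (lo @ replicate L True)"
    and "bits_val (lo @ replicate L True) < 2 ^ (W + W) * 2 ^ L"
proof -
  have "bits_val (lo @ replicate L True) = bits_val lo + 2 ^ (W + W) * (2 ^ L - 1)"
    using assms by (simp add: bits_val_append bits_val_ones)
  then show "2 ^ (W + W) * (2 ^ L - 1) \<le> bits_val (lo @ replicate L True)" by simp
  show "bits_val (lo @ replicate L True) < 2 ^ (W + W) * 2 ^ L"
    using bits_val_less[of "lo @ replicate L True"] assms by (simp add: power_add)
qed

lemma xmag_interval:
  assumes "valid W k"
  shows "2 ^ (W + W) * (2 ^ xlevel k - 1) \<le> xmag W k \<and> xmag W k < 2 ^ (W + W) * 2 ^ xlevel k"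
proof (cases k)
  case (Anchor a)
  then have "a < 2 ^ W * 1" using assms by simp
  also have "\<dots> \<le> 2 ^ W * 2 ^ W" by (intro mult_left_mono) auto
  finally show ?thesis using Anchor by (simp add: power_add)
next
  case (Occ m l a)
  then show ?thesis
    using level_interval[of "replicate l True @ replicate (W - l) False @ pad W (nat_bits a)" W m]
      assms length_pad[OF length_nat_bits_le[of a W]] by simp
next
  case (Src \<alpha> \<beta>)
  then show ?thesis using level_interval[of "replicate W True @ replicate W True" W \<beta>] by simp
next
  case (Snk \<alpha> \<beta>)
  then show ?thesis using level_interval[of "replicate W True @ replicate W True" W \<alpha>] by simp
qed

lemma ymag_interval:
  assumes "valid W k"
  shows "2 ^ (W + W) * (2 ^ ylevel k - 1) \<le> ymag W k \<and> ymag W k < 2 ^ (W + W) * 2 ^ ylevel k"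
proof (cases k)
  case (Anchor a)
  then show ?thesis using xmag_interval[OF assms] by simp
next
  case (Occ m l a)
  then show ?thesis
    using level_interval[of "replicate l True @ replicate (W - l) False @ map Not (pad W (nat_bits a))" W m]
      assms length_pad[OF length_nat_bits_le[of a W]] by simp
next
  case (Src \<alpha> \<beta>)
  then show ?thesis using level_interval[of "replicate W True @ replicate W True" W \<alpha>] by simp
next
  case (Snk \<alpha> \<beta>)
  then show ?thesis using level_interval[of "replicate W True @ replicate W True" W \<beta>] by simp
qed

lemma interval_less:
  fixes B :: nat
  assumes "x < B * 2 ^ L" "B * (2 ^ L' - 1) \<le> y" "L < L'"
  shows "x < y"
proof -
  have "(2::nat) ^ L < 2 ^ L'"
    using assms(3) by simp
  then have "(2::nat) ^ L \<le> 2 ^ L' - 1"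
    by linarith
  then have "B * 2 ^ L \<le> B * (2 ^ L' - 1)"
    by (rule mult_left_mono) simp
  then show ?thesis using assms by linarith
qed

lemma above_levels:
  assumes "valid W u" "valid W v" "above W u v"
  shows "xlevel v \<le> xlevel u" "ylevel u \<le> ylevel v"
  using assms xmag_interval[of W u] xmag_interval[of W v] ymag_interval[of W u] ymag_interval[of W v]
    interval_less[of "xmag W u" "2 ^ (W + W)" "xlevel u" "xlevel v" "xmag W v"]
    interval_less[of "ymag W v" "2 ^ (W + W)" "ylevel v" "ylevel u" "ymag W u"]
  unfolding above_def by linarith+

lemma above_of_levels:
  assumes "valid W u" "valid W v" "xlevel v < xlevel u" "ylevel u < ylevel v"
  shows "above W u v"
  using assms xmag_interval[of W u] xmag_interval[of W v] ymag_interval[of W u] ymag_interval[of W v]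
    interval_less[of "xmag W v" "2 ^ (W + W)" "xlevel v" "xlevel u" "xmag W u"]
    interval_less[of "ymag W u" "2 ^ (W + W)" "ylevel u" "ylevel v" "ymag W v"]
  unfolding above_def by linarith

text \<open>In base \<open>2 ^ W\<close> the two lowest digits are given by the index and the code,
  the latter complemented in the second coordinate.\<close>

lemma mag_Occ:
  assumes "valid W (Occ m l a)"
  shows "xmag W (Occ m l a) = (2 ^ l - 1) + 2 ^ W * (a + 2 ^ W * (2 ^ m - 1))"
    and "ymag W (Occ m l a) = (2 ^ l - 1) + 2 ^ W * ((2 ^ W - 1 - a) + 2 ^ W * (2 ^ m - 1))"
proof -
  have lo: "bits_val (replicate l True @ replicate (W - l) False @ ys) = (2 ^ l - 1) + 2 ^ W * bits_val ys" for ys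
    using assms unfolding append_assoc[symmetric]
    by (subst bits_val_append) (simp add: bits_val_append bits_val_ones)
  have len: "length (pad W (nat_bits a)) = W"
    using assms by (intro length_pad length_nat_bits_le) simp
  show "xmag W (Occ m l a) = (2 ^ l - 1) + 2 ^ W * (a + 2 ^ W * (2 ^ m - 1))"
    unfolding xbits.simps lo by (simp add: bits_val_append bits_val_ones len)
  show "ymag W (Occ m l a) = (2 ^ l - 1) + 2 ^ W * ((2 ^ W - 1 - a) + 2 ^ W * (2 ^ m - 1))"
    unfolding ybits.simps lo using assms
    by (simp add: bits_val_append bits_val_ones len bits_val_flip_pad)
qed

lemma two_digits_less:
  fixes B :: nat
  assumes "x < B" "h < h'"
  shows "x + B * h < y + B * h'"
proof -
  have "B * Suc h \<le> B * h'" using assms by (intro mult_left_mono) auto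
  then show ?thesis using assms by simp
qed

lemma above_Occ_iff:
  assumes "valid W (Occ m l a)" "valid W (Occ m l' a')"
  shows "above W (Occ m l a) (Occ m l' a') \<longleftrightarrow> a' < a \<or> (a' = a \<and> l' = l)"
proof -
  \<comment> \<open>By \<open>l \<le> W\<close> the index block is a single digit in base
    \<open>2 ^ W\<close>.\<close>
  have l: "(2::nat) ^ l - 1 < 2 ^ W" "(2::nat) ^ l' - 1 < 2 ^ W"
    using assms power_increasing[of l W "2::nat"] power_increasing[of l' W "2::nat"]
    by (simp_all add: less_Suc_eq_le less_diff_conv2)
  have lt: "above W (Occ m k b) (Occ m k' b') \<and> \<not> above W (Occ m k' b') (Occ m k b)"
    if "b' < b" "valid W (Occ m k b)" "valid W (Occ m k' b')"
      "(2::nat) ^ k - 1 < 2 ^ W" "(2::nat) ^ k' - 1 < 2 ^ W" for b b' k k'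
  proof -
    have x: "xmag W (Occ m k' b') < xmag W (Occ m k b)"
      unfolding mag_Occ(1)[OF that(2)] mag_Occ(1)[OF that(3)] by (rule two_digits_less) (use that in simp_all)
    have "b < 2 ^ W"
      using that(2) by simp
    then have flipped: "(2::nat) ^ W - 1 - b < 2 ^ W - 1 - b'"
      using that(1) by linarith
    have "ymag W (Occ m k b) < ymag W (Occ m k' b')"
      unfolding mag_Occ(2)[OF that(2)] mag_Occ(2)[OF that(3)]
      by (rule two_digits_less) (use that(4) flipped in \<open>simp_all only: add_less_cancel_right\<close>)
    with x show ?thesis unfolding above_def by linarith
  qed
  \<comment> \<open>For equal codes the two coordinates compare the same index digits in opposite
    directions.\<close>
  have "above W (Occ m l a) (Occ m l' a') \<longleftrightarrow> l = l'" if "a = a'"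
  proof -
    have "above W (Occ m l a) (Occ m l' a') \<longleftrightarrow> (2::nat) ^ l - 1 = 2 ^ l' - 1"
      unfolding \<open>a = a'\<close> above_def mag_Occ[OF assms(1)[unfolded \<open>a = a'\<close>]] mag_Occ[OF assms(2)]
        add_le_cancel_right
      by (metis order_antisym order_refl)
    also have "\<dots> \<longleftrightarrow> (2::nat) ^ l = 2 ^ l'"
      using one_le_power[of "2::nat" l] one_le_power[of "2::nat" l'] by arith
    finally show ?thesis by simp
  qed
  then show ?thesis
    using lt[of a' a l l'] lt[of a a' l' l] assms l by (metis linorder_neqE_nat less_irrefl)
qed

lemma above_antisym:
  assumes "valid W u" "valid W v" "above W u v" "above W v u"
  shows "u = v"
proof -
  have lev: "xlevel u = xlevel v" "ylevel u = ylevel v"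
    using above_levels[OF assms(1,2,3)] above_levels[OF assms(2,1,4)] by auto
  show ?thesis
  proof (cases u)
    case (Anchor a)
    then show ?thesis using lev assms by (cases v) (auto simp: above_def)
  next
    case (Occ m l a)
    then obtain l' a' where v: "v = Occ m l' a'" using lev assms by (cases v) auto
    show ?thesis
      using above_Occ_iff[of W m l a l' a'] above_Occ_iff[of W m l' a' l a] assms Occ v by auto
  next
    case (Src \<alpha> \<beta>)
    then show ?thesis using lev assms by (cases v) auto
  next
    case (Snk \<alpha> \<beta>)
    then show ?thesis using lev assms by (cases v) auto
  qed
qed

lemma above_refl: "above W u u"
  by (simp add: above_def)

lemma place_inj:
  assumes "valid W u" "valid W v" "place W u = place W v"
  shows "u = v"
  using above_antisym[OF assms(1,2)] assms(3) above_refl ge_place_iff by metis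

section \<open>The constructed graph\<close>

text \<open>Color \<open>c\<close> has the code \<open>2c + 1\<close>. The code 2 belongs to an additional color, the hub, that every
  position contains.\<close>

definition code :: "nat \<Rightarrow> nat" where
  "code c = 2 * c + 1"

abbreviation (input) hub :: nat where "hub \<equiv> 2"

text \<open>In \<open>(\<alpha>, S)\<close> the number \<open>\<alpha>\<close> is the level at which the interval of the switch \<open>S\<close> starts.\<close>

fun levelled :: "nat \<Rightarrow> nat list list list \<Rightarrow> (nat \<times> nat list list) list" where
  "levelled \<alpha> [] = []"
| "levelled \<alpha> (S # Ss) = (\<alpha>, S) # levelled (\<alpha> + length S + 2) Ss"

definition top_level :: "nat \<times> nat list list \<Rightarrow> nat" where
  "top_level s = fst s + length (snd s) + 1"

abbreviation src :: "nat \<times> nat list list \<Rightarrow> key" where "src s \<equiv> Src (fst s) (top_level s)"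
abbreviation snk :: "nat \<times> nat list list \<Rightarrow> key" where "snk s \<equiv> Snk (fst s) (top_level s)"

text \<open>The hub takes index 0, so even an empty position has a nonempty box and can be selected
  by a path. The index separates repeated colors.\<close>

definition box_occs :: "nat \<times> nat list \<Rightarrow> key list" where
  "box_occs mp = map (\<lambda>(l, a). Occ (fst mp) l a) (List.enumerate 0 (hub # map code (snd mp)))"

definition boxes :: "nat \<times> nat list list \<Rightarrow> (nat \<times> nat list) list" where
  "boxes s = List.enumerate (Suc (fst s)) (snd s)"

definition switch_occs :: "nat \<times> nat list list \<Rightarrow> key list" where
  "switch_occs s = concat (map box_occs (boxes s))"

fun occ_code :: "key \<Rightarrow> nat" where
  "occ_code (Occ m l a) = a"
| "occ_code _ = 0"

text \<open>Arcs in both directions keep a star balanced and strongly connected.\<close>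

definition occ_arcs :: "key \<Rightarrow> (key \<times> key) list" where
  "occ_arcs k = [(k, Anchor (occ_code k)), (Anchor (occ_code k), k)]"

definition switch_keys :: "nat \<times> nat list list \<Rightarrow> key list" where
  "switch_keys s = switch_occs s @ [src s, snk s]"

definition switch_arcs :: "nat \<times> nat list list \<Rightarrow> (key \<times> key) list" where
  "switch_arcs s = concat (map occ_arcs (switch_occs s)) @ [(snk s, src s)]"

definition all_keys :: "nat list \<Rightarrow> nat list list list \<Rightarrow> key list" where
  "all_keys cs xs = map Anchor (hub # map code cs) @ concat (map switch_keys (levelled 1 xs))"

definition all_arcs :: "nat list list list \<Rightarrow> (key \<times> key) list" where
  "all_arcs xs = concat (map switch_arcs (levelled 1 xs))"

section \<open>Levels of the boxes and disjointness of the intervals of the switches\<close>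

lemma set_box_occs: "set (box_occs (m, p)) = {Occ m l a | l a. (l, a) \<in> set (List.enumerate 0 (hub # map code p))}"
  by (auto simp: box_occs_def)

lemma boxes_level: "(m, p) \<in> set (boxes s) \<Longrightarrow> fst s < m \<and> m < top_level s \<and> p \<in> set (snd s)"
  by (auto simp: boxes_def in_set_enumerate_eq top_level_def intro: nth_mem)

lemma boxes_unique: "(m, p) \<in> set (boxes s) \<Longrightarrow> (m, q) \<in> set (boxes s) \<Longrightarrow> p = q"
  by (auto simp: boxes_def in_set_enumerate_eq)

lemma Occ_in_switch: "Occ m l a \<in> set (switch_occs s) \<longleftrightarrow> (\<exists>p. (m, p) \<in> set (boxes s) \<and> Occ m l a \<in> set (box_occs (m, p)))"
  by (force simp: switch_occs_def box_occs_def)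

lemma switch_occs_Occ: "k \<in> set (switch_occs s) \<Longrightarrow> \<exists>m l a. k = Occ m l a"
  by (auto simp: switch_occs_def box_occs_def)

lemma levelled_ge: "s \<in> set (levelled n xs) \<Longrightarrow> n \<le> fst s"
  by (induction n xs rule: levelled.induct) auto

lemma map_snd_levelled [simp]: "map snd (levelled n xs) = xs"
  by (induction n xs rule: levelled.induct) auto

text \<open>A switch with \<open>n\<close> positions occupies \<open>n + 2\<close> levels, one per
  box and two for the ends; \<open>levelled\<close> advances by exactly this amount.\<close>

lemma levelled_disjoint:
  "s \<in> set (levelled n xs) \<Longrightarrow> s' \<in> set (levelled n xs) \<Longrightarrow> s = s' \<or> top_level s < fst s' \<or> top_level s' < fst s"
proof (induction n xs rule: levelled.induct)
  case (2 \<alpha> S Ss)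
  have "top_level (\<alpha>, S) < fst t" if "t \<in> set (levelled (\<alpha> + length S + 2) Ss)" for t
    using levelled_ge[OF that] by (simp add: top_level_def)
  moreover have "s = (\<alpha>, S) \<or> s \<in> set (levelled (\<alpha> + length S + 2) Ss)"
    "s' = (\<alpha>, S) \<or> s' \<in> set (levelled (\<alpha> + length S + 2) Ss)"
    using 2 by auto
  ultimately show ?case using 2(1) by (metis fst_conv)
qed simp

text \<open>Equal switches become different entries through their start levels, so that choices can
  be functions on the entries.\<close>

lemma distinct_levelled: "distinct (levelled n xs)"
proof (induction n xs rule: levelled.induct)
  case (2 \<alpha> S Ss)
  then show ?case using levelled_ge[of "(\<alpha>, S)" "\<alpha> + length S + 2" Ss] by auto
qed simp

lemma switch_keys_levels:
  assumes "k \<in> set (switch_keys s)"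
  shows "fst s \<le> xlevel k \<and> xlevel k \<le> top_level s \<and> fst s \<le> ylevel k \<and> ylevel k \<le> top_level s"
proof (cases "k \<in> set (switch_occs s)")
  case True
  then obtain m l a where "k = Occ m l a" using switch_occs_Occ by blast
  then show ?thesis
    using True boxes_level[of m _ s] less_imp_le by (auto simp: Occ_in_switch)
next
  case False
  then show ?thesis using assms by (auto simp: switch_keys_def top_level_def)
qed

section \<open>The program\<close>

text \<open>The registers are: 0 input and later output; 1 scratch; 2 holds as many bits as the input has
  symbols; 3 and 4 a block of the same total length that encodes the index inside the current box;
  5 the current level in unary; 6 the level of the current source; 9 and 10 the padded code of the
  current color and its complement; 11 its unpadded code; 13 the vertices and 14 the arcs written so
  far, in reverse. The registers 7, 8 and 12 are used while a code is loaded.\<close>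

definition mk ::
    "nat \<Rightarrow> word \<Rightarrow> nat \<Rightarrow> nat \<Rightarrow> nat \<Rightarrow> word \<Rightarrow> word \<Rightarrow> word \<Rightarrow> word \<Rightarrow> word \<Rightarrow> store" where
  "mk W inp l m \<alpha> cp dp ab v e = (\<lambda>_. [])(0 := inp, 2 := replicate W (Bit True),
     3 := replicate l (Bit True), 4 := replicate (W - l) (Bit False), 5 := replicate m (Bit True),
     6 := replicate \<alpha> (Bit True), 9 := cp, 10 := dp, 11 := ab, 13 := v, 14 := e)"

fun flip_symbol :: "symbol \<Rightarrow> symbol" where
  "flip_symbol (Bit b) = Bit (\<not> b)"
| "flip_symbol a = a"

text \<open>Reads one number off the input. A copy of register 2 loses one symbol per bit read; what
  remains in register 12 is the number of missing bits and becomes the padding. Register 8 keeps the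
  unpadded bits for the anchor.\<close>

definition load :: program where
  "load = seqs [copy 2 12, pour 0 (range Bit) [(7, id), (8, id)] [12],
     pour 12 UNIV [(7, \<lambda>_. Bit False)] [], pour 9 UNIV [] [], pour 10 UNIV [] [], pour 11 UNIV [] [],
     pour 7 UNIV [(9, id), (10, flip_symbol)] [], pour 8 UNIV [(11, id)] []]"

lemma exec_pour_to:
  assumes "distinct (r # map fst ds @ ps)" "s r = u @ v" "set u \<subseteq> X" "top_symbol v \<notin> Some ` X"
    and "s' = poured r ds ps u v s" "(length u + 1) * (length ds + length ps + 6) \<le> T"
  shows "exec (pour r X ds ps) s s' T"
  unfolding assms(5) by (rule exec_mono[OF _ assms(6)], rule exec_pour) (use assms in auto)

lemma exec_load:
  assumes "length bs \<le> W" "length cp \<le> W" "length dp \<le> W" "length ab \<le> W"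
    and "top_symbol rest \<notin> range (Some \<circ> Bit)"
  shows "exec load (mk W (map Bit bs @ rest) l m \<alpha> cp dp ab v e)
    (mk W rest l m \<alpha> (map Bit (pad W bs)) (map Bit (map Not (pad W bs))) (map Bit bs) v e) (70 * (W + 2))"
proof -
  define n where "n = W - length bs"
  define s0 where "s0 = mk W (map Bit bs @ rest) l m \<alpha> cp dp ab v e"
  define s1 where "s1 = s0(12 := replicate W (Bit True))"
  define s2 where "s2 = s1(0 := rest, 7 := rev (map Bit bs), 8 := rev (map Bit bs), 12 := replicate n (Bit True))"
  define s3 where "s3 = s2(12 := [], 7 := replicate n (Bit False) @ rev (map Bit bs))"
  define s4 where "s4 = s3(9 := [])"
  define s5 where "s5 = s4(10 := [])"
  define s6 where "s6 = s5(11 := [])"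
  define s7 where "s7 = s6(7 := [], 9 := map Bit (pad W bs), 10 := map Bit (map Not (pad W bs)))"
  define s8 where "s8 = s7(8 := [], 11 := map Bit bs)"
  note defs = s1_def s2_def s3_def s4_def s5_def s6_def s7_def s8_def s0_def mk_def
  have W: "W = length bs + n" using assms(1) by (simp add: n_def)
  have "exec (copy 2 12) s0 (s0(12 := rev (s0 2) @ s0 12)) (20 * (W + 1))"
    by (rule exec_copy) (simp_all add: defs)
  then have e1: "exec (copy 2 12) s0 s1 (20 * (W + 1))"
    by (simp add: s1_def s0_def mk_def)
  have e2: "exec (pour 0 (range Bit) [(7, id), (8, id)] [12]) s1 s2 (9 * (W + 1))"
    by (rule exec_pour_to[where u = "map Bit bs" and v = rest])
      (use assms(1,5) in \<open>auto simp: defs poured_def fun_eq_iff image_comp n_def\<close>)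
  have e3: "exec (pour 12 UNIV [(7, \<lambda>_. Bit False)] []) s2 s3 (7 * (W + 1))"
    by (rule exec_pour_to[where u = "replicate n (Bit True)" and v = "[]"])
      (auto simp: defs poured_def fun_eq_iff map_replicate_const n_def)
  have e4: "exec (pour 9 UNIV [] []) s3 s4 (6 * (W + 1))"
    by (rule exec_pour_to[where u = cp and v = "[]"])
      (use assms(2) in \<open>auto simp: defs poured_def fun_eq_iff\<close>)
  have e5: "exec (pour 10 UNIV [] []) s4 s5 (6 * (W + 1))"
    by (rule exec_pour_to[where u = dp and v = "[]"])
      (use assms(3) in \<open>auto simp: defs poured_def fun_eq_iff\<close>)
  have e6: "exec (pour 11 UNIV [] []) s5 s6 (6 * (W + 1))"
    by (rule exec_pour_to[where u = ab and v = "[]"])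
      (use assms(4) in \<open>auto simp: defs poured_def fun_eq_iff\<close>)
  have pad: "map Bit (pad W bs) = rev (replicate n (Bit False) @ rev (map Bit bs))"
    by (simp add: pad_def n_def)
  have flip: "map Bit (map Not (pad W bs)) = rev (map flip_symbol (replicate n (Bit False) @ rev (map Bit bs)))"
    by (simp add: pad_def n_def rev_map comp_def)
  define u where "u = replicate n (Bit False) @ rev (map Bit bs)"
  have s7: "s7 = s6(7 := [], 9 := rev u, 10 := rev (map flip_symbol u))"
    unfolding s7_def pad flip u_def ..
  have s6: "s6 7 = u" "s6 9 = []" "s6 10 = []" "length u = W"
    by (simp_all add: defs u_def) (simp add: W)
  have e7: "exec (pour 7 UNIV [(9, id), (10, flip_symbol)] []) s6 s7 (8 * (W + 1))"
    unfolding s7 by (rule exec_pour_to[where u = u and v = "[]"])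
      (auto simp: s6 poured_def fun_eq_iff)
  have e8: "exec (pour 8 UNIV [(11, id)] []) s7 s8 (7 * (W + 1))"
    by (rule exec_pour_to[where u = "rev (map Bit bs)" and v = "[]"])
      (use assms(1) in \<open>auto simp: defs poured_def fun_eq_iff\<close>)
  have "exec load s0 s8 (20 * (W + 1) + (9 * (W + 1) + (7 * (W + 1) + (6 * (W + 1) + (6 * (W + 1) +
      (6 * (W + 1) + (8 * (W + 1) + (7 * (W + 1) + 1))))))))"
    unfolding load_def
    by (intro exec_seqs_Cons[OF e1] exec_seqs_Cons[OF e2] exec_seqs_Cons[OF e3] exec_seqs_Cons[OF e4]
        exec_seqs_Cons[OF e5] exec_seqs_Cons[OF e6] exec_seqs_Cons[OF e7] exec_seqs_Cons[OF e8])
      (simp add: exec_skip[unfolded One_nat_def])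
  then have "exec load s0 s8 (70 * (W + 2))"
    by (rule exec_mono) simp
  moreover have "s8 = mk W rest l m \<alpha> (map Bit (pad W bs)) (map Bit (map Not (pad W bs))) (map Bit bs) v e"
    by (auto simp: defs fun_eq_iff)
  ultimately show ?thesis
    by (simp add: s0_def)
qed


subsection \<open>Words for vertices and arcs\<close>

text \<open>The trailing \<open>[Open, Bit True, Close]\<close> is the denominator 1.\<close>

definition num_word :: "bool \<Rightarrow> bool list \<Rightarrow> word" where
  "num_word neg bs = Open # Bit neg # map Bit bs @ [Close, Open, Bit True, Close]"

definition point_word :: "nat \<Rightarrow> key \<Rightarrow> word" where
  "point_word W k = Open # num_word False (xbits W k) @ num_word True (ybits W k) @ [Close]"

definition arc_word :: "nat \<Rightarrow> key \<times> key \<Rightarrow> word" where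
  "arc_word W a = Open # point_word W (fst a) @ point_word W (snd a) @ [Close]"

lemma enc_nat_1: "enc_nat 1 = [Open, Bit True, Close]"
  by (simp add: enc_nat_def nat_bits.simps)

lemma quotient_of_of_nat: "quotient_of (of_nat n) = (int n, 1)" "quotient_of (- of_nat n) = (- int n, 1)"
  using quotient_of_int[of "int n"] quotient_of_int[of "- int n"] unfolding Rat.of_int_def by simp_all

lemma enc_rat_of_nat: "enc_rat (of_nat n) = Open # Bit False # map Bit (nat_bits n) @ Close # enc_nat 1"
  by (simp add: enc_rat_def enc_int_def quotient_of_of_nat)

text \<open>For \<open>n = 0\<close> the sign bit would be \<open>False\<close>.\<close>

lemma enc_rat_minus_of_nat:
  "0 < n \<Longrightarrow> enc_rat (- of_nat n) = Open # Bit True # map Bit (nat_bits n) @ Close # enc_nat 1"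
  by (simp add: enc_rat_def enc_int_def quotient_of_of_nat)

lemma valid_bits: "valid W k \<Longrightarrow> xbits W k \<noteq> [] \<and> last (xbits W k) \<and> ybits W k \<noteq> [] \<and> last (ybits W k)"
  by (cases k) (auto simp: last_append last_replicate last_nat_bits)

lemma enc_place:
  assumes "valid W k"
  shows "enc_list enc_rat (place W k) = point_word W k"
  using valid_bits[OF assms] bits_val_pos[of "ybits W k"]
  by (simp add: place_def enc_list_def point_word_def num_word_def enc_rat_of_nat enc_rat_minus_of_nat
      enc_nat_1[unfolded One_nat_def] nat_bits_bits_val del: xbits.simps ybits.simps)

definition num_items :: "bool \<Rightarrow> nat list \<Rightarrow> item list" where
  "num_items neg rs = Sym Open # Sym (Bit neg) # map Reg rs @ map Sym [Close, Open, Bit True, Close]"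

definition point_items :: "nat list \<Rightarrow> nat list \<Rightarrow> item list" where
  "point_items rs rs' = Sym Open # num_items False rs @ num_items True rs' @ [Sym Close]"

definition pair_items :: "item list \<Rightarrow> item list \<Rightarrow> item list" where
  "pair_items is is' = Sym Open # is @ is' @ [Sym Close]"

text \<open>The register lists follow the blocks of \<open>xbits\<close> and \<open>ybits\<close>.
  When a source or sink is written, register 5 holds the upper end of the interval and register 6
  the lower end.\<close>

definition occ_items :: "item list" where "occ_items = point_items [3, 4, 9, 5] [3, 4, 10, 5]"
definition anchor_items :: "item list" where "anchor_items = point_items [11] [11]"
definition src_items :: "item list" where "src_items = point_items [2, 2, 5] [2, 2, 6]"
definition snk_items :: "item list" where "snk_items = point_items [2, 2, 6] [2, 2, 5]"

definition word_of_items :: "store \<Rightarrow> item list \<Rightarrow> word" where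
  "word_of_items s is = concat (map (item_word s) is)"

lemma word_of_pair_items:
  "word_of_items s (pair_items is is') = Open # word_of_items s is @ word_of_items s is' @ [Close]"
  by (simp add: word_of_items_def pair_items_def)

text \<open>The stores between the steps of the main loops, with the color code \<open>a\<close> loaded and the
  vertices \<open>ks\<close> and arcs \<open>as\<close> written.\<close>

definition st :: "nat \<Rightarrow> word \<Rightarrow> nat \<Rightarrow> nat \<Rightarrow> nat \<Rightarrow> nat \<Rightarrow> key list \<Rightarrow> (key \<times> key) list \<Rightarrow> store" where
  "st W inp l m \<alpha> a ks as = mk W inp l m \<alpha> (map Bit (pad W (nat_bits a)))
     (map Bit (map Not (pad W (nat_bits a)))) (map Bit (nat_bits a))
     (rev (concat (map (point_word W) ks))) (rev (concat (map (arc_word W) as)))"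

lemma st_regs:
  "st W inp l m \<alpha> a ks as 0 = inp"
  "st W inp l m \<alpha> a ks as (Suc 0) = []"
  "st W inp l m \<alpha> a ks as 2 = replicate W (Bit True)"
  "st W inp l m \<alpha> a ks as 3 = replicate l (Bit True)"
  "st W inp l m \<alpha> a ks as 4 = replicate (W - l) (Bit False)"
  "st W inp l m \<alpha> a ks as 5 = replicate m (Bit True)"
  "st W inp l m \<alpha> a ks as 6 = replicate \<alpha> (Bit True)"
  "st W inp l m \<alpha> a ks as 9 = map Bit (pad W (nat_bits a))"
  "st W inp l m \<alpha> a ks as 10 = map Bit (map Not (pad W (nat_bits a)))"
  "st W inp l m \<alpha> a ks as 11 = map Bit (nat_bits a)"
  "st W inp l m \<alpha> a ks as 13 = rev (concat (map (point_word W) ks))"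
  "st W inp l m \<alpha> a ks as 14 = rev (concat (map (arc_word W) as))"
  by (simp_all add: st_def mk_def)

lemma st_upds:
  "(st W inp l m \<alpha> a ks as)(0 := inp') = st W inp' l m \<alpha> a ks as"
  "(st W inp l m \<alpha> a ks as)(5 := replicate m' (Bit True)) = st W inp l m' \<alpha> a ks as"
  "(st W inp l m \<alpha> a ks as)(6 := replicate \<alpha>' (Bit True)) = st W inp l m \<alpha>' a ks as"
  "(st W inp l m \<alpha> a ks as)(13 := rev (point_word W k) @ rev (concat (map (point_word W) ks))) =
    st W inp l m \<alpha> a (ks @ [k]) as"
  "(st W inp l m \<alpha> a ks as)(14 := rev (arc_word W b) @ rev (concat (map (arc_word W) as))) =
    st W inp l m \<alpha> a ks (as @ [b])"
  "(st W inp l m \<alpha> a ks as)(3 := replicate l' (Bit True), 4 := replicate (W - l') (Bit False)) =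
    st W inp l' m \<alpha> a ks as"
  by (auto simp: st_def mk_def fun_eq_iff)

lemma item_words:
  "word_of_items (st W inp l m \<alpha> a ks as) occ_items = point_word W (Occ m l a)"
  "word_of_items (st W inp l m \<alpha> a ks as) anchor_items = point_word W (Anchor a)"
  "word_of_items (st W inp l m \<alpha> a ks as) src_items = point_word W (Src \<alpha> m)"
  "word_of_items (st W inp l m \<alpha> a ks as) snk_items = point_word W (Snk \<alpha> m)"
  by (simp_all add: word_of_items_def occ_items_def anchor_items_def src_items_def snk_items_def
      point_items_def num_items_def point_word_def num_word_def st_regs comp_def)

definition item_regs :: "item list \<Rightarrow> nat set" where
  "item_regs is = {r. Reg r \<in> set is}"

lemma item_regs_simps:
  "item_regs (num_items neg rs) = set rs"
  "item_regs (point_items rs rs') = set rs \<union> set rs'"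
  "item_regs (pair_items is is') = item_regs is \<union> item_regs is'"
  by (auto simp: item_regs_def num_items_def point_items_def pair_items_def)

lemma length_items:
  "length (num_items neg rs) = length rs + 6"
  "length (point_items rs rs') = length rs + length rs' + 14"
  "length (pair_items is is') = length is + length is' + 2"
  by (simp_all add: num_items_def point_items_def pair_items_def)

text \<open>Every register read here holds at most \<open>W + 1\<close> symbols, so an item costs at
  most \<open>20 * (W + 2)\<close>. The strict inequality for \<open>k\<close> leaves room for the
  final \<open>skip\<close>.\<close>

lemma exec_emit_st:
  assumes "l \<le> W" "m \<le> W + 1" "\<alpha> \<le> W + 1" "a < 2 ^ W"
    and "item_regs is \<subseteq> {2, 3, 4, 5, 6, 9, 10, 11}" "d = 13 \<or> d = 14" "20 * length is < k"
  shows "exec (emit d is) (st W inp l m \<alpha> a ks as)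
    ((st W inp l m \<alpha> a ks as)(d := rev (word_of_items (st W inp l m \<alpha> a ks as) is) @
      st W inp l m \<alpha> a ks as d)) (k * (W + 2))"
proof -
  let ?s = "st W inp l m \<alpha> a ks as"
  have len: "length (nat_bits a) \<le> W" "length (pad W (nat_bits a)) = W"
    using length_nat_bits_le[OF assms(4)] length_pad by auto
  have "\<forall>r. Reg r \<in> set is \<longrightarrow> r \<noteq> d \<and> r \<noteq> 1 \<and> length (?s r) \<le> W + 1"
  proof (intro allI impI)
    fix r assume "Reg r \<in> set is"
    then have "r \<in> {2, 3, 4, 5, 6, 9, 10, 11}"
      using assms(5) by (auto simp: item_regs_def)
    then show "r \<noteq> d \<and> r \<noteq> 1 \<and> length (?s r) \<le> W + 1"
      using assms(1-3,6) len by (auto simp: st_regs)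
  qed
  then have "exec (emit d is) ?s (?s(d := rev (word_of_items ?s is) @ ?s d))
      (length is * (20 * (W + 1 + 1)) + 1)"
    unfolding word_of_items_def using assms(6) by (intro exec_emit) (auto simp: st_regs)
  moreover have "length is * (20 * (W + 1 + 1)) + 1 \<le> k * (W + 2)"
  proof -
    have "(20 * length is + 1) * (W + 2) \<le> k * (W + 2)"
      using assms(7) by (intro mult_right_mono) auto
    then show ?thesis by (simp add: algebra_simps)
  qed
  ultimately show ?thesis by (rule exec_mono)
qed

lemma exec_emit_vertex:
  assumes "l \<le> W" "m \<le> W + 1" "\<alpha> \<le> W + 1" "a < 2 ^ W"
    and "item_regs is \<subseteq> {2, 3, 4, 5, 6, 9, 10, 11}" "20 * length is < k"
    and "word_of_items (st W inp l m \<alpha> a ks as) is = point_word W x"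
  shows "exec (emit 13 is) (st W inp l m \<alpha> a ks as) (st W inp l m \<alpha> a (ks @ [x]) as) (k * (W + 2))"
  using exec_emit_st[OF assms(1-5) _ assms(6), where d = 13 and inp = inp and ks = ks and as = as]
  by (simp add: assms(7) st_regs st_upds)

lemma exec_emit_arc:
  assumes "l \<le> W" "m \<le> W + 1" "\<alpha> \<le> W + 1" "a < 2 ^ W"
    and "item_regs is \<subseteq> {2, 3, 4, 5, 6, 9, 10, 11}" "item_regs is' \<subseteq> {2, 3, 4, 5, 6, 9, 10, 11}"
    and "20 * (length is + length is' + 2) < k"
    and "word_of_items (st W inp l m \<alpha> a ks as) is = point_word W x"
    and "word_of_items (st W inp l m \<alpha> a ks as) is' = point_word W y"
  shows "exec (emit 14 (pair_items is is')) (st W inp l m \<alpha> a ks as) (st W inp l m \<alpha> a ks (as @ [(x, y)]))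
    (k * (W + 2))"
proof -
  let ?s = "st W inp l m \<alpha> a ks as"
  have "word_of_items ?s (pair_items is is') = arc_word W (x, y)"
    using assms(8,9) by (simp add: word_of_pair_items arc_word_def)
  then show ?thesis
    using exec_emit_st[OF assms(1-4), of "pair_items is is'" 14 k inp ks as] assms(5-7)
    by (simp add: item_regs_simps length_items st_regs st_upds)
qed

subsection \<open>The loops\<close>

text \<open>The last two instructions increment the index; for \<open>l < W\<close> registers 3 and
  4 keep the joint length \<open>W\<close>.\<close>

definition occ_prog :: program where
  "occ_prog = seqs [emit 13 occ_items, emit 14 (pair_items occ_items anchor_items),
     emit 14 (pair_items anchor_items occ_items), Push 3 (Bit True), Pop 4]"

text \<open>Replacing the opening bracket of the color \<open>c\<close> by a set bit leaves the bits
  of \<open>code c\<close> on the input.\<close>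

definition color_prog :: program where
  "color_prog = seqs [Pop 0, Push 0 (Bit True), load, Pop 0]"

text \<open>The bits \<open>[False, True]\<close> of the hub are pushed onto the input, so that the
  hub is loaded like a color read from there.\<close>

definition position_prog :: program where
  "position_prog = seqs [Pop 0, Push 0 (Bit True), Push 0 (Bit False), load, occ_prog,
     Loop 0 {Some Open} (Seq color_prog occ_prog), Pop 0,
     pour 3 UNIV [(4, \<lambda>_. Bit False)] [], Push 5 (Bit True)]"

text \<open>The level at entry is saved in register 6. Source and sink are written after the boxes,
  when register 5 has reached the other end of the interval.\<close>

definition switch_prog :: program where
  "switch_prog = seqs [Pop 0, pour 6 UNIV [] [], copy 5 6, Push 5 (Bit True),
     Loop 0 {Some Open} position_prog, Pop 0, emit 13 src_items, emit 13 snk_items,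
     emit 14 (pair_items snk_items src_items), Push 5 (Bit True)]"

text \<open>The first pass measures the input: it moves it to register 1 while writing one symbol
  per input symbol on registers 2 and 4. The second pass restores it.\<close>

definition reduction_prog :: program where
  "reduction_prog = seqs [pour 0 UNIV [(1, id), (2, \<lambda>_. Bit True), (4, \<lambda>_. Bit False)] [],
     pour 1 UNIV [(0, id)] [], Pop 0, Pop 0, Push 0 (Bit True), Push 0 (Bit False), load,
     emit 13 anchor_items, Loop 0 {Some Open} (Seq color_prog (emit 13 anchor_items)), Pop 0, Pop 0,
     Push 5 (Bit True), Loop 0 {Some Open} switch_prog, Pop 0, Pop 0]"

text \<open>The output is built from its end, since register 0 is a stack; this also undoes the
  reversal of registers 13 and 14.\<close>

definition output_prog :: program where
  "output_prog = seqs [Push 0 Close, Push 0 Close, pour 14 UNIV [(0, id)] [], Push 0 Open, Push 0 Close,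
     pour 13 UNIV [(0, id)] [], Push 0 Open, Push 0 Open]"

lemma exec_Push_0: "exec (Push 0 b) (st W inp l m \<alpha> a ks as) (st W (b # inp) l m \<alpha> a ks as) 1"
  using exec_push[of 0 b "st W inp l m \<alpha> a ks as"] by (simp add: st_regs st_upds)

lemma exec_Pop_0: "exec (Pop 0) (st W (b # inp) l m \<alpha> a ks as) (st W inp l m \<alpha> a ks as) 1"
  using exec_pop[of 0 "st W (b # inp) l m \<alpha> a ks as"] by (simp add: st_regs st_upds)

lemma exec_Push_5: "exec (Push 5 (Bit True)) (st W inp l m \<alpha> a ks as) (st W inp l (Suc m) \<alpha> a ks as) 1"
  using exec_push[of 5 "Bit True" "st W inp l m \<alpha> a ks as"]
    st_upds(2)[of W inp l m \<alpha> a ks as "Suc m"] by (simp add: st_regs)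

lemma exec_load_st:
  assumes "a < 2 ^ W" "b < 2 ^ W" "top_symbol rest \<notin> range (Some \<circ> Bit)" "inp = map Bit (nat_bits b) @ rest"
  shows "exec load (st W inp l m \<alpha> a ks as) (st W rest l m \<alpha> b ks as) (70 * (W + 2))"
proof -
  have "length (nat_bits a) \<le> W" "length (nat_bits b) \<le> W"
    using assms length_nat_bits_le by auto
  then show ?thesis
    unfolding st_def assms(4) using assms(3) by (intro exec_load) (auto simp: length_pad)
qed

lemma regs_subset:
  "item_regs occ_items \<subseteq> {2, 3, 4, 5, 6, 9, 10, 11}"
  "item_regs anchor_items \<subseteq> {2, 3, 4, 5, 6, 9, 10, 11}"
  "item_regs src_items \<subseteq> {2, 3, 4, 5, 6, 9, 10, 11}"
  "item_regs snk_items \<subseteq> {2, 3, 4, 5, 6, 9, 10, 11}"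
  by (auto simp: occ_items_def anchor_items_def src_items_def snk_items_def item_regs_simps)

lemma length_item_lists:
  "length occ_items = 22" "length anchor_items = 16" "length src_items = 20" "length snk_items = 20"
  by (simp_all add: occ_items_def anchor_items_def src_items_def snk_items_def length_items)

lemma exec_occ_prog:
  assumes "l \<le> W" "m \<le> W + 1" "\<alpha> \<le> W + 1" "a < 2 ^ W"
  shows "exec occ_prog (st W inp l m \<alpha> a ks as)
    (st W inp (Suc l) m \<alpha> a (ks @ [Occ m l a]) (as @ occ_arcs (Occ m l a))) (2100 * (W + 2))"
proof -
  let ?q = "W + 2" and ?k = "Occ m l a"
  have e1: "exec (emit 13 occ_items) (st W inp l m \<alpha> a ks as) (st W inp l m \<alpha> a (ks @ [?k]) as) (450 * ?q)"
    by (rule exec_emit_vertex[OF assms regs_subset(1)]) (simp_all add: item_words length_item_lists)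
  have e2: "exec (emit 14 (pair_items occ_items anchor_items)) (st W inp l m \<alpha> a (ks @ [?k]) as)
      (st W inp l m \<alpha> a (ks @ [?k]) (as @ [(?k, Anchor a)])) (810 * ?q)"
    by (rule exec_emit_arc[OF assms regs_subset(1,2)]) (simp_all add: item_words length_item_lists)
  have e3: "exec (emit 14 (pair_items anchor_items occ_items)) (st W inp l m \<alpha> a (ks @ [?k]) (as @ [(?k, Anchor a)]))
      (st W inp l m \<alpha> a (ks @ [?k]) ((as @ [(?k, Anchor a)]) @ [(Anchor a, ?k)])) (810 * ?q)"
    by (rule exec_emit_arc[OF assms regs_subset(2,1)]) (simp_all add: item_words length_item_lists)
  let ?s = "st W inp l m \<alpha> a (ks @ [?k]) (as @ occ_arcs ?k)"
  have e4: "exec (Push 3 (Bit True)) ?s (?s(3 := Bit True # ?s 3)) 1"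
    by (rule exec_push)
  have e5: "exec (Pop 4) (?s(3 := Bit True # ?s 3)) (st W inp (Suc l) m \<alpha> a (ks @ [?k]) (as @ occ_arcs ?k)) 1"
  proof -
    have tl: "tl (replicate (W - l) (Bit False)) = replicate (W - Suc l) (Bit False)"
      by (cases "W - l") auto
    have "(?s(3 := Bit True # ?s 3))(4 := tl ((?s(3 := Bit True # ?s 3)) 4)) =
        ?s(3 := replicate (Suc l) (Bit True), 4 := replicate (W - Suc l) (Bit False))"
      using tl by (simp add: st_regs)
    then show ?thesis
      using exec_pop[of 4 "?s(3 := Bit True # ?s 3)"] by (simp only: st_upds)
  qed
  have e3': "exec (emit 14 (pair_items anchor_items occ_items)) (st W inp l m \<alpha> a (ks @ [?k]) (as @ [(?k, Anchor a)]))
      ?s (810 * ?q)"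
    using e3 by (simp add: occ_arcs_def)
  have "exec occ_prog (st W inp l m \<alpha> a ks as) (st W inp (Suc l) m \<alpha> a (ks @ [?k]) (as @ occ_arcs ?k))
      (450 * ?q + (810 * ?q + (810 * ?q + (1 + (1 + 1)))))"
    unfolding occ_prog_def
    by (intro exec_seqs_Cons[OF e1] exec_seqs_Cons[OF e2] exec_seqs_Cons[OF e3'] exec_seqs_Cons[OF e4]
        exec_seqs_Cons[OF e5]) (simp add: exec_skip[unfolded One_nat_def])
  then show ?thesis by (rule exec_mono) simp
qed

lemma exec_color_prog:
  assumes "a < 2 ^ W" "code c < 2 ^ W"
  shows "exec color_prog (st W (enc_nat c @ rest) l m \<alpha> a ks as) (st W rest l m \<alpha> (code c) ks as) (80 * (W + 2))"
proof -
  have inp: "Bit True # map Bit (nat_bits c) @ Close # rest = map Bit (nat_bits (code c)) @ Close # rest"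
    by (simp only: code_def nat_bits_double list.map append_Cons)
  have load: "exec load (st W (Bit True # map Bit (nat_bits c) @ Close # rest) l m \<alpha> a ks as)
      (st W (Close # rest) l m \<alpha> (code c) ks as) (70 * (W + 2))"
    by (rule exec_load_st[OF assms _ inp]) auto
  have "exec color_prog (st W (Open # map Bit (nat_bits c) @ Close # rest) l m \<alpha> a ks as)
      (st W rest l m \<alpha> (code c) ks as) (1 + (1 + (70 * (W + 2) + (1 + 1))))"
    unfolding color_prog_def
    by (intro exec_seqs_Cons[OF exec_Pop_0] exec_seqs_Cons[OF exec_Push_0] exec_seqs_Cons[OF load])
      (simp add: exec_skip[unfolded One_nat_def])
  then have "exec color_prog (st W (Open # map Bit (nat_bits c) @ Close # rest) l m \<alpha> a ks as)
      (st W rest l m \<alpha> (code c) ks as) (80 * (W + 2))"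
    by (rule exec_mono) simp
  then show ?thesis by (simp add: enc_nat_def)
qed

lemma length_enc_nat: "2 \<le> length (enc_nat n)"
  by (simp add: enc_nat_def)

text \<open>The time is charged to the input: each symbol pays \<open>3000 * (W + 2)\<close>, and an
  encoded color has at least two symbols. The code left in the registers depends on the last color
  read, hence the quantified \<open>a'\<close>.\<close>

lemma exec_colors_loop:
  assumes "l + length p \<le> W" "m \<le> W + 1" "\<alpha> \<le> W + 1" "a < 2 ^ W" "\<And>c. c \<in> set p \<Longrightarrow> code c < 2 ^ W"
  shows "\<exists>a'<2 ^ W. exec (Loop 0 {Some Open} (Seq color_prog occ_prog))
    (st W (concat (map enc_nat p) @ Close # rest) l m \<alpha> a ks as)
    (st W (Close # rest) (l + length p) m \<alpha> a'
      (ks @ map (\<lambda>(l, a). Occ m l a) (List.enumerate l (map code p)))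
      (as @ concat (map occ_arcs (map (\<lambda>(l, a). Occ m l a) (List.enumerate l (map code p))))))
    (length (concat (map enc_nat p)) * (3000 * (W + 2)) + 1)"
  using assms
proof (induction p arbitrary: l a ks as)
  case Nil
  then show ?case
    by (intro exI[of _ a]) (simp add: exec_loop_exit[unfolded One_nat_def] st_regs)
next
  case (Cons c p)
  let ?q = "W + 2" and ?k = "Occ m l (code c)"
  let ?inp = "concat (map enc_nat p) @ Close # rest"
  have c: "code c < 2 ^ W" using Cons.prems by simp
  obtain a' where a': "a' < 2 ^ W" and IH: "exec (Loop 0 {Some Open} (Seq color_prog occ_prog))
      (st W ?inp (Suc l) m \<alpha> (code c) (ks @ [?k]) (as @ occ_arcs ?k))
      (st W (Close # rest) (Suc l + length p) m \<alpha> a'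
        ((ks @ [?k]) @ map (\<lambda>(l, a). Occ m l a) (List.enumerate (Suc l) (map code p)))
        ((as @ occ_arcs ?k) @ concat (map occ_arcs (map (\<lambda>(l, a). Occ m l a) (List.enumerate (Suc l) (map code p))))))
      (length (concat (map enc_nat p)) * (3000 * ?q) + 1)"
    using Cons.IH[of "Suc l" "code c" "ks @ [?k]" "as @ occ_arcs ?k"] Cons.prems c by auto
  have body: "exec (Seq color_prog occ_prog) (st W (enc_nat c @ ?inp) l m \<alpha> a ks as)
      (st W ?inp (Suc l) m \<alpha> (code c) (ks @ [?k]) (as @ occ_arcs ?k)) (80 * ?q + 2100 * ?q)"
    using Cons.prems c by (intro exec_seq[OF exec_color_prog exec_occ_prog]) auto
  have "exec (Loop 0 {Some Open} (Seq color_prog occ_prog)) (st W (enc_nat c @ ?inp) l m \<alpha> a ks as)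
      (st W (Close # rest) (Suc l + length p) m \<alpha> a'
        ((ks @ [?k]) @ map (\<lambda>(l, a). Occ m l a) (List.enumerate (Suc l) (map code p)))
        ((as @ occ_arcs ?k) @ concat (map occ_arcs (map (\<lambda>(l, a). Occ m l a) (List.enumerate (Suc l) (map code p))))))
      ((80 * ?q + 2100 * ?q) + (length (concat (map enc_nat p)) * (3000 * ?q) + 1) + 1)"
    by (rule exec_loop_step[OF _ body IH]) (simp add: st_regs enc_nat_def)
  then have "exec (Loop 0 {Some Open} (Seq color_prog occ_prog)) (st W (concat (map enc_nat (c # p)) @ Close # rest) l m \<alpha> a ks as)
      (st W (Close # rest) (l + length (c # p)) m \<alpha> a'
        (ks @ map (\<lambda>(l, a). Occ m l a) (List.enumerate l (map code (c # p))))
        (as @ concat (map occ_arcs (map (\<lambda>(l, a). Occ m l a) (List.enumerate l (map code (c # p)))))))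
      ((80 * ?q + 2100 * ?q) + (length (concat (map enc_nat p)) * (3000 * ?q) + 1) + 1)"
    by simp
  moreover have "(80 * ?q + 2100 * ?q) + (length (concat (map enc_nat p)) * (3000 * ?q) + 1) + 1
      \<le> length (concat (map enc_nat (c # p))) * (3000 * ?q) + 1"
    using mult_right_mono[OF length_enc_nat[of c], of "3000 * ?q"] by (simp add: add_mult_distrib)
  ultimately show ?case
    using a' exec_mono by blast
qed

definition enc_position :: "nat list \<Rightarrow> word" where "enc_position = enc_list enc_nat"
definition enc_switch :: "nat list list \<Rightarrow> word" where "enc_switch = enc_list enc_position"

text \<open>The bound stays 1 below the budget of the encoded position, which pays for the test in
  the surrounding loop.\<close>

lemma exec_position_prog:
  assumes "length p < W" "m \<le> W + 1" "\<alpha> \<le> W + 1" "a < 2 ^ W" "hub < 2 ^ W" "\<And>c. c \<in> set p \<Longrightarrow> code c < 2 ^ W"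
  shows "\<exists>a'<2 ^ W. exec position_prog (st W (enc_position p @ rest) 0 m \<alpha> a ks as)
    (st W rest 0 (Suc m) \<alpha> a' (ks @ box_occs (m, p)) (as @ concat (map occ_arcs (box_occs (m, p)))))
    (length (enc_position p) * (3000 * (W + 2)) - 1)"
proof -
  let ?q = "W + 2" and ?k = "Occ m 0 hub"
  let ?inp = "concat (map enc_nat p) @ Close # rest"
  have load: "exec load (st W (Bit False # Bit True # ?inp) 0 m \<alpha> a ks as) (st W ?inp 0 m \<alpha> hub ks as) (70 * ?q)"
    by (rule exec_load_st[OF assms(4,5)]) (cases p; auto simp: nat_bits_2 enc_nat_def)+
  have occ: "exec occ_prog (st W ?inp 0 m \<alpha> hub ks as)
      (st W ?inp (Suc 0) m \<alpha> hub (ks @ [?k]) (as @ occ_arcs ?k)) (2100 * ?q)"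
    using assms by (intro exec_occ_prog) auto
  let ?box = "map (\<lambda>(l, a). Occ m l a) (List.enumerate (Suc 0) (map code p))"
  have box: "[?k] @ ?box = box_occs (m, p)"
    by (simp add: box_occs_def)
  obtain a' where a': "a' < 2 ^ W" and loop: "exec (Loop 0 {Some Open} (Seq color_prog occ_prog))
      (st W ?inp (Suc 0) m \<alpha> hub (ks @ [?k]) (as @ occ_arcs ?k))
      (st W (Close # rest) (Suc 0 + length p) m \<alpha> a' ((ks @ [?k]) @ ?box)
        ((as @ occ_arcs ?k) @ concat (map occ_arcs ?box)))
      (length (concat (map enc_nat p)) * (3000 * ?q) + 1)"
    using exec_colors_loop[of "Suc 0" p W m \<alpha> hub rest "ks @ [?k]" "as @ occ_arcs ?k"] assms by auto
  have as: "(as @ occ_arcs ?k) @ concat (map occ_arcs ?box) = as @ concat (map occ_arcs (box_occs (m, p)))"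
    unfolding box[symmetric] by simp
  have ks: "(ks @ [?k]) @ ?box = ks @ box_occs (m, p)"
    unfolding box[symmetric] by simp
  note loop = loop[unfolded as ks]
  let ?s = "\<lambda>l. st W rest l m \<alpha> a' (ks @ box_occs (m, p)) (as @ concat (map occ_arcs (box_occs (m, p))))"
  \<comment> \<open>The ones of the index block become zeros again; as \<open>length p < W\<close>,
    both registers together still hold \<open>W\<close> symbols.\<close>
  have reset: "exec (pour 3 UNIV [(4, \<lambda>_. Bit False)] []) (?s (Suc 0 + length p)) (?s 0) (7 * (W + 1))"
  proof (rule exec_pour_to[where u = "replicate (Suc (length p)) (Bit True)" and v = "[]"])
    let ?r = "replicate (W - Suc (length p)) (Bit False)"
    have "poured 3 [(4, \<lambda>_. Bit False)] [] (replicate (Suc (length p)) (Bit True)) [] (?s (Suc 0 + length p)) =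
        (?s (Suc 0 + length p))(3 := [], 4 := replicate (Suc (length p)) (Bit False) @ ?r)"
      by (auto simp: poured_def fun_eq_iff st_regs map_replicate_const replicate_append_same)
    also have "replicate (Suc (length p)) (Bit False) @ ?r = replicate (W - 0) (Bit False)"
      using less_imp_Suc_add[OF assms(1)] by (auto simp: replicate_add)
    also have "(?s (Suc 0 + length p))(3 := [], 4 := replicate (W - 0) (Bit False)) = ?s 0"
      using st_upds(6)[of W rest "Suc 0 + length p" m \<alpha> a' _ _ 0] by simp
    finally show "?s 0 = poured 3 [(4, \<lambda>_. Bit False)] [] (replicate (Suc (length p)) (Bit True)) []
        (?s (Suc 0 + length p))" ..
  qed (use assms(1) in \<open>auto simp: st_regs\<close>)
  have "exec position_prog (st W (Open # ?inp) 0 m \<alpha> a ks as)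
      (st W rest 0 (Suc m) \<alpha> a' (ks @ box_occs (m, p)) (as @ concat (map occ_arcs (box_occs (m, p)))))
      (1 + (1 + (1 + (70 * ?q + (2100 * ?q + ((length (concat (map enc_nat p)) * (3000 * ?q) + 1) +
        (1 + (7 * (W + 1) + (1 + 1)))))))))"
    unfolding position_prog_def
    by (intro exec_seqs_Cons[OF exec_Pop_0] exec_seqs_Cons[OF exec_Push_0] exec_seqs_Cons[OF load]
        exec_seqs_Cons[OF occ] exec_seqs_Cons[OF loop] exec_seqs_Cons[OF reset] exec_seqs_Cons[OF exec_Push_5])
      (simp add: exec_skip[unfolded One_nat_def])
  then have "exec position_prog (st W (Open # ?inp) 0 m \<alpha> a ks as)
      (st W rest 0 (Suc m) \<alpha> a' (ks @ box_occs (m, p)) (as @ concat (map occ_arcs (box_occs (m, p)))))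
      ((length (concat (map enc_nat p)) + 2) * (3000 * ?q) - 1)"
    by (rule exec_mono) (simp add: algebra_simps)
  moreover have "enc_position p @ rest = Open # ?inp" "length (enc_position p) = length (concat (map enc_nat p)) + 2"
    by (simp_all add: enc_position_def enc_list_def)
  ultimately show ?thesis
    using a' by auto
qed

lemma exec_positions_loop:
  assumes "\<And>p. p \<in> set S \<Longrightarrow> length p < W" "m + length S \<le> W + 1" "\<alpha> \<le> W + 1" "a < 2 ^ W" "hub < 2 ^ W"
    and "\<And>p c. p \<in> set S \<Longrightarrow> c \<in> set p \<Longrightarrow> code c < 2 ^ W"
  shows "\<exists>a'<2 ^ W. exec (Loop 0 {Some Open} position_prog)
    (st W (concat (map enc_position S) @ Close # rest) 0 m \<alpha> a ks as)
    (st W (Close # rest) 0 (m + length S) \<alpha> a' (ks @ concat (map box_occs (List.enumerate m S)))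
      (as @ concat (map occ_arcs (concat (map box_occs (List.enumerate m S))))))
    (length (concat (map enc_position S)) * (3000 * (W + 2)) + 1)"
  using assms
proof (induction S arbitrary: m a ks as)
  case Nil
  then show ?case
    by (intro exI[of _ a]) (simp add: exec_loop_exit[unfolded One_nat_def] st_regs)
next
  case (Cons p S)
  let ?q = "W + 2"
  let ?inp = "concat (map enc_position S) @ Close # rest"
  let ?ks = "ks @ box_occs (m, p)" and ?as = "as @ concat (map occ_arcs (box_occs (m, p)))"
  obtain a1 where a1: "a1 < 2 ^ W" and body: "exec position_prog (st W (enc_position p @ ?inp) 0 m \<alpha> a ks as)
      (st W ?inp 0 (Suc m) \<alpha> a1 ?ks ?as) (length (enc_position p) * (3000 * ?q) - 1)"
    using exec_position_prog[of p W m \<alpha> a ?inp ks as] Cons.prems by auto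
  obtain a' where a': "a' < 2 ^ W" and IH: "exec (Loop 0 {Some Open} position_prog)
      (st W ?inp 0 (Suc m) \<alpha> a1 ?ks ?as)
      (st W (Close # rest) 0 (Suc m + length S) \<alpha> a' (?ks @ concat (map box_occs (List.enumerate (Suc m) S)))
        (?as @ concat (map occ_arcs (concat (map box_occs (List.enumerate (Suc m) S))))))
      (length (concat (map enc_position S)) * (3000 * ?q) + 1)"
    using Cons.IH[of "Suc m" a1 ?ks ?as] Cons.prems a1 by auto
  have top: "top_symbol (st W (enc_position p @ ?inp) 0 m \<alpha> a ks as 0) \<in> {Some Open}"
    by (simp add: st_regs enc_position_def enc_list_def)
  have pos: "0 < length (enc_position p) * (3000 * ?q)"
    by (simp add: enc_position_def enc_list_def)
  have "exec (Loop 0 {Some Open} position_prog) (st W (enc_position p @ ?inp) 0 m \<alpha> a ks as)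
      (st W (Close # rest) 0 (Suc m + length S) \<alpha> a' (?ks @ concat (map box_occs (List.enumerate (Suc m) S)))
        (?as @ concat (map occ_arcs (concat (map box_occs (List.enumerate (Suc m) S))))))
      (length (concat (map enc_position (p # S))) * (3000 * ?q) + 1)"
    by (rule exec_mono[OF exec_loop_step[OF top body IH]]) (use pos in \<open>simp add: add_mult_distrib\<close>)
  then show ?case
    using a' by (intro exI[of _ a']) simp
qed

lemma exec_switch_prog:
  assumes "\<And>p. p \<in> set S \<Longrightarrow> length p < W" "m + length S + 1 \<le> W + 1" "\<alpha> \<le> W + 1" "a < 2 ^ W" "hub < 2 ^ W"
    and "\<And>p c. p \<in> set S \<Longrightarrow> c \<in> set p \<Longrightarrow> code c < 2 ^ W"
  shows "\<exists>a'<2 ^ W. exec switch_prog (st W (enc_switch S @ rest) 0 m \<alpha> a ks as)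
    (st W rest 0 (m + length S + 2) m a' (ks @ switch_keys (m, S)) (as @ switch_arcs (m, S)))
    (length (enc_switch S) * (3000 * (W + 2)) - 1)"
proof -
  let ?q = "W + 2"
  let ?inp = "concat (map enc_position S) @ Close # rest"
  let ?s = "st W ?inp 0 m \<alpha> a ks as"
  have "poured 6 [] [] (replicate \<alpha> (Bit True)) [] ?s = ?s(6 := [])"
    by (auto simp: poured_def fun_eq_iff)
  also have "\<dots> = st W ?inp 0 m 0 a ks as"
    using st_upds(3)[of W ?inp 0 m \<alpha> a ks as 0] by simp
  finally have clear: "exec (pour 6 UNIV [] []) ?s (st W ?inp 0 m 0 a ks as) (6 * (W + 2))"
    using assms(3) by (intro exec_pour_to[where u = "replicate \<alpha> (Bit True)" and v = "[]"]) (auto simp: st_regs)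
  have "exec (copy 5 6) (st W ?inp 0 m 0 a ks as)
      ((st W ?inp 0 m 0 a ks as)(6 := rev (st W ?inp 0 m 0 a ks as 5) @ st W ?inp 0 m 0 a ks as 6)) (20 * (W + 1 + 1))"
    by (rule exec_copy) (use assms(2) in \<open>auto simp: st_regs\<close>)
  then have cp: "exec (copy 5 6) (st W ?inp 0 m 0 a ks as) (st W ?inp 0 m m a ks as) (20 * ?q)"
    by (simp add: st_regs st_upds)
  let ?occs = "concat (map box_occs (List.enumerate (Suc m) S))"
  let ?M = "Suc m + length S"
  obtain a' where a': "a' < 2 ^ W" and loop: "exec (Loop 0 {Some Open} position_prog)
      (st W ?inp 0 (Suc m) m a ks as)
      (st W (Close # rest) 0 ?M m a' (ks @ ?occs) (as @ concat (map occ_arcs ?occs)))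
      (length (concat (map enc_position S)) * (3000 * ?q) + 1)"
    using exec_positions_loop[of S W "Suc m" m a rest ks as] assms by auto
  have b: "0 \<le> W" "?M \<le> W + 1" "m \<le> W + 1" "a' < 2 ^ W"
    using assms(2) a' by auto
  let ?as = "as @ concat (map occ_arcs ?occs)"
  have e1: "exec (emit 13 src_items) (st W rest 0 ?M m a' (ks @ ?occs) ?as)
      (st W rest 0 ?M m a' ((ks @ ?occs) @ [Src m ?M]) ?as) (401 * ?q)"
    by (rule exec_emit_vertex[OF b regs_subset(3)]) (simp_all add: item_words length_item_lists)
  have e2: "exec (emit 13 snk_items) (st W rest 0 ?M m a' ((ks @ ?occs) @ [Src m ?M]) ?as)
      (st W rest 0 ?M m a' (((ks @ ?occs) @ [Src m ?M]) @ [Snk m ?M]) ?as) (401 * ?q)"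
    by (rule exec_emit_vertex[OF b regs_subset(4)]) (simp_all add: item_words length_item_lists)
  have e3: "exec (emit 14 (pair_items snk_items src_items))
      (st W rest 0 ?M m a' (((ks @ ?occs) @ [Src m ?M]) @ [Snk m ?M]) ?as)
      (st W rest 0 ?M m a' (((ks @ ?occs) @ [Src m ?M]) @ [Snk m ?M]) (?as @ [(Snk m ?M, Src m ?M)])) (841 * ?q)"
    by (rule exec_emit_arc[OF b regs_subset(4,3)]) (simp_all add: item_words length_item_lists)
  have "exec switch_prog (st W (Open # ?inp) 0 m \<alpha> a ks as)
      (st W rest 0 (Suc ?M) m a' (((ks @ ?occs) @ [Src m ?M]) @ [Snk m ?M]) (?as @ [(Snk m ?M, Src m ?M)]))
      (1 + (6 * ?q + (20 * ?q + (1 + ((length (concat (map enc_position S)) * (3000 * ?q) + 1) +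
        (1 + (401 * ?q + (401 * ?q + (841 * ?q + (1 + 1))))))))))"
    unfolding switch_prog_def
    by (intro exec_seqs_Cons[OF exec_Pop_0] exec_seqs_Cons[OF clear] exec_seqs_Cons[OF cp] exec_seqs_Cons[OF exec_Push_5]
        exec_seqs_Cons[OF loop] exec_seqs_Cons[OF e1] exec_seqs_Cons[OF e2] exec_seqs_Cons[OF e3])
      (simp add: exec_skip[unfolded One_nat_def])
  then have "exec switch_prog (st W (Open # ?inp) 0 m \<alpha> a ks as)
      (st W rest 0 (Suc ?M) m a' (((ks @ ?occs) @ [Src m ?M]) @ [Snk m ?M]) (?as @ [(Snk m ?M, Src m ?M)]))
      ((length (concat (map enc_position S)) + 2) * (3000 * ?q) - 1)"
    by (rule exec_mono) (simp add: algebra_simps)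
  moreover have "enc_switch S @ rest = Open # ?inp" "length (enc_switch S) = length (concat (map enc_position S)) + 2"
    by (simp_all add: enc_switch_def enc_list_def)
  moreover have "((ks @ ?occs) @ [Src m ?M]) @ [Snk m ?M] = ks @ switch_keys (m, S)"
    "?as @ [(Snk m ?M, Src m ?M)] = as @ switch_arcs (m, S)" "Suc ?M = m + length S + 2"
    by (simp_all add: switch_keys_def switch_arcs_def switch_occs_def boxes_def top_level_def)
  ultimately show ?thesis
    using a' by (intro exI[of _ a']) simp
qed

lemma exec_switches_loop:
  assumes "\<forall>S\<in>set xs. \<forall>p\<in>set S. length p < W \<and> (\<forall>c\<in>set p. code c < 2 ^ W)" "m + (\<Sum>S\<leftarrow>xs. length S + 2) \<le> W + 1"
    and "\<alpha> \<le> W + 1" "a < 2 ^ W" "hub < 2 ^ W"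
  shows "\<exists>m' \<alpha>' a'. exec (Loop 0 {Some Open} switch_prog)
    (st W (concat (map enc_switch xs) @ Close # rest) 0 m \<alpha> a ks as)
    (st W (Close # rest) 0 m' \<alpha>' a' (ks @ concat (map switch_keys (levelled m xs)))
      (as @ concat (map switch_arcs (levelled m xs))))
    (length (concat (map enc_switch xs)) * (3000 * (W + 2)) + 1)"
  using assms
proof (induction xs arbitrary: m \<alpha> a ks as)
  case Nil
  then show ?case
    by (intro exI[of _ m] exI[of _ \<alpha>] exI[of _ a]) (simp add: exec_loop_exit[unfolded One_nat_def] st_regs)
next
  case (Cons S xs)
  let ?q = "W + 2"
  let ?inp = "concat (map enc_switch xs) @ Close # rest"
  let ?ks = "ks @ switch_keys (m, S)" and ?as = "as @ switch_arcs (m, S)" and ?m = "m + length S + 2"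
  obtain a1 where a1: "a1 < 2 ^ W" and body: "exec switch_prog (st W (enc_switch S @ ?inp) 0 m \<alpha> a ks as)
      (st W ?inp 0 ?m m a1 ?ks ?as) (length (enc_switch S) * (3000 * ?q) - 1)"
  proof -
    have "length p < W" "c \<in> set p \<Longrightarrow> code c < 2 ^ W" if "p \<in> set S" for p c
      using Cons.prems(1) that by auto
    moreover have "m + length S + 1 \<le> W + 1"
      using Cons.prems(2) by simp
    ultimately show thesis
      using exec_switch_prog[of S W m \<alpha> a ?inp ks as] Cons.prems(3-5) that by blast
  qed
  have "m \<le> W + 1" "?m + (\<Sum>S\<leftarrow>xs. length S + 2) \<le> W + 1"
    using Cons.prems(2) by auto
  then obtain m' \<alpha>' a' where IH: "exec (Loop 0 {Some Open} switch_prog)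
      (st W ?inp 0 ?m m a1 ?ks ?as)
      (st W (Close # rest) 0 m' \<alpha>' a' (?ks @ concat (map switch_keys (levelled ?m xs)))
        (?as @ concat (map switch_arcs (levelled ?m xs))))
      (length (concat (map enc_switch xs)) * (3000 * ?q) + 1)"
  proof -
    assume m: "m \<le> W + 1" and sum: "?m + (\<Sum>S\<leftarrow>xs. length S + 2) \<le> W + 1"
    have "\<forall>S\<in>set xs. \<forall>p\<in>set S. length p < W \<and> (\<forall>c\<in>set p. code c < 2 ^ W)"
      using Cons.prems(1) by simp
    from Cons.IH[of ?m m a1 ?ks ?as, OF this sum m a1 Cons.prems(5)]
    show thesis
      using that by blast
  qed
  have top: "top_symbol (st W (enc_switch S @ ?inp) 0 m \<alpha> a ks as 0) \<in> {Some Open}"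
    by (simp add: st_regs enc_switch_def enc_list_def)
  have pos: "0 < length (enc_switch S) * (3000 * ?q)"
    by (simp add: enc_switch_def enc_list_def)
  have "exec (Loop 0 {Some Open} switch_prog) (st W (enc_switch S @ ?inp) 0 m \<alpha> a ks as)
      (st W (Close # rest) 0 m' \<alpha>' a' (?ks @ concat (map switch_keys (levelled ?m xs)))
        (?as @ concat (map switch_arcs (levelled ?m xs))))
      (length (concat (map enc_switch (S # xs))) * (3000 * ?q) + 1)"
    by (rule exec_mono[OF exec_loop_step[OF top body IH]]) (use pos in \<open>simp add: add_mult_distrib\<close>)
  then show ?case
    by (intro exI[of _ m'] exI[of _ \<alpha>'] exI[of _ a']) simp
qed

lemma exec_anchors_loop:
  assumes "m \<le> W + 1" "\<alpha> \<le> W + 1" "a < 2 ^ W" "\<And>c. c \<in> set cs \<Longrightarrow> code c < 2 ^ W"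
  shows "\<exists>a'<2 ^ W. exec (Loop 0 {Some Open} (Seq color_prog (emit 13 anchor_items)))
    (st W (concat (map enc_nat cs) @ Close # rest) 0 m \<alpha> a ks as)
    (st W (Close # rest) 0 m \<alpha> a' (ks @ map Anchor (map code cs)) as)
    (length (concat (map enc_nat cs)) * (3000 * (W + 2)) + 1)"
  using assms
proof (induction cs arbitrary: a ks)
  case Nil
  then show ?case
    by (intro exI[of _ a]) (simp add: exec_loop_exit[unfolded One_nat_def] st_regs)
next
  case (Cons c cs)
  let ?q = "W + 2"
  let ?inp = "concat (map enc_nat cs) @ Close # rest" and ?ks = "ks @ [Anchor (code c)]"
  have c: "code c < 2 ^ W" using Cons.prems by simp
  have emit: "exec (emit 13 anchor_items) (st W ?inp 0 m \<alpha> (code c) ks as) (st W ?inp 0 m \<alpha> (code c) ?ks as) (321 * ?q)"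
    by (rule exec_emit_vertex[OF _ Cons.prems(1,2) c regs_subset(2)]) (simp_all add: item_words length_item_lists)
  have body: "exec (Seq color_prog (emit 13 anchor_items)) (st W (enc_nat c @ ?inp) 0 m \<alpha> a ks as)
      (st W ?inp 0 m \<alpha> (code c) ?ks as) (80 * ?q + 321 * ?q)"
    by (rule exec_seq[OF exec_color_prog[OF Cons.prems(3) c] emit])
  obtain a' where a': "a' < 2 ^ W" and IH: "exec (Loop 0 {Some Open} (Seq color_prog (emit 13 anchor_items)))
      (st W ?inp 0 m \<alpha> (code c) ?ks as)
      (st W (Close # rest) 0 m \<alpha> a' (?ks @ map Anchor (map code cs)) as)
      (length (concat (map enc_nat cs)) * (3000 * ?q) + 1)"
    using Cons.IH[of "code c" ?ks] Cons.prems c by auto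
  have top: "top_symbol (st W (enc_nat c @ ?inp) 0 m \<alpha> a ks as 0) \<in> {Some Open}"
    by (simp add: st_regs enc_nat_def)
  have "exec (Loop 0 {Some Open} (Seq color_prog (emit 13 anchor_items))) (st W (enc_nat c @ ?inp) 0 m \<alpha> a ks as)
      (st W (Close # rest) 0 m \<alpha> a' (?ks @ map Anchor (map code cs)) as)
      (length (concat (map enc_nat (c # cs))) * (3000 * ?q) + 1)"
    by (rule exec_mono[OF exec_loop_step[OF top body IH]])
      (use mult_right_mono[OF length_enc_nat[of c], of "3000 * ?q"] in \<open>simp add: add_mult_distrib\<close>)
  then show ?case
    using a' by (intro exI[of _ a']) simp
qed


subsection \<open>The complete program\<close>

definition enc_instance :: "nat list \<Rightarrow> nat list list list \<Rightarrow> word" where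
  "enc_instance cs xs = enc_pair (enc_list enc_nat) (enc_list (enc_list (enc_list enc_nat))) (cs, xs)"

definition out_word :: "nat \<Rightarrow> key list \<Rightarrow> (key \<times> key) list \<Rightarrow> word" where
  "out_word W ks as = Open # Open # concat (map (point_word W) ks) @
     Close # Open # concat (map (arc_word W) as) @ [Close, Close]"

lemma enc_instance_eq: "enc_instance cs xs =
    Open # Open # concat (map enc_nat cs) @ Close # Open # concat (map enc_switch xs) @ [Close, Close]"
  by (simp add: enc_instance_def enc_pair_def enc_list_def[of enc_nat cs] enc_list_def[of _ xs]
      enc_switch_def enc_position_def)

lemma length_le_concat: "x \<in> set xs \<Longrightarrow> length (f x) \<le> length (concat (map f xs))"
  by (induction xs) auto

lemma length_le_length_concat: "(\<And>x. x \<in> set xs \<Longrightarrow> 0 < length (f x)) \<Longrightarrow> length xs \<le> length (concat (map f xs))"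
proof (induction xs)
  case (Cons x xs)
  then have "0 < length (f x)" "length xs \<le> length (concat (map f xs))" by auto
  then show ?case
    unfolding list.map concat.simps length_append list.size by linarith
qed simp

text \<open>The two brackets of an encoded number leave room for the additional low bit of the
  code.\<close>

lemma code_less_power: "length (enc_nat c) \<le> W \<Longrightarrow> code c < 2 ^ W"
proof -
  assume "length (enc_nat c) \<le> W"
  then have "(2::nat) ^ (length (nat_bits c) + 1) \<le> 2 ^ W"
    by (intro power_increasing) (auto simp: enc_nat_def)
  then show ?thesis
    using less_length_nat_bits[of c] by (simp add: code_def)
qed

text \<open>Every color, position and switch spends brackets of its own, so the length of the input
  bounds codes, indices and levels at once.\<close>

lemma input_bounds:
  assumes "W = length (enc_instance cs xs)"
  shows "hub < 2 ^ W" "c \<in> set cs \<Longrightarrow> code c < 2 ^ W"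
    "S \<in> set xs \<Longrightarrow> p \<in> set S \<Longrightarrow> length p < W" "(\<Sum>S\<leftarrow>xs. length S + 2) \<le> W"
proof -
  have W: "W = 6 + length (concat (map enc_nat cs)) + length (concat (map enc_switch xs))"
    using assms by (simp add: enc_instance_eq)
  have "(2::nat) ^ 2 \<le> 2 ^ W"
    using W by (intro power_increasing) auto
  then show "hub < 2 ^ W" by simp
  show "c \<in> set cs \<Longrightarrow> code c < 2 ^ W"
    using length_le_concat[of c cs enc_nat] W by (intro code_less_power) linarith
  have pos: "length p < length (enc_position p)" for p
    using length_le_length_concat[of p enc_nat] by (simp add: enc_position_def enc_list_def enc_nat_def)
  show "length p < W" if "S \<in> set xs" "p \<in> set S"
  proof -
    have "length (enc_position p) \<le> length (enc_switch S)"
      using length_le_concat[OF that(2), of enc_position] by (simp add: enc_switch_def enc_list_def)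
    then show ?thesis
      using pos[of p] length_le_concat[OF that(1), of enc_switch] W by linarith
  qed
  have "length S + 2 \<le> length (enc_switch S)" for S
    using length_le_length_concat[of S enc_position] by (simp add: enc_switch_def enc_list_def enc_position_def)
  then have "(\<Sum>S\<leftarrow>xs. length S + 2) \<le> (\<Sum>S\<leftarrow>xs. length (enc_switch S))"
    by (intro sum_list_mono)
  then show "(\<Sum>S\<leftarrow>xs. length S + 2) \<le> W"
    using W by (simp add: length_concat comp_def)
qed

lemma exec_Push_0_mk: "exec (Push 0 b) (mk W inp l m \<alpha> cp dp ab v e) (mk W (b # inp) l m \<alpha> cp dp ab v e) 1"
proof -
  have "(mk W inp l m \<alpha> cp dp ab v e)(0 := b # mk W inp l m \<alpha> cp dp ab v e 0) = mk W (b # inp) l m \<alpha> cp dp ab v e"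
    by (auto simp: mk_def fun_eq_iff)
  then show ?thesis using exec_push by metis
qed

lemma exec_Pop_0_mk: "exec (Pop 0) (mk W (b # inp) l m \<alpha> cp dp ab v e) (mk W inp l m \<alpha> cp dp ab v e) 1"
proof -
  have "(mk W (b # inp) l m \<alpha> cp dp ab v e)(0 := tl (mk W (b # inp) l m \<alpha> cp dp ab v e 0)) = mk W inp l m \<alpha> cp dp ab v e"
    by (auto simp: mk_def fun_eq_iff)
  then show ?thesis using exec_pop by metis
qed

lemma exec_reduction_prog:
  assumes w: "w = enc_instance cs xs" and W: "W = length w"
    and colors: "\<forall>S\<in>set xs. \<forall>p\<in>set S. set p \<subseteq> set cs"
  shows "\<exists>m \<alpha> a. exec reduction_prog (initial_store w) (st W [] 0 m \<alpha> a (all_keys cs xs) (all_arcs xs))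
    (3000 * (W + 2) * W)"
proof -
  note bounds = input_bounds[of W cs xs, OF W[unfolded w]]
  let ?q = "W + 2"
  let ?sw = "concat (map enc_switch xs) @ [Close, Close]"
  let ?cs = "concat (map enc_nat cs) @ Close # Open # ?sw"
  have w': "w = Open # Open # ?cs"
    by (simp add: w enc_instance_eq)
  have lenW: "W = 6 + length (concat (map enc_nat cs)) + length (concat (map enc_switch xs))"
    by (simp add: W w')
  define s1 :: store where "s1 = (\<lambda>_. [])(1 := rev w, 2 := replicate W (Bit True), 4 := replicate W (Bit False))"
  let ?s2 = "\<lambda>inp. mk W inp 0 0 0 [] [] [] [] []"
  have e1: "exec (pour 0 UNIV [(1, id), (2, \<lambda>_. Bit True), (4, \<lambda>_. Bit False)] []) (initial_store w) s1 (9 * (W + 1))"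
    by (rule exec_pour_to[where u = w and v = "[]"])
      (auto simp: initial_store_def s1_def poured_def fun_eq_iff map_replicate_const W)
  have e2: "exec (pour 1 UNIV [(0, id)] []) s1 (?s2 w) (7 * (W + 1))"
    by (rule exec_pour_to[where u = "rev w" and v = "[]"])
      (auto simp: s1_def mk_def poured_def fun_eq_iff W)
  have load: "exec load (?s2 (Bit False # Bit True # ?cs)) (st W ?cs 0 0 0 hub [] []) (70 * ?q)"
  proof -
    have "length (nat_bits hub) \<le> W"
      by (rule length_nat_bits_le[OF bounds(1)])
    moreover have "top_symbol ?cs \<notin> range (Some \<circ> Bit)"
      by (cases cs) (auto simp: enc_nat_def)
    ultimately show ?thesis
      using exec_load[of "nat_bits hub" W "[]" "[]" "[]" ?cs 0 0 0 "[]" "[]"] by (simp add: st_def nat_bits_2)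
  qed
  have anchor: "exec (emit 13 anchor_items) (st W ?cs 0 0 0 hub [] []) (st W ?cs 0 0 0 hub ([] @ [Anchor hub]) []) (321 * ?q)"
    by (rule exec_emit_vertex[OF _ _ _ bounds(1) regs_subset(2)]) (simp_all add: item_words length_item_lists)
  obtain a where a: "a < 2 ^ W" and anchors: "exec (Loop 0 {Some Open} (Seq color_prog (emit 13 anchor_items)))
      (st W ?cs 0 0 0 hub ([] @ [Anchor hub]) [])
      (st W (Close # Open # ?sw) 0 0 0 a (([] @ [Anchor hub]) @ map Anchor (map code cs)) [])
      (length (concat (map enc_nat cs)) * (3000 * ?q) + 1)"
    using exec_anchors_loop[of 0 W 0 hub cs "Open # ?sw" "[] @ [Anchor hub]" "[]"] bounds(1,2) by auto
  let ?ks = "([] @ [Anchor hub]) @ map Anchor (map code cs)"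
  have positions: "\<forall>S\<in>set xs. \<forall>p\<in>set S. length p < W \<and> (\<forall>c\<in>set p. code c < 2 ^ W)"
    using bounds(2,3) colors by blast
  have sum: "1 + (\<Sum>S\<leftarrow>xs. length S + 2) \<le> W + 1"
    using bounds(4) by simp
  obtain m \<alpha> a' where switches: "exec (Loop 0 {Some Open} switch_prog)
      (st W ?sw 0 (Suc 0) 0 a ?ks [])
      (st W [Close, Close] 0 m \<alpha> a' (?ks @ concat (map switch_keys (levelled 1 xs)))
        ([] @ concat (map switch_arcs (levelled 1 xs))))
      (length (concat (map enc_switch xs)) * (3000 * ?q) + 1)"
    using exec_switches_loop[of xs W 1 0 a "[Close]" ?ks "[]", OF positions sum _ a bounds(1)] by auto
  have run: "exec reduction_prog (initial_store w)
      (st W [] 0 m \<alpha> a' (?ks @ concat (map switch_keys (levelled 1 xs))) ([] @ concat (map switch_arcs (levelled 1 xs))))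
      (9 * (W + 1) + (7 * (W + 1) + (1 + (1 + (1 + (1 + (70 * ?q + (321 * ?q +
        ((length (concat (map enc_nat cs)) * (3000 * ?q) + 1) + (1 + (1 + (1 +
          ((length (concat (map enc_switch xs)) * (3000 * ?q) + 1) + (1 + (1 + 1)))))))))))))))"
    unfolding reduction_prog_def
    by (intro exec_seqs_Cons[OF e1] exec_seqs_Cons[OF e2[unfolded w']] exec_seqs_Cons[OF exec_Pop_0_mk]
        exec_seqs_Cons[OF exec_Push_0_mk] exec_seqs_Cons[OF load] exec_seqs_Cons[OF anchor]
        exec_seqs_Cons[OF anchors] exec_seqs_Cons[OF exec_Pop_0] exec_seqs_Cons[OF exec_Push_5]
        exec_seqs_Cons[OF switches]) (simp add: exec_skip[unfolded One_nat_def])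
  have keys: "?ks @ concat (map switch_keys (levelled 1 xs)) = all_keys cs xs"
    by (simp add: all_keys_def)
  have arcs: "[] @ concat (map switch_arcs (levelled 1 xs)) = all_arcs xs"
    by (simp add: all_arcs_def)
  \<comment> \<open>The 6 stands for the brackets of the pair and its two lists; their share of the
    budget pays for all work outside the loops.\<close>
  have time: "9 * (W + 1) + (7 * (W + 1) + (1 + (1 + (1 + (1 + (70 * ?q + (321 * ?q +
        ((x * (3000 * ?q) + 1) + (1 + (1 + (1 + ((y * (3000 * ?q) + 1) + (1 + (1 + 1))))))))))))))
      \<le> 3000 * ?q * (6 + x + y)" for x y
    by (simp add: algebra_simps)
  show ?thesis
    using exec_mono[OF run[unfolded keys arcs]
        time[of "length (concat (map enc_nat cs))" "length (concat (map enc_switch xs))", folded lenW]]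
    by (intro exI)
qed

lemma exec_output_prog:
  assumes "s 0 = []" "s 13 = rev v" "s 14 = rev e" "length v \<le> T" "length e \<le> T"
  shows "\<exists>s'. exec output_prog s s' (14 * T + 30) \<and>
    s' 0 = Open # Open # v @ Close # Open # e @ [Close, Close]"
proof -
  define s1 where "s1 = s(0 := [Close])"
  define s2 where "s2 = s(0 := [Close, Close])"
  define s3 where "s3 = s2(0 := e @ [Close, Close], 14 := [])"
  define s4 where "s4 = s3(0 := Open # e @ [Close, Close])"
  define s5 where "s5 = s3(0 := Close # Open # e @ [Close, Close])"
  define s6 where "s6 = s5(0 := v @ Close # Open # e @ [Close, Close], 13 := [])"
  define s7 where "s7 = s6(0 := Open # v @ Close # Open # e @ [Close, Close])"
  define s8 where "s8 = s6(0 := Open # Open # v @ Close # Open # e @ [Close, Close])"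
  note defs = s1_def s2_def s3_def s4_def s5_def s6_def s7_def s8_def
  have e1: "exec (Push 0 Close) s s1 1"
    using exec_push[of 0 Close s] assms(1) by (simp add: defs)
  have e2: "exec (Push 0 Close) s1 s2 1"
    using exec_push[of 0 Close s1] by (simp add: defs)
  have e3: "exec (pour 14 UNIV [(0, id)] []) s2 s3 (7 * (T + 1))"
    by (rule exec_pour_to[where u = "rev e" and v = "[]"])
      (use assms in \<open>auto simp: poured_def fun_eq_iff defs\<close>)
  have e4: "exec (Push 0 Open) s3 s4 1"
    using exec_push[of 0 Open s3] by (simp add: defs fun_upd_twist)
  have e5: "exec (Push 0 Close) s4 s5 1"
    using exec_push[of 0 Close s4] by (simp add: defs fun_upd_twist)
  have e6: "exec (pour 13 UNIV [(0, id)] []) s5 s6 (7 * (T + 1))"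
    by (rule exec_pour_to[where u = "rev v" and v = "[]"])
      (use assms in \<open>auto simp: poured_def fun_eq_iff defs\<close>)
  have e7: "exec (Push 0 Open) s6 s7 1"
    using exec_push[of 0 Open s6] by (simp add: defs fun_upd_twist)
  have e8: "exec (Push 0 Open) s7 s8 1"
    using exec_push[of 0 Open s7] by (simp add: defs fun_upd_twist)
  have "exec output_prog s s8 (1 + (1 + (7 * (T + 1) + (1 + (1 + (7 * (T + 1) + (1 + (1 + 1))))))))"
    unfolding output_prog_def
    by (intro exec_seqs_Cons[OF e1] exec_seqs_Cons[OF e2] exec_seqs_Cons[OF e3] exec_seqs_Cons[OF e4]
        exec_seqs_Cons[OF e5] exec_seqs_Cons[OF e6] exec_seqs_Cons[OF e7] exec_seqs_Cons[OF e8])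
      (simp add: exec_skip[unfolded One_nat_def])
  then have "exec output_prog s s8 (14 * T + 30)"
    by (rule exec_mono) simp
  then show ?thesis
    by (intro exI[of _ s8]) (simp add: defs)
qed

definition full_prog :: program where
  "full_prog = Seq reduction_prog output_prog"

text \<open>\<open>45000 = 15 * 3000\<close>: by \<open>run_length_le\<close> both output registers
  are at most as long as the time of the first program, and writing them out costs 14 times that
  time plus 30.\<close>

lemma run_full_prog:
  assumes w: "w = enc_instance cs xs" and colors: "\<forall>S\<in>set xs. \<forall>p\<in>set S. set p \<subseteq> set cs"
  shows "\<exists>t s. run full_prog (initial_store w) t s \<and> s 0 = out_word (length w) (all_keys cs xs) (all_arcs xs)
    \<and> t \<le> 45000 * (length w + 2) * length w + 30"
proof -
  define W where "W = length w"
  obtain m \<alpha> a where red: "exec reduction_prog (initial_store w)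
      (st W [] 0 m \<alpha> a (all_keys cs xs) (all_arcs xs)) (3000 * (W + 2) * W)"
    using exec_reduction_prog[OF w W_def colors] by blast
  let ?s = "st W [] 0 m \<alpha> a (all_keys cs xs) (all_arcs xs)" and ?T = "3000 * (W + 2) * W"
  obtain t where t: "t \<le> ?T" "run reduction_prog (initial_store w) t ?s"
    using red unfolding exec_def by blast
  have v: "length (concat (map (point_word W) (all_keys cs xs))) \<le> ?T"
    using run_length_le[OF t(2), of 13] t(1) by (simp add: st_regs initial_store_def)
  have e: "length (concat (map (arc_word W) (all_arcs xs))) \<le> ?T"
    using run_length_le[OF t(2), of 14] t(1) by (simp add: st_regs initial_store_def)
  obtain s' where s': "exec output_prog ?s s' (14 * ?T + 30)"
    "s' 0 = out_word W (all_keys cs xs) (all_arcs xs)"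
    using exec_output_prog[of ?s, OF st_regs(1,11,12) v e] unfolding out_word_def by blast
  have "exec full_prog (initial_store w) s' (?T + (14 * ?T + 30))"
    unfolding full_prog_def by (rule exec_seq[OF red s'(1)])
  then have "exec full_prog (initial_store w) s' (45000 * (W + 2) * W + 30)"
    by (rule exec_mono) simp
  then show ?thesis
    using s'(2) unfolding exec_def W_def by blast
qed

section \<open>Closed Euler trails after adding arcs\<close>

abbreviation arcs_mset :: "'a pair_pre_digraph \<Rightarrow> ('a \<times> 'a) multiset \<Rightarrow> ('a \<times> 'a) multiset" where
  "arcs_mset G E \<equiv> mset_set (parcs G) + E"

lemma add_arcs_simps:
  "verts (add_arcs G E) = pverts G"
  "arcs (add_arcs G E) = {(a, i). i < count (arcs_mset G E) a}"
  "tail (add_arcs G E) e = fst (fst e)"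
  "head (add_arcs G E) e = snd (fst e)"
  by (auto simp: add_arcs_def split: prod.splits)

text \<open>Drops telescope to 0 along a closed trail, and the trail uses each arc exactly once.
  Quantified over all \<open>\<phi>\<close>, this is the equality of in- and out-degrees without any
  counting.\<close>

lemma closed_euler_trail_flow:
  fixes \<phi> :: "'a \<Rightarrow> rat"
  assumes "has_closed_euler_trail (add_arcs G E)"
  shows "(\<Sum>a\<in>#arcs_mset G E. \<phi> (fst a) - \<phi> (snd a)) = 0"
proof -
  let ?H = "add_arcs G E"
  obtain u p where p: "pre_digraph.euler_trail ?H u p u"
    using assms by (auto simp: has_closed_euler_trail_def)
  then have cas: "pre_digraph.cas ?H u p u" and d: "distinct p" and sp: "set p = arcs ?H"
    by (auto simp: pre_digraph.euler_trail_def pre_digraph.trail_def pre_digraph.awalk_def)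
  have "(\<Sum>e\<leftarrow>p. \<phi> (fst (fst e)) - \<phi> (snd (fst e))) = 0"
    using cas_telescope[OF cas, of \<phi>] by (simp add: add_arcs_simps)
  then have "(\<Sum>e\<in>arcs ?H. \<phi> (fst (fst e)) - \<phi> (snd (fst e))) = 0"
    using d sp by (simp add: sum_list_distinct_conv_sum_set)
  then show ?thesis
    using copies_of_arcs[of "arcs_mset G E" "\<lambda>a. \<phi> (fst a) - \<phi> (snd a)"] by (simp add: add_arcs_simps)
qed

lemma cas_same_side:
  assumes "pre_digraph.cas H u p v" "\<And>e. e \<in> set p \<Longrightarrow> tail H e \<in> S \<longleftrightarrow> head H e \<in> S"
  shows "\<forall>w\<in>set (pre_digraph.awalk_verts H u p). w \<in> S \<longleftrightarrow> u \<in> S"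
  using assms
  by (induction p arbitrary: u) (auto simp: pre_digraph.cas.simps pre_digraph.awalk_verts.simps)

text \<open>Otherwise the trail would remain on the side of its start, although it visits every
  vertex.\<close>

lemma closed_euler_trail_crosses:
  assumes "has_closed_euler_trail (add_arcs G E)" "finite (parcs G)"
    and "x \<in> pverts G" "x \<in> S" "y \<in> pverts G" "y \<notin> S"
  obtains u v where "(u, v) \<in> parcs G \<or> (u, v) \<in># E" "(u \<in> S) \<noteq> (v \<in> S)"
proof -
  let ?H = "add_arcs G E"
  obtain z p where p: "pre_digraph.euler_trail ?H z p z"
    using assms(1) by (auto simp: has_closed_euler_trail_def)
  then have cas: "pre_digraph.cas ?H z p z" and sp: "set p = arcs ?H"
    and sv: "set (pre_digraph.awalk_verts ?H z p) = pverts G"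
    by (auto simp: pre_digraph.euler_trail_def pre_digraph.trail_def pre_digraph.awalk_def add_arcs_simps)
  obtain e where e: "e \<in> arcs ?H" "(tail ?H e \<in> S) \<noteq> (head ?H e \<in> S)"
    using cas_same_side[OF cas, of S] sp sv assms(3-6) by blast
  obtain u v i where uvi: "e = ((u, v), i)" by (metis prod.exhaust)
  have "(u, v) \<in># arcs_mset G E"
    using e(1) uvi by (intro count_inI) (simp add: add_arcs_simps)
  then have "(u, v) \<in> parcs G \<or> (u, v) \<in># E"
    using assms(2) by auto
  then show ?thesis
    using that e(2) uvi by (auto simp: add_arcs_simps)
qed

lemma sum_mset_subtract:
  fixes f g :: "'a \<Rightarrow> rat"
  shows "(\<Sum>a\<in>#M. f a - g a) = (\<Sum>a\<in>#M. f a) - (\<Sum>a\<in>#M. g a)"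
  by (induction M) auto

text \<open>Indicator functions of single vertices as potentials give equal in- and out-degrees;
  Euler's theorem for multigraphs does the rest.\<close>

lemma closed_euler_trailI:
  assumes G: "pair_digraph G" and E: "\<And>u v. (u, v) \<in># E \<Longrightarrow> u \<in> pverts G \<and> v \<in> pverts G"
    and flow: "\<And>\<phi> :: 'a \<Rightarrow> rat. (\<Sum>a\<in>#arcs_mset G E. \<phi> (fst a) - \<phi> (snd a)) = 0"
    and h: "h \<in> pverts G"
    and conn: "\<And>v. v \<in> pverts G \<Longrightarrow> (h, v) \<in> (parcs G \<union> set_mset E)\<^sup>* \<and> (v, h) \<in> (parcs G \<union> set_mset E)\<^sup>*"
  shows "has_closed_euler_trail (add_arcs G E)"
proof -
  interpret G: pair_digraph G by fact
  let ?H = "add_arcs G E" and ?M = "arcs_mset G E"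
  have arc: "fst (fst e) \<in> pverts G \<and> snd (fst e) \<in> pverts G" if "e \<in> arcs ?H" for e
  proof -
    obtain u v i where e: "e = ((u, v), i)" by (metis prod.exhaust)
    have "(u, v) \<in># ?M"
      using that e by (intro count_inI) (simp add: add_arcs_simps)
    then show ?thesis
      using E[of u v] G.in_arcsD1[of u v] G.in_arcsD2[of u v] e by auto
  qed
  interpret H: fin_digraph ?H
  proof (intro fin_digraph.intro wf_digraph.intro fin_digraph_axioms.intro)
    fix e assume "e \<in> arcs ?H"
    from arc[OF this] show "tail ?H e \<in> verts ?H" "head ?H e \<in> verts ?H"
      unfolding add_arcs_simps by blast+
  next
    show "finite (verts ?H)"
      unfolding add_arcs_simps by simp
    show "finite (arcs ?H)"
      unfolding add_arcs_simps using copies_of_arcs[of ?M] by blast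
  qed
  have adj: "u \<rightarrow>\<^bsub>?H\<^esub> v" if "(u, v) \<in> parcs G \<union> set_mset E" for u v
  proof -
    have "(u, v) \<in># ?M"
      using that by auto
    then have "((u, v), 0) \<in> arcs ?H"
      by (simp only: add_arcs_simps mem_Collect_eq prod.case count_greater_zero_iff)
    then show ?thesis
      using H.in_arcs_imp_in_arcs_ends by (fastforce simp: add_arcs_simps(3,4))
  qed
  have reach: "u \<rightarrow>\<^sup>*\<^bsub>?H\<^esub> v" if "(u, v) \<in> (parcs G \<union> set_mset E)\<^sup>*" "u \<in> pverts G" for u v
    using that
  proof (induction rule: rtrancl_induct)
    case base
    then show ?case by (simp add: H.reachable_refl add_arcs_simps)
  next
    case (step y z)
    then show ?case using H.reachable_adj_trans adj by blast
  qed
  have "connected ?H"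
    unfolding connected_def
  proof (rule strongly_connectedI)
    show "verts (with_proj (mk_symmetric ?H)) \<noteq> {}"
      using h by (auto simp: add_arcs_simps)
    fix u v assume "u \<in> verts (with_proj (mk_symmetric ?H))" "v \<in> verts (with_proj (mk_symmetric ?H))"
    then have "u \<in> pverts G" "v \<in> pverts G" by (auto simp: add_arcs_simps)
    then have "u \<rightarrow>\<^sup>*\<^bsub>?H\<^esub> h" "h \<rightarrow>\<^sup>*\<^bsub>?H\<^esub> v"
      using reach conn h by blast+
    then have "u \<rightarrow>\<^sup>*\<^bsub>?H\<^esub> v"
      using H.reachable_trans by blast
    then show "u \<rightarrow>\<^sup>*\<^bsub>with_proj (mk_symmetric ?H)\<^esub> v"
      by (rule H.reachable_mk_symmetricI)
  qed
  moreover have "in_degree ?H v = out_degree ?H v" for v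
  proof -
    have *: "rat_of_nat (card {e \<in> arcs ?H. P (fst e)}) = (\<Sum>a\<in>#?M. of_bool (P a))" for P
    proof -
      have "rat_of_nat (card {e \<in> arcs ?H. P (fst e)}) = (\<Sum>e\<in>arcs ?H. of_bool (P (fst e)))"
        using H.finite_arcs by (simp add: sum_of_bool_eq Collect_conj_eq)
      then show ?thesis
        using copies_of_arcs[of ?M "\<lambda>a. of_bool (P a)"] by (simp add: add_arcs_simps)
    qed
    have "(\<Sum>a\<in>#?M. of_bool (fst a = v)) = (\<Sum>a\<in>#?M. of_bool (snd a = v) :: rat)"
      using flow[of "\<lambda>x. of_bool (x = v)"] by (simp add: sum_mset_subtract)
    then have "rat_of_nat (card {e \<in> arcs ?H. fst (fst e) = v}) = rat_of_nat (card {e \<in> arcs ?H. snd (fst e) = v})"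
      using *[of "\<lambda>a. fst a = v"] *[of "\<lambda>a. snd a = v"] by simp
    then show ?thesis
      by (simp add: in_degree_def out_degree_def in_arcs_def out_arcs_def add_arcs_simps(3,4))
  qed
  ultimately show ?thesis
    unfolding has_closed_euler_trail_def using H.closed_euler1 by blast
qed

section \<open>Correctness of the construction\<close>

lemma distinct_concat_map:
  assumes "distinct xs" "\<And>x. x \<in> set xs \<Longrightarrow> distinct (f x)"
    and "\<And>x y. x \<in> set xs \<Longrightarrow> y \<in> set xs \<Longrightarrow> x \<noteq> y \<Longrightarrow> set (f x) \<inter> set (f y) = {}"
  shows "distinct (concat (map f xs))"
  using assms
proof (induction xs)
  case (Cons x xs)
  have "set (f x) \<inter> set (f y) = {}" if "y \<in> set xs" for y
    using Cons.prems(1) Cons.prems(3)[of x y] that by auto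
  then have "set (f x) \<inter> set (concat (map f xs)) = {}"
    by auto
  then show ?case
    using Cons by simp
qed simp

text \<open>Correctness depends on \<open>W\<close> only through these bounds and is kept apart from
  the program.\<close>

locale cover_instance =
  fixes W :: nat and cs :: "nat list" and xs :: "nat list list list"
  assumes distinct_cs: "distinct cs"
    and hub_less: "hub < 2 ^ W"
    and code_less: "c \<in> set cs \<Longrightarrow> code c < 2 ^ W"
    and position_length: "S \<in> set xs \<Longrightarrow> p \<in> set S \<Longrightarrow> length p \<le> W"
    and position_colors: "S \<in> set xs \<Longrightarrow> p \<in> set S \<Longrightarrow> set p \<subseteq> set cs"
begin

definition D :: "(nat \<times> nat list list) list" where
  "D = levelled 1 xs"

definition code_set :: "nat set" where
  "code_set = insert hub (code ` set cs)"

definition K :: "key set" where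
  "K = set (all_keys cs xs)"

definition A :: "(key \<times> key) set" where
  "A = set (all_arcs xs)"

definition G :: "point pair_pre_digraph" where
  "G = \<lparr>pverts = place W ` K, parcs = map_prod (place W) (place W) ` A\<rparr>"

section \<open>Levels and codes that occur in an instance\<close>

lemma D_snd: "s \<in> set D \<Longrightarrow> snd s \<in> set xs"
  using map_snd_levelled[of 1 xs] unfolding D_def by (metis image_eqI set_map)

lemma D_pos: "s \<in> set D \<Longrightarrow> 0 < fst s"
  using levelled_ge[of s 1 xs] unfolding D_def by simp

lemma D_disjoint: "s \<in> set D \<Longrightarrow> t \<in> set D \<Longrightarrow> s = t \<or> top_level s < fst t \<or> top_level t < fst s"
  unfolding D_def by (rule levelled_disjoint)

lemma fst_less_top_level: "fst s < top_level s"
  by (simp add: top_level_def)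

lemma src_inj: "s \<in> set D \<Longrightarrow> t \<in> set D \<Longrightarrow> fst s = fst t \<Longrightarrow> s = t"
  using D_disjoint[of s t] fst_less_top_level[of s] fst_less_top_level[of t] by linarith

lemma K_cases:
  assumes "k \<in> K"
  obtains (anchor) a where "a \<in> code_set" "k = Anchor a"
  | (switch) s where "s \<in> set D" "k \<in> set (switch_keys s)"
  using assms unfolding K_def all_keys_def code_set_def D_def by auto

lemma anchor_in_K: "a \<in> code_set \<Longrightarrow> Anchor a \<in> K"
  unfolding K_def all_keys_def code_set_def by auto

lemma switch_keys_in_K: "s \<in> set D \<Longrightarrow> k \<in> set (switch_keys s) \<Longrightarrow> k \<in> K"
  unfolding K_def all_keys_def D_def by auto

lemma hub_in_code_set: "hub \<in> code_set"
  by (simp add: code_set_def)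

lemma finite_code_set: "finite code_set"
  by (simp add: code_set_def)

text \<open>Codes of colors are odd, the code of the hub is even.\<close>

lemma card_code_set: "card code_set = length cs + 1"
proof -
  have "hub \<notin> code ` set cs"
    by (auto simp: code_def)
  moreover have "inj_on code (set cs)"
    by (auto simp: code_def inj_on_def)
  ultimately show ?thesis
    using distinct_cs by (simp add: code_set_def card_image distinct_card)
qed

lemma code_set_bounds: "a \<in> code_set \<Longrightarrow> 0 < a \<and> a < 2 ^ W"
  using hub_less code_less by (auto simp: code_set_def code_def)

lemma switch_occ_props:
  assumes "s \<in> set D" "Occ m l a \<in> set (switch_occs s)"
  shows "fst s < m" "m < top_level s" "l \<le> W" "a \<in> code_set"
proof -
  obtain p where p: "(m, p) \<in> set (boxes s)" "Occ m l a \<in> set (box_occs (m, p))"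
    using assms(2) unfolding Occ_in_switch by blast
  show "fst s < m" "m < top_level s"
    using boxes_level[OF p(1)] by auto
  have S: "p \<in> set (snd s)" "snd s \<in> set xs"
    using boxes_level[OF p(1)] D_snd assms(1) by auto
  have la: "l < length (hub # map code p)" "a = (hub # map code p) ! l"
    using p(2) by (auto simp: set_box_occs in_set_enumerate_eq)
  show "l \<le> W"
    using la(1) position_length[OF S(2,1)] by simp
  have "a \<in> set (hub # map code p)"
    unfolding la(2) using la(1) by (rule nth_mem)
  then show "a \<in> code_set"
    using position_colors[OF S(2,1)] by (auto simp: code_set_def)
qed

lemma switch_key_cases:
  assumes "k \<in> set (switch_keys s)"
  obtains (src) "k = src s" | (snk) "k = snk s" | (occ) m l a where "k = Occ m l a" "k \<in> set (switch_occs s)"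
proof -
  from assms consider "k = src s" | "k = snk s" | "k \<in> set (switch_occs s)"
    unfolding switch_keys_def by auto
  then show thesis
  proof cases
    case 3
    then show thesis using occ switch_occs_Occ by blast
  qed (use src snk in blast)+
qed

lemma K_valid:
  assumes "k \<in> K"
  shows "valid W k"
  using assms
proof (cases rule: K_cases)
  case (anchor a)
  then show ?thesis using code_set_bounds by simp
next
  case (switch s)
  from switch(2) show ?thesis
  proof (cases rule: switch_key_cases)
    case (occ m l a)
    then show ?thesis using switch_occ_props[OF switch(1), of m l a] code_set_bounds by auto
  qed (use D_pos[OF switch(1)] in \<open>auto simp: top_level_def\<close>)
qed

lemma place_inj_on: "inj_on (place W) K"
  using place_inj K_valid by (intro inj_onI) blast

lemma switch_keys_pos: "s \<in> set D \<Longrightarrow> k \<in> set (switch_keys s) \<Longrightarrow> 0 < xlevel k \<and> 0 < ylevel k"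
  using switch_keys_levels[of k s] D_pos[of s] by linarith

lemma switch_keys_disjoint:
  assumes "s \<in> set D" "t \<in> set D" "k \<in> set (switch_keys s)" "k \<in> set (switch_keys t)"
  shows "s = t"
  using D_disjoint[OF assms(1,2)] switch_keys_levels[OF assms(3)] switch_keys_levels[OF assms(4)] by linarith

text \<open>The intended comparabilities, in combinatorial terms; \<open>descends_iff\<close> shows
  that the plane has no others. From there on the geometry enters the arguments about extensions
  through this relation alone.\<close>

inductive descends :: "key \<Rightarrow> key \<Rightarrow> bool" where
  src_occ: "s \<in> set D \<Longrightarrow> v \<in> set (switch_occs s) \<Longrightarrow> descends (src s) v"
| src_snk: "s \<in> set D \<Longrightarrow> descends (src s) (snk s)"
| occ_snk: "s \<in> set D \<Longrightarrow> u \<in> set (switch_occs s) \<Longrightarrow> descends u (snk s)"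
| occ_occ: "s \<in> set D \<Longrightarrow> Occ m l a \<in> set (switch_occs s) \<Longrightarrow> Occ m l' a' \<in> set (switch_occs s) \<Longrightarrow>
    a' < a \<Longrightarrow> descends (Occ m l a) (Occ m l' a')"

lemma descends_K: "descends u v \<Longrightarrow> u \<in> K \<and> v \<in> K"
  by (induction rule: descends.induct) (auto intro!: switch_keys_in_K simp: switch_keys_def)

lemma descends_iff: "descends u v \<longleftrightarrow> u \<in> K \<and> v \<in> K \<and> u \<noteq> v \<and> above W u v"
proof (intro iffI conjI)
  assume uv: "descends u v"
  then show "u \<in> K" "v \<in> K" using descends_K by auto
  then have V: "valid W u" "valid W v" using K_valid by auto
  show "u \<noteq> v"
    using uv by cases (auto dest!: switch_occs_Occ simp: top_level_def)
  show "above W u v"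
    using uv
  proof cases
    case (src_occ s)
    obtain m l a where v: "v = Occ m l a" using switch_occs_Occ src_occ(3) by blast
    show ?thesis
      using src_occ switch_occ_props[of s m l a] v by (intro above_of_levels V) auto
  next
    case (src_snk s)
    then show ?thesis
      using fst_less_top_level[of s] by (intro above_of_levels V) auto
  next
    case (occ_snk s)
    obtain m l a where u: "u = Occ m l a" using switch_occs_Occ occ_snk(3) by blast
    show ?thesis
      using occ_snk switch_occ_props[of s m l a] u by (intro above_of_levels V) auto
  next
    case (occ_occ s m l a l' a')
    then show ?thesis
      using above_Occ_iff V by auto
  qed
next
  assume uv: "u \<in> K \<and> v \<in> K \<and> u \<noteq> v \<and> above W u v"
  then have V: "valid W u" "valid W v" using K_valid by auto
  have lev: "xlevel v \<le> xlevel u" "ylevel u \<le> ylevel v"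
    using above_levels[OF V] uv by auto
  from uv have "u \<in> K" "v \<in> K" by auto
  from \<open>u \<in> K\<close> show "descends u v"
  proof (cases rule: K_cases)
    case (anchor a)
    from \<open>v \<in> K\<close> show ?thesis
    proof (cases rule: K_cases)
      case (anchor b)
      then show ?thesis using uv \<open>u = Anchor a\<close> by (auto simp: above_def)
    next
      \<comment> \<open>An anchor has level 0 in both coordinates, which makes it incomparable with
        all vertices of switches.\<close>
      case (switch t)
      then show ?thesis using switch_keys_pos lev \<open>u = Anchor a\<close> by fastforce
    qed
  next
    case (switch s)
    note s = switch
    from \<open>v \<in> K\<close> show ?thesis
    proof (cases rule: K_cases)
      case (anchor b)
      then show ?thesis using switch_keys_pos[OF s] lev by auto
    next
      case (switch t)
      \<comment> \<open>Of two different switches, the one at the higher levels has the larger first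
        but the smaller second coordinates.\<close>
      have "s = t"
        using D_disjoint[OF s(1) switch(1)] switch_keys_levels[OF s(2)] switch_keys_levels[OF switch(2)] lev
        by linarith
      with switch have v: "v \<in> set (switch_keys s)" by simp
      from s(2) show ?thesis
      proof (cases rule: switch_key_cases)
        case src
        from v show ?thesis
          by (cases rule: switch_key_cases) (use src uv s(1) in \<open>auto intro: descends.intros\<close>)
      next
        case snk
        from v show ?thesis
        proof (cases rule: switch_key_cases)
          case (occ m l a)
          then show ?thesis
            using switch_occ_props(1)[OF s(1), of m l a] lev snk by auto
        qed (use snk uv lev fst_less_top_level[of s] in auto)
      next
        case (occ m l a)
        note u = occ
        from v show ?thesis
        proof (cases rule: switch_key_cases)
          case src
          then show ?thesis
            using switch_occ_props(2)[OF s(1), of m l a] lev u by auto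
        next
          case snk
          then show ?thesis using u s(1) by (auto intro: descends.intros)
        next
          case (occ m' l' a')
          then have "m' = m" using lev u by simp
          then have "a' < a"
            using above_Occ_iff[of W m l a l' a'] V uv u occ by auto
          then show ?thesis
            using u occ s(1) \<open>m' = m\<close> by (auto intro: descends.intros)
        qed
      qed
    qed
  qed
qed

lemma A_cases:
  assumes "(u, v) \<in> A"
  obtains (snk_src) s where "s \<in> set D" "u = snk s" "v = src s"
  | (occ_anchor) s m l a where "s \<in> set D" "u = Occ m l a" "v = Anchor a" "u \<in> set (switch_occs s)"
  | (anchor_occ) s m l a where "s \<in> set D" "v = Occ m l a" "u = Anchor a" "v \<in> set (switch_occs s)"
proof -
  from assms obtain s where s: "s \<in> set D" "(u, v) \<in> set (switch_arcs s)"
    unfolding A_def all_arcs_def D_def by auto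
  then consider "u = snk s \<and> v = src s"
    | k where "k \<in> set (switch_occs s)" "(u, v) \<in> set (occ_arcs k)"
    unfolding switch_arcs_def by auto
  then show thesis
  proof cases
    case (2 k)
    obtain m l a where "k = Occ m l a" using switch_occs_Occ 2 by blast
    with 2 have "(u = Occ m l a \<and> v = Anchor a) \<or> (v = Occ m l a \<and> u = Anchor a)"
      "Occ m l a \<in> set (switch_occs s)"
      by (auto simp: occ_arcs_def)
    then show thesis
      using s(1) occ_anchor anchor_occ by blast
  qed (use s(1) snk_src in blast)
qed

lemma snk_src_in_A: "s \<in> set D \<Longrightarrow> (snk s, src s) \<in> A"
  unfolding A_def all_arcs_def switch_arcs_def D_def by auto

lemma occ_anchor_in_A:
  assumes "s \<in> set D" "Occ m l a \<in> set (switch_occs s)"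
  shows "(Occ m l a, Anchor a) \<in> A" "(Anchor a, Occ m l a) \<in> A"
proof -
  have "set (occ_arcs (Occ m l a)) \<subseteq> set (switch_arcs s)"
    using assms(2) unfolding switch_arcs_def by auto
  then show "(Occ m l a, Anchor a) \<in> A" "(Anchor a, Occ m l a) \<in> A"
    using assms(1) unfolding A_def all_arcs_def D_def occ_arcs_def by auto
qed

lemma A_in_K: "(u, v) \<in> A \<Longrightarrow> u \<in> K \<and> v \<in> K \<and> u \<noteq> v"
  by (erule A_cases)
    (auto intro: switch_keys_in_K anchor_in_K switch_occ_props(4) simp: switch_keys_def)

lemma finite_K: "finite K" and finite_A: "finite A"
  by (simp_all add: K_def A_def)

lemma G_pair_digraph: "pair_digraph G"
proof
  fix e assume "e \<in> parcs G"
  then obtain u v where e: "e = (place W u, place W v)" "(u, v) \<in> A"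
    unfolding G_def by auto
  show "fst e \<in> pverts G" "snd e \<in> pverts G"
    using e A_in_K unfolding G_def by auto
  show "fst e \<noteq> snd e"
    using e A_in_K inj_onD[OF place_inj_on] by fastforce
qed (auto simp: G_def finite_K finite_A)

section \<open>Vertex and arc lists without repetitions\<close>

lemma distinct_switch_occs: "distinct (switch_occs s)"
  unfolding switch_occs_def
proof (rule distinct_concat_map)
  show "distinct (boxes s)"
    by (simp add: boxes_def)
  fix x assume "x \<in> set (boxes s)"
  show "distinct (box_occs x)"
    unfolding box_occs_def by (auto simp: distinct_map inj_on_def simp del: enumerate_simps)
next
  fix x y assume "x \<in> set (boxes s)" "y \<in> set (boxes s)" "x \<noteq> y"
  then have "fst x \<noteq> fst y"
    using boxes_unique by (metis prod.collapse)
  then show "set (box_occs x) \<inter> set (box_occs y) = {}"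
    by (auto simp: box_occs_def)
qed

lemma distinct_all_keys: "distinct (all_keys cs xs)"
proof -
  have "distinct (concat (map switch_keys D))"
  proof (rule distinct_concat_map)
    show "distinct D"
      by (simp add: D_def distinct_levelled)
    show "distinct (switch_keys s)" for s
      using distinct_switch_occs by (auto simp: switch_keys_def dest: switch_occs_Occ)
    show "set (switch_keys s) \<inter> set (switch_keys t) = {}" if "s \<in> set D" "t \<in> set D" "s \<noteq> t" for s t
      using switch_keys_disjoint that by blast
  qed
  moreover have "distinct (hub # map code cs)"
    using distinct_cs card_code_set by (intro card_distinct) (simp add: code_set_def)
  then have "distinct (map Anchor (hub # map code cs))"
    by (subst distinct_map) (simp only: inj_on_def key.inject, simp)
  moreover have "Anchor a \<notin> set (concat (map switch_keys D))" for a
    using switch_keys_pos by fastforce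
  ultimately show ?thesis
    unfolding all_keys_def D_def[symmetric] by (auto simp del: list.map)
qed

lemma distinct_all_arcs: "distinct (all_arcs xs)"
  unfolding all_arcs_def D_def[symmetric]
proof (rule distinct_concat_map)
  show "distinct D"
    by (simp add: D_def distinct_levelled)
next
  fix s assume "s \<in> set D"
  have "distinct (concat (map occ_arcs (switch_occs s)))"
  proof (rule distinct_concat_map[OF distinct_switch_occs])
    fix k assume "k \<in> set (switch_occs s)"
    then show "distinct (occ_arcs k)"
      by (auto simp: occ_arcs_def dest: switch_occs_Occ)
  next
    fix k k' assume "k \<in> set (switch_occs s)" "k' \<in> set (switch_occs s)" "k \<noteq> k'"
    then show "set (occ_arcs k) \<inter> set (occ_arcs k') = {}"
      by (auto simp: occ_arcs_def dest!: switch_occs_Occ)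
  qed
  then show "distinct (switch_arcs s)"
    by (auto simp: switch_arcs_def occ_arcs_def)
next
  fix s t assume st: "s \<in> set D" "t \<in> set D" "s \<noteq> t"
  \<comment> \<open>Every arc names a vertex of its switch: its tail, or its head if the tail is an
    anchor. Hence arcs of different switches differ.\<close>
  have key: "\<exists>k\<in>set (switch_keys r). k = fst e \<or> (fst e \<in> range Anchor \<and> k = snd e)"
    if "e \<in> set (switch_arcs r)" for e r
  proof -
    from that consider "e = (snk r, src r)" | k where "k \<in> set (switch_occs r)" "e \<in> set (occ_arcs k)"
      unfolding switch_arcs_def by auto
    then show ?thesis
    proof cases
      case 1
      then show ?thesis by (simp add: switch_keys_def)
    next
      case (2 k)
      then have "k \<in> set (switch_keys r)" "k = fst e \<or> (fst e \<in> range Anchor \<and> k = snd e)"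
        by (auto simp: switch_keys_def occ_arcs_def)
      then show ?thesis by blast
    qed
  qed
  show "set (switch_arcs s) \<inter> set (switch_arcs t) = {}"
  proof (rule equals0I)
    fix e assume "e \<in> set (switch_arcs s) \<inter> set (switch_arcs t)"
    then obtain k k' where k: "k \<in> set (switch_keys s)" "k = fst e \<or> fst e \<in> range Anchor \<and> k = snd e"
      and k': "k' \<in> set (switch_keys t)" "k' = fst e \<or> fst e \<in> range Anchor \<and> k' = snd e"
      using key by (metis IntE)
    have "k \<notin> range Anchor" "k' \<notin> range Anchor"
      using switch_keys_pos[OF st(1) k(1)] switch_keys_pos[OF st(2) k'(1)] by auto
    then have "k = k'" using k k' by metis
    then show False using switch_keys_disjoint[OF st(1,2) k(1)] k'(1) st(3) by simp
  qed
qed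

end

lemma sum_mset_nonneg:
  fixes f :: "'a \<Rightarrow> rat"
  assumes "\<And>a. a \<in># M \<Longrightarrow> 0 \<le> f a"
  shows "0 \<le> (\<Sum>a\<in>#M. f a)"
  using assms by (induction M) auto

lemma sum_mset_pos:
  fixes f :: "'a \<Rightarrow> rat"
  assumes "\<And>a. a \<in># M \<Longrightarrow> 0 \<le> f a" "b \<in># M" "0 < f b"
  shows "0 < (\<Sum>a\<in>#M. f a)"
proof -
  obtain N where N: "M = add_mset b N" using assms(2) by (metis mset_add)
  have "0 \<le> (\<Sum>a\<in>#N. f a)"
    using assms(1) N by (intro sum_mset_nonneg) auto
  then show ?thesis using N assms(3) by simp
qed

lemma size_le_sum_mset:
  fixes f :: "'a \<Rightarrow> rat"
  assumes "\<And>a. a \<in># M \<Longrightarrow> 1 \<le> f a"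
  shows "of_nat (size M) \<le> (\<Sum>a\<in>#M. f a)"
proof -
  have "(\<Sum>a\<in>#M. 1) \<le> (\<Sum>a\<in>#M. f a)"
    using assms by (intro sum_mset_mono)
  then show ?thesis by simp
qed

lemma box_occs_code:
  assumes "Occ m l a \<in> set (box_occs (m, p))"
  shows "a \<in> set (hub # map code p)"
proof -
  have "l < length (hub # map code p)" "a = (hub # map code p) ! l"
    using assms by (auto simp: set_box_occs in_set_enumerate_eq)
  then show ?thesis using nth_mem by blast
qed

text \<open>Turns a choice per list position into a function on the entries, so that the later
  arguments need no indices.\<close>

lemma choose_along_list:
  assumes "list_all2 P ps (map h xs)" "distinct xs"
  shows "\<exists>f. (\<forall>x\<in>set xs. P (f x) (h x)) \<and> map f xs = ps"
  using assms
proof (induction xs arbitrary: ps)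
  case Nil
  then show ?case by simp
next
  case (Cons x xs)
  then obtain p qs where ps: "ps = p # qs" "P p (h x)" "list_all2 P qs (map h xs)"
    by (auto simp: list_all2_Cons2)
  then obtain f where f: "\<forall>x\<in>set xs. P (f x) (h x)" "map f xs = qs"
    using Cons by auto
  have "map (f(x := p)) xs = map f xs"
    using Cons.prems(2) by (intro map_cong) auto
  then show ?case
    using f ps Cons.prems(2) by (intro exI[of _ "f(x := p)"]) auto
qed

section \<open>Passing between extensions and multisets of arcs on symbolic vertices\<close>

context cover_instance begin

text \<open>Star arcs cancel in pairs, so of the fixed arcs only those from sinks to sources count.
  What is left says that the extension is a flow with supply 1 at each source and demand 1 at each
  sink.\<close>

definition balanced :: "(key \<times> key) multiset \<Rightarrow> bool" where
  "balanced E \<longleftrightarrow> (\<forall>\<psi> :: key \<Rightarrow> rat.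
     (\<Sum>a\<in>#E. \<psi> (fst a) - \<psi> (snd a)) = (\<Sum>s\<leftarrow>D. \<psi> (src s) - \<psi> (snk s)))"

lemma parcs_flow:
  fixes \<phi> :: "point \<Rightarrow> rat"
  shows "(\<Sum>a\<in>#mset_set (parcs G). \<phi> (fst a) - \<phi> (snd a)) =
    - (\<Sum>s\<leftarrow>D. \<phi> (place W (src s)) - \<phi> (place W (snk s)))"
proof -
  let ?g = "\<lambda>a. \<phi> (place W (fst a)) - \<phi> (place W (snd a))"
  have "inj_on (map_prod (place W) (place W)) A"
    by (rule inj_on_subset[OF map_prod_inj_on[OF place_inj_on place_inj_on]]) (use A_in_K in auto)
  then have "mset_set (parcs G) = image_mset (map_prod (place W) (place W)) (mset_set A)"
    by (simp add: G_def image_mset_mset_set)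
  also have "mset_set A = mset (all_arcs xs)"
    unfolding A_def by (rule mset_set_set[OF distinct_all_arcs])
  finally have "(\<Sum>a\<in>#mset_set (parcs G). \<phi> (fst a) - \<phi> (snd a)) = (\<Sum>a\<in>#mset (all_arcs xs). ?g a)"
    by (simp add: multiset.map_comp comp_def)
  also have "\<dots> = (\<Sum>a\<leftarrow>all_arcs xs. ?g a)"
    by (simp flip: mset_map add: sum_mset_sum_list)
  also have "\<dots> = (\<Sum>s\<leftarrow>D. \<phi> (place W (snk s)) - \<phi> (place W (src s)))"
  proof -
    have "(\<Sum>a\<leftarrow>concat (map occ_arcs ks). ?g a) = 0" for ks
      by (induction ks) (auto simp: occ_arcs_def)
    then have "(\<Sum>a\<leftarrow>switch_arcs s. ?g a) = \<phi> (place W (snk s)) - \<phi> (place W (src s))" for s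
      by (simp add: switch_arcs_def)
    then have "(\<Sum>a\<leftarrow>concat (map switch_arcs ss). ?g a) =
        (\<Sum>s\<leftarrow>ss. \<phi> (place W (snk s)) - \<phi> (place W (src s)))" for ss
      by (induction ss) simp_all
    then show ?thesis by (simp add: all_arcs_def D_def)
  qed
  also have "(\<Sum>s\<leftarrow>ss. \<phi> (place W (snk s)) - \<phi> (place W (src s))) =
      - (\<Sum>s\<leftarrow>ss. \<phi> (place W (src s)) - \<phi> (place W (snk s)))" for ss
    by (induction ss) auto
  finally show ?thesis .
qed

text \<open>Connectivity through cuts, so that no paths have to be handled. Two kinds of cuts are
  used below: a source with its sink, and the star of a color.\<close>

definition crosses :: "(key \<times> key) multiset \<Rightarrow> bool" where
  "crosses E \<longleftrightarrow> (\<forall>S x y. x \<in> K \<and> x \<in> S \<and> y \<in> K \<and> y \<notin> S \<longrightarrow>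
     (\<exists>u v. ((u, v) \<in> A \<or> (u, v) \<in># E) \<and> (u \<in> S) \<noteq> (v \<in> S)))"

lemma crossesE:
  assumes "crosses E" "x \<in> K" "x \<in> S" "y \<in> K" "y \<notin> S"
  obtains u v where "(u, v) \<in> A \<or> (u, v) \<in># E" "(u \<in> S) \<noteq> (v \<in> S)"
proof -
  from assms(1) have "\<exists>u v. ((u, v) \<in> A \<or> (u, v) \<in># E) \<and> (u \<in> S) \<noteq> (v \<in> S)"
    unfolding crosses_def by (elim allE[where x = S] allE[where x = x] allE[where x = y] impE) (use assms in simp_all)
  then show thesis
    by (elim exE conjE) (rule that)
qed

lemma extensionE:
  assumes "is_extension G E"
  obtains E' where "size E' = size E" "\<And>u v. (u, v) \<in># E' \<Longrightarrow> descends u v" "balanced E'" "crosses E'"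
proof -
  define key where "key = inv_into K (place W)"
  define E' where "E' = image_mset (map_prod key key) E"
  have key: "key (place W k) = k" if "k \<in> K" for k
    unfolding key_def using inv_into_f_f[OF place_inj_on that] .
  have arcs: "\<exists>u v. a = (place W u, place W v) \<and> descends u v" if "a \<in># E" for a
  proof -
    obtain p q where a: "a = (p, q)" by (cases a)
    then have "p \<in> pverts G" "q \<in> pverts G" "p \<noteq> q" "list_all2 (\<ge>) p q"
      using assms that unfolding is_extension_def by blast+
    then obtain u v where "u \<in> K" "v \<in> K" "p = place W u" "q = place W v"
      unfolding G_def by auto
    then show ?thesis
      using a \<open>p \<noteq> q\<close> \<open>list_all2 (\<ge>) p q\<close> ge_place_iff unfolding descends_iff by blast
  qed
  have key2: "map_prod key key (place W u, place W v) = (u, v)" if "descends u v" for u v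
    using that descends_K key by auto
  show thesis
  proof (rule that[of E'])
    show "size E' = size E"
      by (simp add: E'_def)
    show "descends u v" if uv: "(u, v) \<in># E'" for u v
    proof -
      obtain a where a: "a \<in># E" "(u, v) = map_prod key key a"
        using uv by (auto simp: E'_def)
      then show ?thesis using arcs[of a] key2 by auto
    qed
    have trail: "has_closed_euler_trail (add_arcs G E)"
      using assms by (simp add: is_extension_def)
    show "balanced E'"
      unfolding balanced_def
    proof
      fix \<psi> :: "key \<Rightarrow> rat"
      have "(\<Sum>a\<in>#E. \<psi> (key (fst a)) - \<psi> (key (snd a))) =
          (\<Sum>s\<leftarrow>D. \<psi> (key (place W (src s))) - \<psi> (key (place W (snk s))))"
        using closed_euler_trail_flow[OF trail, of "\<lambda>p. \<psi> (key p)"] parcs_flow[of "\<lambda>p. \<psi> (key p)"] by simp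
      also have "\<dots> = (\<Sum>s\<leftarrow>D. \<psi> (src s) - \<psi> (snk s))"
        using switch_keys_in_K by (intro arg_cong[where f = sum_list] map_cong) (auto simp: key switch_keys_def)
      finally show "(\<Sum>a\<in>#E'. \<psi> (fst a) - \<psi> (snd a)) = (\<Sum>s\<leftarrow>D. \<psi> (src s) - \<psi> (snk s))"
        by (simp add: E'_def multiset.map_comp comp_def)
    qed
    show "crosses E'"
      unfolding crosses_def
    proof (intro allI impI)
      fix S x y assume xy: "x \<in> K \<and> x \<in> S \<and> y \<in> K \<and> y \<notin> S"
      let ?S = "{p. key p \<in> S}"
      have "place W x \<in> pverts G" "place W x \<in> ?S" "place W y \<in> pverts G" "place W y \<notin> ?S"
        using xy key by (auto simp: G_def)
      moreover have "finite (parcs G)"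
        by (simp add: G_def finite_A)
      ultimately obtain p q where pq: "(p, q) \<in> parcs G \<or> (p, q) \<in># E" "(p \<in> ?S) \<noteq> (q \<in> ?S)"
        using closed_euler_trail_crosses[OF trail] by blast
      have "(key p, key q) \<in> A \<or> (key p, key q) \<in># E'"
        using pq(1)
      proof
        assume "(p, q) \<in> parcs G"
        then obtain u v where "(u, v) \<in> A" "p = place W u" "q = place W v"
          unfolding G_def by auto
        then show ?thesis using A_in_K key by auto
      next
        assume "(p, q) \<in># E"
        then have "map_prod key key (p, q) \<in># E'"
          unfolding E'_def by (simp only: set_image_mset imageI)
        then show ?thesis by simp
      qed
      then show "\<exists>u v. ((u, v) \<in> A \<or> (u, v) \<in># E') \<and> (u \<in> S) \<noteq> (v \<in> S)"
        using pq(2) by auto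
    qed
  qed
qed

lemma extensionI:
  assumes desc: "\<And>u v. (u, v) \<in># E \<Longrightarrow> descends u v" and bal: "balanced E"
    and conn: "\<And>k. k \<in> K \<Longrightarrow> (Anchor hub, k) \<in> (A \<union> set_mset E)\<^sup>* \<and> (k, Anchor hub) \<in> (A \<union> set_mset E)\<^sup>*"
  shows "is_extension G (image_mset (map_prod (place W) (place W)) E)"
proof -
  let ?E = "image_mset (map_prod (place W) (place W)) E"
  have arcs: "p \<in> pverts G \<and> q \<in> pverts G \<and> p \<noteq> q \<and> list_all2 (\<ge>) p q" if pq: "(p, q) \<in># ?E" for p q
  proof -
    obtain u v where uv: "(u, v) \<in># E" "p = place W u" "q = place W v"
      using pq by auto
    then have "u \<in> K \<and> v \<in> K \<and> u \<noteq> v \<and> above W u v"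
      using desc descends_iff by blast
    then show ?thesis
      using uv ge_place_iff inj_onD[OF place_inj_on, of u v] unfolding G_def by auto
  qed
  have path: "(place W u, place W v) \<in> (parcs G \<union> set_mset ?E)\<^sup>*" if "(u, v) \<in> (A \<union> set_mset E)\<^sup>*" for u v
    using that
  proof (induction rule: rtrancl_induct)
    case (step y z)
    then have "map_prod (place W) (place W) (y, z) \<in> parcs G \<union> set_mset ?E"
      unfolding G_def by auto
    then have "(place W y, place W z) \<in> parcs G \<union> set_mset ?E"
      by simp
    with step.IH show ?case
      by (rule rtrancl_into_rtrancl)
  qed simp
  have "has_closed_euler_trail (add_arcs G ?E)"
  proof (rule closed_euler_trailI[OF G_pair_digraph, of _ "place W (Anchor hub)"])
    show "(u, v) \<in># ?E \<Longrightarrow> u \<in> pverts G \<and> v \<in> pverts G" for u v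
      using arcs by blast
    show "place W (Anchor hub) \<in> pverts G"
      using anchor_in_K[OF hub_in_code_set] by (simp add: G_def)
    show "(place W (Anchor hub), v) \<in> (parcs G \<union> set_mset ?E)\<^sup>* \<and>
        (v, place W (Anchor hub)) \<in> (parcs G \<union> set_mset ?E)\<^sup>*" if v: "v \<in> pverts G" for v
    proof -
      obtain k where "k \<in> K" "v = place W k"
        using v unfolding G_def by auto
      then show ?thesis using conn path by blast
    qed
    fix \<phi> :: "point \<Rightarrow> rat"
    have "(\<Sum>a\<in>#?E. \<phi> (fst a) - \<phi> (snd a)) = (\<Sum>s\<leftarrow>D. \<phi> (place W (src s)) - \<phi> (place W (snk s)))"
      using bal[unfolded balanced_def, rule_format, of "\<lambda>k. \<phi> (place W k)"]
      by (simp add: multiset.map_comp comp_def)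
    then show "(\<Sum>a\<in>#arcs_mset G ?E. \<phi> (fst a) - \<phi> (snd a)) = 0"
      using parcs_flow[of \<phi>] by simp
  qed
  then show ?thesis
    using arcs unfolding is_extension_def by blast
qed

subsection \<open>The number of extension arcs\<close>

text \<open>Codes are not bounded in terms of the parameter, but their ranks are at most the number
  of colors.\<close>

definition rank :: "nat \<Rightarrow> nat" where
  "rank a = card {b \<in> code_set. b < a}"

lemma rank_less: "a' \<in> code_set \<Longrightarrow> a' < a \<Longrightarrow> rank a' < rank a"
  unfolding rank_def using finite_code_set by (intro psubset_card_mono) auto

lemma rank_less_card: "a \<in> code_set \<Longrightarrow> rank a < card code_set"
  unfolding rank_def using finite_code_set by (intro psubset_card_mono) auto

text \<open>Every extension arc lowers \<open>\<psi>\<close> by at least 1, while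
  \<open>balanced\<close> fixes the total drop at \<open>length cs + 2\<close> per switch, whatever
  the extension looks like.\<close>

lemma size_extension_le:
  assumes "is_extension G E"
  shows "size E \<le> length xs * (length cs + 2)"
proof -
  obtain E' where E': "size E' = size E" "\<And>u v. (u, v) \<in># E' \<Longrightarrow> descends u v" "balanced E'"
    using assms by (rule extensionE) blast
  \<comment> \<open>There are \<open>length cs + 1\<close> codes including the hub, so
    \<open>rank a + 1\<close> lies strictly between the values 0 at sinks and
    \<open>length cs + 2\<close> at sources.\<close>
  define \<psi> :: "key \<Rightarrow> rat" where
    "\<psi> k = (case k of Src _ _ \<Rightarrow> of_nat (length cs + 2) | Occ m l a \<Rightarrow> of_nat (rank a + 1) | _ \<Rightarrow> 0)" for k
  have "1 \<le> \<psi> u - \<psi> v" if "descends u v" for u v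
    using that
  proof cases
    case (src_occ s)
    then obtain m l a where "v = Occ m l a" "a \<in> code_set"
      using switch_occs_Occ switch_occ_props(4) by blast
    then show ?thesis
      using rank_less_card[of a] card_code_set src_occ by (simp add: \<psi>_def)
  next
    case (src_snk s)
    then show ?thesis by (simp add: \<psi>_def)
  next
    case (occ_snk s)
    then obtain m l a where "u = Occ m l a"
      using switch_occs_Occ by blast
    then show ?thesis using occ_snk by (simp add: \<psi>_def)
  next
    case (occ_occ s m l a l' a')
    then have "rank a' < rank a"
      using rank_less switch_occ_props(4) by blast
    then show ?thesis using occ_occ by (simp add: \<psi>_def)
  qed
  then have "of_nat (size E') \<le> (\<Sum>a\<in>#E'. \<psi> (fst a) - \<psi> (snd a))"
    using E'(2) by (intro size_le_sum_mset) auto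
  also have "\<dots> = (\<Sum>s\<leftarrow>D. \<psi> (src s) - \<psi> (snk s))"
    using E'(3) unfolding balanced_def by blast
  also have "\<dots> = of_nat (length D * (length cs + 2))"
    by (simp add: \<psi>_def sum_list_triv algebra_simps)
  also have "length D = length xs"
    unfolding D_def by (metis length_map map_snd_levelled)
  finally show ?thesis
    using E'(1) of_nat_le_iff[where 'a = rat] by metis
qed

subsection \<open>From an extension to a cover\<close>

context
  fixes E assumes desc: "\<And>u v. (u, v) \<in># E \<Longrightarrow> descends u v" and bal: "balanced E" and cross: "crosses E"
begin

text \<open>If a vertex of a box is met by an extension arc, then an arc from the source enters the box:
  otherwise the potential that is positive and increasing along the colors of the box, and zero
  elsewhere, would have a positive total drop.\<close>

lemma box_entered:
  assumes s: "s \<in> set D" "Occ m l a \<in> set (switch_occs s)"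
    and uv: "(u, v) \<in># E" "u = Occ m l a \<or> v = Occ m l a"
  shows "\<exists>l' a'. (src s, Occ m l' a') \<in># E"
proof (rule ccontr)
  assume no: "\<not> ?thesis"
  define \<psi> :: "key \<Rightarrow> rat" where
    "\<psi> k = (case k of Occ m' l a \<Rightarrow> (if m' = m then of_nat (rank a + 1) else 0) | _ \<Rightarrow> 0)" for k
  \<comment> \<open>A box number belongs to a single switch, so no other source has an arc into this
    box.\<close>
  have same: "t = s" if "t \<in> set D" "Occ m l' a' \<in> set (switch_occs t)" for t l' a'
    using switch_keys_disjoint D_disjoint[OF s(1) that(1)] switch_occ_props(1,2)[OF s]
      switch_occ_props(1,2)[OF that] by (metis less_trans not_less_iff_gr_or_eq)
  have drop: "0 \<le> \<psi> x - \<psi> y \<and> (x = Occ m l a \<or> y = Occ m l a \<longrightarrow> 0 < \<psi> x - \<psi> y)"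
    if xy: "(x, y) \<in># E" for x y
    using desc[OF xy]
  proof cases
    case (src_occ t)
    then obtain m' l' a' where y: "y = Occ m' l' a'"
      using switch_occs_Occ by blast
    have "m' \<noteq> m"
    proof
      assume "m' = m"
      then have "t = s" using same src_occ y by simp
      then show False using no xy src_occ y \<open>m' = m\<close> by blast
    qed
    then show ?thesis using src_occ y by (simp add: \<psi>_def)
  next
    case (src_snk t)
    then show ?thesis by (simp add: \<psi>_def)
  next
    case (occ_snk t)
    then obtain m' l' a' where "x = Occ m' l' a'"
      using switch_occs_Occ by blast
    then show ?thesis using occ_snk by (simp add: \<psi>_def)
  next
    case (occ_occ t m' l1 a1 l2 a2)
    then have "rank a2 < rank a1"
      using rank_less switch_occ_props(4) by blast
    then show ?thesis using occ_occ by (auto simp: \<psi>_def)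
  qed
  have "0 < (\<Sum>e\<in>#E. \<psi> (fst e) - \<psi> (snd e))"
  proof (rule sum_mset_pos)
    show "0 \<le> \<psi> (fst e) - \<psi> (snd e)" if "e \<in># E" for e
      using drop[of "fst e" "snd e"] that by simp
    show "(u, v) \<in># E" "0 < \<psi> (fst (u, v)) - \<psi> (snd (u, v))"
      using drop uv by auto
  qed
  also have "\<dots> = 0"
    using bal unfolding balanced_def by (simp add: \<psi>_def)
  finally show False by simp
qed

text \<open>The potential is the indicator of \<open>src s\<close>: its total drop is 1, no
  extension arc enters a source, and each arc leaving \<open>src s\<close> contributes 1. Together
  with \<open>box_entered\<close>, at most one box of a switch is met.\<close>

lemma src_arc_unique:
  assumes s: "s \<in> set D" and vw: "(src s, v) \<in># E" "(src s, w) \<in># E"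
  shows "v = w"
proof (rule ccontr)
  assume ne: "v \<noteq> w"
  define \<psi> :: "key \<Rightarrow> rat" where "\<psi> k = of_bool (k = src s)" for k
  have zero: "\<psi> y = 0" if "(x, y) \<in># E" for x y
    using desc[OF that] by cases (auto simp: \<psi>_def dest: switch_occs_Occ)
  obtain E1 where E1: "E = add_mset (src s, v) E1"
    using vw(1) by (metis mset_add)
  then have "(src s, w) \<in># E1"
    using vw(2) ne by auto
  then obtain E2 where E2: "E = add_mset (src s, v) (add_mset (src s, w) E2)"
    using E1 by (metis mset_add)
  have "\<psi> (fst e) - \<psi> (snd e) \<ge> 0" if "e \<in># E2" for e
    using zero[of "fst e" "snd e"] that E2 by (simp add: \<psi>_def)
  then have "0 \<le> (\<Sum>e\<in>#E2. \<psi> (fst e) - \<psi> (snd e))"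
    by (intro sum_mset_nonneg) auto
  moreover have "\<psi> v = 0" "\<psi> w = 0" "\<psi> (src s) = 1"
    using zero vw by (auto simp: \<psi>_def)
  ultimately have "2 \<le> (\<Sum>e\<in>#E. \<psi> (fst e) - \<psi> (snd e))"
    unfolding E2 by simp
  also have "\<dots> = (\<Sum>t\<leftarrow>D. \<psi> (src t) - \<psi> (snk t))"
    using bal unfolding balanced_def by blast
  also have "\<dots> = (\<Sum>t\<leftarrow>D. of_bool (t = s))"
  proof (intro arg_cong[where f = sum_list] map_cong refl)
    fix t assume "t \<in> set D"
    then have "src t = src s \<longleftrightarrow> t = s"
      using src_inj[of t s] s by auto
    then show "\<psi> (src t) - \<psi> (snk t) = of_bool (t = s)"
      by (simp add: \<psi>_def)
  qed
  also have "\<dots> = (\<Sum>t\<in>set D. of_bool (t = s))"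
    by (rule sum_list_distinct_conv_sum_set) (simp add: D_def distinct_levelled)
  also have "\<dots> = 1"
    using s by (simp add: sum_of_bool_eq)
  finally show False by simp
qed

text \<open>The only fixed arc at the source and the sink joins the two, so connectivity with the
  hub needs an extension arc between this pair and an occurrence; \<open>box_entered\<close> then
  supplies an arc from the source into its box.\<close>

lemma exists_entered_box:
  assumes s: "s \<in> set D"
  shows "\<exists>m p l a. (m, p) \<in> set (boxes s) \<and> (src s, Occ m l a) \<in># E"
proof -
  let ?S = "{src s, snk s}"
  have S: "src s \<in> K" "src s \<in> ?S" "Anchor hub \<in> K" "Anchor hub \<notin> ?S"
    using anchor_in_K[OF hub_in_code_set] switch_keys_in_K[OF s] by (auto simp: switch_keys_def)
  obtain u v where uv: "(u, v) \<in> A \<or> (u, v) \<in># E" "(u \<in> ?S) \<noteq> (v \<in> ?S)"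
    by (rule crossesE[OF cross S])
  have eq: "t = s" if "t \<in> set D" "src t \<in> ?S \<or> snk t \<in> ?S" for t
    using that src_inj[OF that(1) s] by auto
  have "(u, v) \<notin> A"
  proof
    assume "(u, v) \<in> A"
    then show False
      by (cases rule: A_cases) (use uv(2) eq in auto)
  qed
  then have E: "(u, v) \<in># E" using uv by blast
  have "\<exists>k\<in>set (switch_occs s). u = k \<or> v = k"
    using desc[OF E]
  proof cases
    case (src_occ t)
    then show ?thesis using uv(2) eq[of t] by (auto dest: switch_occs_Occ)
  next
    case (src_snk t)
    then show ?thesis using uv(2) eq[of t] by auto
  next
    case (occ_snk t)
    then show ?thesis using uv(2) eq[of t] by (auto dest: switch_occs_Occ)
  next
    case (occ_occ t m l a l' a')
    then show ?thesis using uv(2) by auto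
  qed
  then obtain m l a where k: "Occ m l a \<in> set (switch_occs s)" "u = Occ m l a \<or> v = Occ m l a"
    using switch_occs_Occ by metis
  moreover obtain p where "(m, p) \<in> set (boxes s)"
    using k(1) unfolding Occ_in_switch by blast
  ultimately show ?thesis
    using box_entered[OF s k(1) E k(2)] by blast
qed

text \<open>The cut is the star of the color. No fixed arc leaves a star, and the anchor of the hub
  lies outside.\<close>

lemma anchor_met:
  assumes "a \<in> code_set" "a \<noteq> hub"
  shows "\<exists>s m l u v. s \<in> set D \<and> Occ m l a \<in> set (switch_occs s) \<and> (u, v) \<in># E \<and> (u = Occ m l a \<or> v = Occ m l a)"
proof -
  let ?S = "insert (Anchor a) {Occ m l a | m l. True}"
  have S: "Anchor a \<in> K" "Anchor a \<in> ?S" "Anchor hub \<in> K" "Anchor hub \<notin> ?S"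
    using anchor_in_K hub_in_code_set assms by auto
  obtain u v where uv: "(u, v) \<in> A \<or> (u, v) \<in># E" "(u \<in> ?S) \<noteq> (v \<in> ?S)"
    by (rule crossesE[OF cross S])
  have "(u, v) \<notin> A"
  proof
    assume "(u, v) \<in> A"
    then show False
      by (cases rule: A_cases) (use uv(2) in auto)
  qed
  then have E: "(u, v) \<in># E" using uv by blast
  have "\<exists>s\<in>set D. \<exists>m l. Occ m l a \<in> set (switch_occs s) \<and> (u = Occ m l a \<or> v = Occ m l a)"
    using desc[OF E]
    by cases (use uv(2) in \<open>auto dest: switch_occs_Occ\<close>)
  then show ?thesis using E by blast
qed

text \<open>A color is met in some box, the source enters this box, and by uniqueness it is the box
  chosen for the switch.\<close>

lemma cover_of_extension:
  "\<exists>f. (\<forall>s\<in>set D. f s \<in> set (snd s)) \<and> (\<forall>c\<in>set cs. \<exists>s\<in>set D. c \<in> set (f s))"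
proof -
  have "\<exists>mp. \<forall>s\<in>set D. (fst (mp s), snd (mp s)) \<in> set (boxes s) \<and> (\<exists>l a. (src s, Occ (fst (mp s)) l a) \<in># E)"
    using exists_entered_box by (intro bchoice) (metis fst_conv snd_conv)
  then obtain mp where mp: "\<And>s. s \<in> set D \<Longrightarrow> (fst (mp s), snd (mp s)) \<in> set (boxes s)"
    "\<And>s. s \<in> set D \<Longrightarrow> \<exists>l a. (src s, Occ (fst (mp s)) l a) \<in># E"
    by blast
  show ?thesis
  proof (intro exI[of _ "\<lambda>s. snd (mp s)"] conjI ballI)
    fix s assume "s \<in> set D"
    then show "snd (mp s) \<in> set (snd s)"
      using mp(1) boxes_level by blast
  next
    fix c assume c: "c \<in> set cs"
    have code: "code c \<in> code_set" "code c \<noteq> hub"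
      using c by (auto simp: code_set_def code_def)
    obtain s m l u v where s: "s \<in> set D" and occ: "Occ m l (code c) \<in> set (switch_occs s)"
      and uv: "(u, v) \<in># E" "u = Occ m l (code c) \<or> v = Occ m l (code c)"
      using anchor_met[OF code] by blast
    obtain l' a' where "(src s, Occ m l' a') \<in># E"
      using box_entered[OF s occ uv] by blast
    then have m: "m = fst (mp s)"
      using mp(2)[OF s] src_arc_unique[OF s] by blast
    obtain p where p: "(m, p) \<in> set (boxes s)" "Occ m l (code c) \<in> set (box_occs (m, p))"
      using occ unfolding Occ_in_switch by blast
    then have "p = snd (mp s)"
      using boxes_unique mp(1)[OF s] m by blast
    moreover have "code c \<in> set (hub # map code p)"
      using p(2) by (rule box_occs_code)
    then have "c \<in> set p"
      using code(2) by (auto simp: code_def)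
    ultimately show "\<exists>s\<in>set D. c \<in> set (snd (mp s))"
      using s by blast
  qed
qed

end

end

subsection \<open>From a cover to an extension\<close>

definition steps :: "'a list \<Rightarrow> ('a \<times> 'a) list" where
  "steps ks = zip ks (tl ks)"

lemma steps_Cons: "steps (x # y # ks) = (x, y) # steps (y # ks)"
  by (simp add: steps_def)

lemma steps_single: "steps [x] = []"
  by (simp add: steps_def)

lemma steps_sorted_wrt: "sorted_wrt P ks \<Longrightarrow> (u, v) \<in> set (steps ks) \<Longrightarrow> P u v"
proof (induction ks rule: induct_list012)
  case (3 x y ks)
  then show ?case by (auto simp: steps_Cons)
qed (auto simp: steps_def)

lemma steps_telescope:
  fixes \<psi> :: "'a \<Rightarrow> rat"
  shows "ks \<noteq> [] \<Longrightarrow> (\<Sum>a\<leftarrow>steps ks. \<psi> (fst a) - \<psi> (snd a)) = \<psi> (hd ks) - \<psi> (last ks)"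
  by (induction ks rule: induct_list012) (auto simp: steps_Cons steps_single)

lemma steps_path:
  assumes "set (steps ks) \<subseteq> R" "k \<in> set ks"
  shows "(hd ks, k) \<in> R\<^sup>* \<and> (k, last ks) \<in> R\<^sup>*"
  using assms
proof (induction ks arbitrary: k rule: induct_list012)
  case (3 x y ks)
  then have IH: "(y, k) \<in> R\<^sup>* \<and> (k, last (y # ks)) \<in> R\<^sup>*" if "k \<in> set (y # ks)" for k
    using that by (auto simp: steps_Cons)
  have "(x, y) \<in> R"
    using 3 by (simp add: steps_Cons)
  then show ?case
    using IH[of y] IH[of k] 3(4) by (auto intro: converse_rtrancl_into_rtrancl)
qed (auto simp: steps_def)

context cover_instance begin

text \<open>One copy of each repeated color is selected, since copies are incomparable; decreasing
  codes then form a chain, with the hub sorted in like any other code.\<close>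

lemma box_chain_exists:
  assumes s: "s \<in> set D" and p: "p \<in> set (snd s)"
  shows "\<exists>ks. (\<forall>a\<in>set (hub # map code p). \<exists>m l. Occ m l a \<in> set ks) \<and>
    set ks \<subseteq> set (switch_occs s) \<and> sorted_wrt descends ks"
proof -
  obtain m where m: "(m, p) \<in> set (boxes s)"
  proof -
    obtain i where "i < length (snd s)" "snd s ! i = p"
      using p by (auto simp: in_set_conv_nth)
    then have "(Suc (fst s) + i, p) \<in> set (boxes s)"
      by (auto simp: boxes_def in_set_enumerate_eq)
    then show thesis by (rule that)
  qed
  define B where "B = set (hub # map code p)"
  have "\<exists>l. Occ m l a \<in> set (switch_occs s)" if a: "a \<in> B" for a
  proof -
    obtain l where "l < length (hub # map code p)" "(hub # map code p) ! l = a"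
      using a unfolding B_def in_set_conv_nth by blast
    then have "(l, a) \<in> set (List.enumerate 0 (hub # map code p))"
      by (simp add: in_set_enumerate_eq del: enumerate_simps)
    then have "Occ m l a \<in> set (box_occs (m, p))"
      unfolding set_box_occs by blast
    then show ?thesis
      using m unfolding Occ_in_switch by blast
  qed
  then obtain l where l: "\<And>a. a \<in> B \<Longrightarrow> Occ m (l a) a \<in> set (switch_occs s)"
    by metis
  define ks where "ks = map (\<lambda>a. Occ m (l a) a) (rev (sorted_list_of_set B))"
  have B: "set (sorted_list_of_set B) = B"
    by (rule set_sorted_list_of_set) (simp add: B_def)
  have "sorted_wrt (\<lambda>a b. b < a) (rev (sorted_list_of_set B))"
    by (simp add: sorted_wrt_rev strict_sorted_list_of_set)
  then have "sorted_wrt descends ks"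
    unfolding ks_def sorted_wrt_map
    by (rule sorted_wrt_mono_rel[rotated]) (use B s l in \<open>auto intro!: descends.occ_occ\<close>)
  moreover have "set ks \<subseteq> set (switch_occs s)"
    using B l by (auto simp: ks_def)
  moreover have "\<forall>a\<in>B. \<exists>m l. Occ m l a \<in> set ks"
    using B by (auto simp: ks_def)
  ultimately show ?thesis
    unfolding B_def by blast
qed

text \<open>The fixed arc from sink to source closes each path to a cycle, so the path and all stars
  it visits, the hub among them, are mutually reachable.\<close>

lemma extension_of_cover:
  assumes f: "\<And>s. s \<in> set D \<Longrightarrow> f s \<in> set (snd s)"
    and cover: "\<And>c. c \<in> set cs \<Longrightarrow> \<exists>s\<in>set D. c \<in> set (f s)"
  shows "\<exists>E. is_extension G E"
proof -
  obtain ks where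
    ks_codes: "\<And>s a. s \<in> set D \<Longrightarrow> a \<in> set (hub # map code (f s)) \<Longrightarrow> \<exists>m l. Occ m l a \<in> set (ks s)"
    and ks_occs: "\<And>s. s \<in> set D \<Longrightarrow> set (ks s) \<subseteq> set (switch_occs s)"
    and ks_sorted: "\<And>s. s \<in> set D \<Longrightarrow> sorted_wrt descends (ks s)"
  proof -
    have "\<forall>s\<in>set D. \<exists>ks. (\<forall>a\<in>set (hub # map code (f s)). \<exists>m l. Occ m l a \<in> set ks) \<and>
        set ks \<subseteq> set (switch_occs s) \<and> sorted_wrt descends ks"
      using box_chain_exists f by blast
    from bchoice[OF this] show thesis
      using that by blast
  qed
  define path where "path s = src s # ks s @ [snk s]" for s
  have path_sorted: "sorted_wrt descends (path s)" if s: "s \<in> set D" for s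
    unfolding path_def using ks_sorted[OF s] ks_occs[OF s] s
    by (auto simp: sorted_wrt_append intro: descends.intros)
  define E where "E = mset (concat (map (\<lambda>s. steps (path s)) D))"
  have desc: "descends u v" if "(u, v) \<in># E" for u v
    using that path_sorted steps_sorted_wrt unfolding E_def by fastforce
  have bal: "balanced E"
    unfolding balanced_def
  proof
    fix \<psi> :: "key \<Rightarrow> rat"
    have "(\<Sum>a\<leftarrow>steps (path s). \<psi> (fst a) - \<psi> (snd a)) = \<psi> (src s) - \<psi> (snk s)" for s
      using steps_telescope[of "path s" \<psi>] by (simp add: path_def)
    then have "(\<Sum>a\<leftarrow>concat (map (\<lambda>s. steps (path s)) ss). \<psi> (fst a) - \<psi> (snd a)) =
        (\<Sum>s\<leftarrow>ss. \<psi> (src s) - \<psi> (snk s))" for ss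
      by (induction ss) simp_all
    then show "(\<Sum>a\<in>#E. \<psi> (fst a) - \<psi> (snd a)) = (\<Sum>s\<leftarrow>D. \<psi> (src s) - \<psi> (snk s))"
      unfolding E_def by (simp flip: mset_map add: sum_mset_sum_list del: mset_concat map_concat)
  qed
  let ?R = "A \<union> set_mset E"
  define mutual where "mutual u v \<longleftrightarrow> (u, v) \<in> ?R\<^sup>* \<and> (v, u) \<in> ?R\<^sup>*" for u v
  have sym: "mutual u v \<Longrightarrow> mutual v u" and trans: "mutual u v \<Longrightarrow> mutual v w \<Longrightarrow> mutual u w" for u v w
    unfolding mutual_def by (auto intro: rtrancl_trans)
  have on_path: "mutual (src s) k" if s: "s \<in> set D" and k: "k \<in> set (path s)" for s k
  proof -
    have sub: "set (steps (path s)) \<subseteq> ?R"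
      using s by (auto simp: E_def)
    have "(src s, k) \<in> ?R\<^sup>*" "(k, snk s) \<in> ?R\<^sup>*"
      using steps_path[OF sub k] by (auto simp: path_def)
    moreover have "(snk s, src s) \<in> ?R"
      using snk_src_in_A[OF s] by blast
    ultimately show ?thesis
      unfolding mutual_def by (meson rtrancl_into_rtrancl)
  qed
  have occ: "mutual (Occ m l a) (Anchor a)" if "s \<in> set D" "Occ m l a \<in> set (switch_occs s)" for s m l a
    using occ_anchor_in_A[OF that] unfolding mutual_def by blast
  have path_code: "mutual (src s) (Anchor a)" if s: "s \<in> set D" and a: "a \<in> set (hub # map code (f s))" for s a
  proof -
    obtain m l where k: "Occ m l a \<in> set (ks s)"
      using ks_codes[OF s a] by blast
    then have "Occ m l a \<in> set (path s)" "Occ m l a \<in> set (switch_occs s)"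
      using ks_occs[OF s] by (auto simp: path_def)
    then show ?thesis
      using on_path[OF s] occ[OF s] trans by blast
  qed
  have src_hub: "mutual (src s) (Anchor hub)" if "s \<in> set D" for s
    using path_code[OF that, of hub] by simp
  have anchor: "mutual (Anchor a) (Anchor hub)" if a: "a \<in> code_set" for a
  proof (cases "a = hub")
    case True
    then show ?thesis by (simp add: mutual_def)
  next
    case False
    then obtain c where c: "c \<in> set cs" "a = code c"
      using a by (auto simp: code_set_def)
    then obtain s where "s \<in> set D" "c \<in> set (f s)"
      using cover by blast
    then have "mutual (src s) (Anchor a)" "mutual (src s) (Anchor hub)"
      using path_code[of s a] src_hub c by auto
    then show ?thesis using sym trans by blast
  qed
  have "mutual k (Anchor hub)" if "k \<in> K" for k
    using that
  proof (cases rule: K_cases)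
    case (anchor a)
    then show ?thesis using \<open>a \<in> code_set \<Longrightarrow> mutual (Anchor a) (Anchor hub)\<close> by simp
  next
    case (switch s)
    from switch(2) show ?thesis
    proof (cases rule: switch_key_cases)
      case src
      then show ?thesis using src_hub switch by simp
    next
      case snk
      then have "mutual (src s) k"
        using on_path[OF switch(1)] by (simp add: path_def)
      then show ?thesis using src_hub[OF switch(1)] sym trans by blast
    next
      case (occ m l a)
      then have "mutual k (Anchor a)" "a \<in> code_set"
        using \<open>\<And>s m l a. s \<in> set D \<Longrightarrow> Occ m l a \<in> set (switch_occs s) \<Longrightarrow> mutual (Occ m l a) (Anchor a)\<close>
          switch_occ_props(4)[OF switch(1)] switch(1) by auto
      then show ?thesis
        using \<open>\<And>a. a \<in> code_set \<Longrightarrow> mutual (Anchor a) (Anchor hub)\<close> trans by blast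
    qed
  qed
  then show ?thesis
    using extensionI[OF desc bal] unfolding mutual_def by blast
qed

lemma coverable_iff_extension:
  "switch_coverable (set cs) (map (\<lambda>S. mset (map mset S)) xs) \<longleftrightarrow> (\<exists>E. is_extension G E)"
proof
  assume "switch_coverable (set cs) (map (\<lambda>S. mset (map mset S)) xs)"
  then obtain ps where ps: "list_all2 (\<lambda>p S. p \<in># S) ps (map (\<lambda>S. mset (map mset S)) xs)"
    and cover: "\<forall>c\<in>set cs. \<exists>p\<in>set ps. c \<in># p"
    unfolding switch_coverable_def by blast
  \<comment> \<open>Passing from \<open>xs\<close> to the distinct entries of \<open>D\<close> lets
    equal switches choose different positions.\<close>
  have "list_all2 (\<lambda>p S. p \<in> mset ` set S) ps (map snd D)"
    using ps by (auto simp: D_def list_all2_conv_all_nth)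
  then obtain g where g: "\<forall>s\<in>set D. g s \<in> mset ` set (snd s)" "map g D = ps"
    using choose_along_list[of "\<lambda>p S. p \<in> mset ` set S" ps snd D] distinct_levelled[of 1 xs]
    unfolding D_def by blast
  then have "\<forall>s\<in>set D. \<exists>p. p \<in> set (snd s) \<and> mset p = g s"
    by (metis imageE)
  then obtain f where f: "\<forall>s\<in>set D. f s \<in> set (snd s) \<and> mset (f s) = g s"
    by metis
  show "\<exists>E. is_extension G E"
  proof (rule extension_of_cover)
    show "f s \<in> set (snd s)" if "s \<in> set D" for s
      using f that by blast
    show "\<exists>s\<in>set D. c \<in> set (f s)" if c: "c \<in> set cs" for c
    proof -
      obtain s where "s \<in> set D" "c \<in># g s"
        using cover c unfolding g(2)[symmetric] by (metis imageE list.set_map)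
      then show ?thesis using f by (metis set_mset_mset)
    qed
  qed
next
  assume "\<exists>E. is_extension G E"
  then obtain E where "is_extension G E" by blast
  then obtain E' where E': "\<And>u v. (u, v) \<in># E' \<Longrightarrow> descends u v" "balanced E'" "crosses E'"
    by (rule extensionE) blast
  obtain f where f: "\<forall>s\<in>set D. f s \<in> set (snd s)" "\<forall>c\<in>set cs. \<exists>s\<in>set D. c \<in> set (f s)"
    using cover_of_extension[OF E'] by blast
  have "list_all2 (\<lambda>p S. p \<in># S) (map (\<lambda>s. mset (f s)) D) (map (\<lambda>s. mset (map mset (snd s))) D)"
    using f(1) by (auto simp: list_all2_conv_all_nth)
  also have "map (\<lambda>s. mset (map mset (snd s))) D = map (\<lambda>S. mset (map mset S)) (map snd D)"
    by simp
  also have "map snd D = xs"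
    by (simp add: D_def)
  finally show "switch_coverable (set cs) (map (\<lambda>S. mset (map mset S)) xs)"
    unfolding switch_coverable_def using f(2)
    by (intro exI[of _ "map (\<lambda>s. mset (f s)) D"] conjI) auto
qed

end

section \<open>The reduction\<close>

context cover_instance begin

lemma out_word_encodes: "encodes (eulerian_extension 2) G (out_word W (all_keys cs xs) (all_arcs xs))"
proof -
  let ?p = "map_prod (place W) (place W)"
  let ?vs = "map (place W) (all_keys cs xs)" and ?as = "map ?p (all_arcs xs)"
  have enc: "enc_list enc_rat (place W k) = point_word W k" if "k \<in> K" for k
    using enc_place K_valid that by blast
  have "inj_on ?p A"
    by (rule inj_on_subset[OF map_prod_inj_on[OF place_inj_on place_inj_on]]) (use A_in_K in auto)
  then have "distinct ?vs" "distinct ?as"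
    using place_inj_on distinct_all_keys distinct_all_arcs by (simp_all add: distinct_map K_def A_def)
  have "set ?vs = pverts G" "set ?as = parcs G"
    by (simp_all add: G_def K_def A_def)
  have vmap: "map (\<lambda>x. enc_list enc_rat (place W x)) (all_keys cs xs) = map (point_word W) (all_keys cs xs)"
    using enc by (intro map_cong) (auto simp: K_def)
  have amap: "map (\<lambda>x. enc_pair (enc_list enc_rat) (enc_list enc_rat) (?p x)) (all_arcs xs) =
      map (arc_word W) (all_arcs xs)"
  proof (intro map_cong refl)
    fix x assume "x \<in> set (all_arcs xs)"
    then have "fst x \<in> K" "snd x \<in> K"
      using A_in_K[of "fst x" "snd x"] by (simp_all add: A_def)
    then show "enc_pair (enc_list enc_rat) (enc_list enc_rat) (?p x) = arc_word W x"
      by (simp add: enc_pair_def arc_word_def enc)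
  qed
  have "out_word W (all_keys cs xs) (all_arcs xs) = enc_pair (enc_list (enc_list enc_rat))
      (enc_list (enc_pair (enc_list enc_rat) (enc_list enc_rat))) (?vs, ?as)"
    unfolding out_word_def enc_pair_def[of "enc_list (enc_list enc_rat)"]
      enc_list_def[of "enc_list enc_rat"] enc_list_def[of "enc_pair (enc_list enc_rat) (enc_list enc_rat)"]
    by (simp add: comp_def vmap amap)
  then show ?thesis
    using \<open>distinct ?vs\<close> \<open>distinct ?as\<close> \<open>set ?vs = pverts G\<close> \<open>set ?as = parcs G\<close>
    unfolding eulerian_extension_def by (simp only: param_problem.simps) blast
qed

lemma parameter_le: "parameter (eulerian_extension 2) G \<le> length xs * (length cs + 2)"
proof (cases "\<exists>E. is_extension G E")
  case True
  then have "Max (size ` {E. is_extension G E}) \<in> size ` {E. is_extension G E}"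
    using finite_extension_sizes[OF G_pair_digraph] by (intro Max_in) auto
  then show ?thesis
    using True size_extension_le by (auto simp: eulerian_extension_def)
next
  case False
  then show ?thesis by (auto simp: eulerian_extension_def)
qed

lemma G_instance: "G \<in> instances (eulerian_extension 2)"
  using G_pair_digraph by (auto simp: eulerian_extension_def G_def place_def)

end

text \<open>A total function on words is required, although the program is analysed on encodings of
  instances only; elsewhere the value may be arbitrary.\<close>

definition reduction :: "word \<Rightarrow> word" where
  "reduction w = (THE out. \<exists>t s. run full_prog (initial_store w) t s \<and> s 0 = out)"

lemma reduction_eq: "run full_prog (initial_store w) t s \<Longrightarrow> reduction w = s 0"
  unfolding reduction_def using run_deterministic by (intro the_equality) blast+

lemma switch_set_cover_encodesE:
  assumes "x \<in> instances switch_set_cover" "encodes switch_set_cover x w"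
  obtains cs xs where "distinct cs" "x = (set cs, map (\<lambda>S. mset (map mset S)) xs)" "w = enc_instance cs xs"
    "\<forall>S\<in>set xs. \<forall>p\<in>set S. set p \<subseteq> set cs"
proof -
  obtain C Ss where x: "x = (C, Ss)" by (cases x)
  obtain cs xs where e: "distinct cs" "set cs = C" "map (\<lambda>S. mset (map mset S)) xs = Ss" "w = enc_instance cs xs"
    using assms(2) unfolding x switch_set_cover_def enc_instance_def by auto
  have "set p \<subseteq> set cs" if "S \<in> set xs" "p \<in> set S" for S p
  proof -
    have "mset (map mset S) \<in> set Ss"
      using that(1) e(3) by auto
    then have "is_switch C (mset (map mset S))"
      using assms(1) unfolding x switch_set_cover_def by simp
    moreover have "mset p \<in># mset (map mset S)"
      using that(2) by auto
    ultimately have "is_position C (mset p)"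
      unfolding is_switch_def by blast
    then show ?thesis using e(2) by (simp add: is_position_def)
  qed
  then show thesis
    using that[of cs xs] e x by blast
qed

theorem mainTheorem20:
  shows "poly_param_reducible switch_set_cover (eulerian_extension 2)"
  unfolding poly_param_reducible_def
proof (intro exI conjI ballI allI impI)
  show "polytime_on (codes switch_set_cover) reduction"
    unfolding polytime_on_def
  proof (rule exI[of _ full_prog], rule exI[of _ "[:30, 90000, 45000:]"], rule ballI)
    fix w assume "w \<in> codes switch_set_cover"
    then obtain x where "x \<in> instances switch_set_cover" "encodes switch_set_cover x w"
      unfolding codes_def by blast
    then obtain cs xs where w: "w = enc_instance cs xs"
      and colors: "\<forall>S\<in>set xs. \<forall>p\<in>set S. set p \<subseteq> set cs"
      by (rule switch_set_cover_encodesE)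
    obtain t s where "run full_prog (initial_store w) t s" "t \<le> 45000 * (length w + 2) * length w + 30"
      using run_full_prog[OF w colors] by blast
    moreover have "45000 * (length w + 2) * length w + 30 = poly [:30, 90000, 45000:] (length w)"
      by (simp add: algebra_simps)
    ultimately show "\<exists>t s. run full_prog (initial_store w) t s \<and> s 0 = reduction w \<and>
        t \<le> poly [:30, 90000, 45000:] (length w)"
      using reduction_eq by metis
  qed
next
  fix x w assume "x \<in> instances switch_set_cover" "encodes switch_set_cover x w"
  then obtain cs xs where cs: "distinct cs" and x: "x = (set cs, map (\<lambda>S. mset (map mset S)) xs)"
    and w: "w = enc_instance cs xs"
    and colors: "\<forall>S\<in>set xs. \<forall>p\<in>set S. set p \<subseteq> set cs"
    by (rule switch_set_cover_encodesE)
  note bounds = input_bounds[OF arg_cong[OF w, of length]]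
  interpret cover_instance "length w" cs xs
    using cs bounds colors by unfold_locales (auto intro: less_imp_le)
  have "reduction w = out_word (length w) (all_keys cs xs) (all_arcs xs)"
    using run_full_prog[OF w colors] reduction_eq by metis
  then have "encodes (eulerian_extension 2) G (reduction w)"
    using out_word_encodes by simp
  moreover have "is_yes switch_set_cover x \<longleftrightarrow> is_yes (eulerian_extension 2) G"
    using coverable_iff_extension by (simp add: x switch_set_cover_def eulerian_extension_def)
  \<comment> \<open>The polynomial is \<open>n * (n + 2)\<close>, where \<open>n\<close> is the
    number of colors plus the number of switches.\<close>
  moreover have "parameter (eulerian_extension 2) G \<le> poly [:0, 2, 1:] (parameter switch_set_cover x)"
  proof -
    have "parameter switch_set_cover x = length cs + length xs"
      using cs by (simp add: x switch_set_cover_def distinct_card)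
    moreover have "length xs * (length cs + 2) \<le> (length cs + length xs) * ((length cs + length xs) + 2)"
      by (intro mult_mono) auto
    ultimately show ?thesis
      using parameter_le by (simp add: algebra_simps)
  qed
  ultimately show "\<exists>y\<in>instances (eulerian_extension 2). encodes (eulerian_extension 2) y (reduction w) \<and>
      (is_yes switch_set_cover x \<longleftrightarrow> is_yes (eulerian_extension 2) y) \<and>
      parameter (eulerian_extension 2) y \<le> poly [:0, 2, 1:] (parameter switch_set_cover x)"
    using G_instance by blast
qed

end
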